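(* Let $n\ge 1$. (i) The chain complex $(\mathrm{DEnd}_*(n),\delta)$ is acyclic in positive dimensions: $H_{k}(\mathrm{DEnd}_*(n),\delta)=0$ for all $k>0$. (ii) The map $\mathcal B_0:\mathrm{DEnd}_0(n)\to \mathrm{LDO}(n)$, $\mathcal B_0(f)=f_0$, induces an isomorphism of the $0$th homology group $$H_0(\mathrm{DEnd}_*(n),\delta)\;\cong\;\frac{\{A\in \mathrm{LDO}(n):\ \chi(A\circ \frac{d}{dx^i_j})=0\ \text{for all } 1\le i\le N,\ 1\le j\le n\}}{\{A\in\mathrm{LDO}(n):\ \chi(A)=0\}}.$$ Moreover, $\mathcal B_0$ maps the space of $0$-cycles $Z_0(\mathrm{DEnd}_*(n))=\{f\in \mathrm{DEnd}_0(n):\delta f=0\}$ onto $\{A\in \mathrm{LDO}(n):\ \chi(A\circ\frac{d}{dx^i_j})=0 \text{ for all } i,j\}$.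
   Context: Jets. Let $N\ge1$ and let $E=\mathbf R^N\times\mathbf R\to\mathbf R^N$ be the trivial line bundle, with base coordinates $\mathbf x=(x^1,\dots,x^N)$ and fibre coordinate $u$. The infinite jet bundle $J^\infty E$ has coordinates $(x^i,u_J)$, where $J=(j_1,\dots,j_N)$ runs over multi-indices of non-negative integers, $|J|=j_1+\dots+j_N$. $\mathrm{Loc}(E)$ is the real vector space of local functions: smooth functions of $\mathbf x$ and finitely many of the $u_J$ (pullbacks of smooth functions on some finite jet bundle $J^kE$). The total derivative is $\frac{d}{dx^i}=\frac{\partial}{\partial x^i}+\sum_J u_{iJ}\frac{\partial}{\partial u_J}$, where $iJ$ is $J$ with $j_i$ raised by one; $(\frac d{d\mathbf x})^I=\prod_i(\frac d{dx^i})^{i_i}$ for a multi-index $I=(i_1,\dots,i_N)$ and $(-1)^I=(-1)^{i_1+\dots+i_N}$. For a finitely supported function $\alpha$ from multi-indices to non-negative integers, $(\frac{\partial}{\partial\mathbf u})^\alpha=\prod_J\frac{\partial^{\alpha(J)}}{\partial u_J^{\alpha(J)}}$, and $\deg_f(\alpha)$ is the maximal $|J|$ with $\alpha(J)\ne0$ (and $0$ if $\alpha=0$). Operators. $\mathrm{LDO}(n)$ ($n$-multilinear local differential operators) is the space of $n$-linear maps $A:\mathrm{Loc}(E)^{\otimes n}\to\mathrm{Loc}(E)$ of the form $A(f_1,\dots,f_n)=\sum p_{I_1,\dots,I_n,\alpha_1,\dots,\alpha_n}\prod_{j=1}^n\big((\frac d{d\mathbf x})^{I_j}(\frac\partial{\partial\mathbf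 u})^{\alpha_j}f_j\big)$ with $p_{I_1,\dots,I_n,\alpha_1,\dots,\alpha_n}\in\mathrm{Loc}(E)$, such that for each $m$ only finitely many $p_{I_1,\dots,I_n,\alpha_1,\dots,\alpha_n}$ with $\sum_j\deg_f(\alpha_j)\le m$ are nonzero. Write $\frac d{dx^i_j}$ and $(\frac\partial{\partial\mathbf u_j})^{\alpha}$ for the total derivative $\frac d{dx^i}$ and vertical derivative acting on the $j$-th function; $(A\circ\frac d{dx^i_j})(f_1,\dots,f_n)=A(f_1,\dots,\frac{d}{dx^i}f_j,\dots,f_n)$. Characteristic. Put $\frac d{dy^i_1}=\sum_{j=1}^n\frac d{dx^i_j}$ and $\frac d{dy^i_j}=\frac d{dx^i_j}$ for $2\le j\le n$. Every $A\in\mathrm{LDO}(n)$ can be written in polarized form $A=\sum q_{I_1,\dots,I_n;\alpha_1,\dots,\alpha_n}(\frac d{d\mathbf y_1})^{I_1}\cdots(\frac d{d\mathbf y_n})^{I_n}(\frac\partial{\partial\mathbf u_1})^{\alpha_1}\cdots(\frac\partial{\partial\mathbf u_n})^{\alpha_n}$, and its characteristic is $\chi(A)=\sum(-1)^{I_1}\big((\frac d{d\mathbf x})^{I_1}q_{I_1,\dots,I_n;\alpha_1,\dots,\alpha_n}\big)(\frac d{d\mathbf y_2})^{I_2}\cdots(\frac d{d\mathbf y_n})^{I_n}(\frac\partial{\partial\mathbf u_1})^{\alpha_1}\cdots(\frac\partial{\partial\mathbf u_n})^{\alpha_n}\in\mathrm{LDO}(n)$. Complexes. $\Omega^{k,0}(J^\infty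 E)$ is the free $\mathrm{Loc}(E)$-module with basis $(d\mathbf x)^\epsilon=(dx^1)^{\epsilon^1}\wedge\cdots\wedge(dx^N)^{\epsilon^N}$, $\epsilon\in\{0,1\}^N$, $\sum\epsilon^i=k$; $d_H\omega=\sum_i dx^i\wedge\frac{d}{dx^i}\omega$ ($\frac{d}{dx^i}$ acting on coefficients). Regrade: $\Omega_i(J^\infty E)=\Omega^{N-i,0}(J^\infty E)$ for $0\le i\le N$ (zero otherwise), a chain complex with $\deg d_H=-1$. Tensor powers are over $\mathbf R$, $[\;]_s$ denotes the degree $s$ part, and $d_H^{\otimes n}$ is the standard differential on the tensor power. $\mathrm{DEnd}_k(n)$ is the space of degree $k$ linear maps $f=\{f_s\}$, $f_s:[\Omega_*(J^\infty E)^{\otimes n}]_s\to\Omega_{s+k}(J^\infty E)$, with matrix coefficients in $\mathrm{LDO}(n)$, i.e. $f_s\big(h_1(d\mathbf x)^{\epsilon_1}\otimes\cdots\otimes h_n(d\mathbf x)^{\epsilon_n}\big)=\sum_\epsilon A^{\epsilon_1,\dots,\epsilon_n}_{s,\epsilon}(h_1,\dots,h_n)(d\mathbf x)^\epsilon$ with $A^{\epsilon_1,\dots,\epsilon_n}_{s,\epsilon}\in\mathrm{LDO}(n)$. The differential $\delta:\mathrm{DEnd}_k(n)\to\mathrm{DEnd}_{k-1}(n)$ is $(\delta f)_s=d_Hf_s-(-1)^{\deg f}f_{s-1}d_H^{\otimes n}$. Since $[\Omega_*(J^\infty E)^{\otimes n}]_0=(\Omega^{N,0}(J^\infty E))^{\otimes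 n}\cong\mathrm{Loc}(E)^{\otimes n}$ and $\Omega_0(J^\infty E)=\Omega^{N,0}(J^\infty E)\cong\mathrm{Loc}(E)$ via $h\,dx^1\wedge\cdots\wedge dx^N\leftrightarrow h$, for $f\in\mathrm{DEnd}_0(n)$ the component $f_0$ is regarded as an element of $\mathrm{LDO}(n)$. *)

theory Defs
  imports
    "HOL-Analysis.Analysis"
    "HOL-Algebra.Elementary_Groups"
    "HOL-Library.Poly_Mapping"
begin

section \<open>Conventions\<close>

text \<open>
  The number \<open>N\<close> of base coordinates and the number \<open>n\<close> of arguments of an operator are the
  cardinalities of two type variables \<open>'d\<close> and \<open>'n\<close> of sort \<open>{finite, linorder}\<close>.  Types are
  nonempty, so \<open>N \<ge> 1\<close> and \<open>n \<ge> 1\<close>; a finite linear order is isomorphic to \<open>{1, \<dots>, N}\<close> in a unique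
  way.  The order of \<open>'d\<close> is used for the signs of the wedge product, the order of \<open>'n\<close> for the
  Koszul signs and for singling out the first argument.  A multi-index is a function
  \<open>'d \<Rightarrow> nat\<close>.
\<close>


section \<open>Local functions on the infinite jet space\<close>

datatype 'd coord = Base 'd | Fibre "'d \<Rightarrow> nat"

type_synonym 'd jet = "'d coord \<Rightarrow> real"

definition mi_size :: "('d::finite \<Rightarrow> nat) \<Rightarrow> nat" where
  "mi_size J = (\<Sum>i\<in>UNIV. J i)"

definition mi_raise :: "'d \<Rightarrow> ('d \<Rightarrow> nat) \<Rightarrow> ('d \<Rightarrow> nat)" where
  "mi_raise i J = J(i := Suc (J i))"

definition pd :: "'c \<Rightarrow> (('c \<Rightarrow> real) \<Rightarrow> real) \<Rightarrow> ('c \<Rightarrow> real) \<Rightarrow> real" where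
  "pd c f p = deriv (\<lambda>t. f (p(c := t))) (p c)"

text \<open>
  Smoothness: all iterated partial derivatives exist and are continuous.  Continuity refers to the
  product topology; for a function of finitely many coordinates this is ordinary continuity of the
  function of these coordinates, and \<^term>\<open>smooth\<close> is the ordinary notion of a
  \<open>C\<^sup>\<infinity>\<close> function on a finite-dimensional space.
\<close>

coinductive smooth :: "(('c \<Rightarrow> real) \<Rightarrow> real) \<Rightarrow> bool" where
  smoothI: "continuous_on UNIV f \<Longrightarrow>
    (\<And>c p. (\<lambda>t. f (p(c := t))) differentiable at (p c)) \<Longrightarrow>
    (\<And>c. smooth (pd c f)) \<Longrightarrow> smooth f"

definition depends_upto :: "nat \<Rightarrow> (('d::finite) jet \<Rightarrow> real) \<Rightarrow> bool" where
  "depends_upto k f \<longleftrightarrow>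
     (\<forall>p q. (\<forall>i. p (Base i) = q (Base i)) \<and>
            (\<forall>J. mi_size J \<le> k \<longrightarrow> p (Fibre J) = q (Fibre J)) \<longrightarrow> f p = f q)"

definition local_fun :: "(('d::finite) jet \<Rightarrow> real) \<Rightarrow> bool" where
  "local_fun f \<longleftrightarrow> smooth f \<and> (\<exists>k. depends_upto k f)"


subsection \<open>Closure properties\<close>

inductive smooth_alg :: "(('c \<Rightarrow> real) \<Rightarrow> real) \<Rightarrow> bool" where
  base: "smooth f \<Longrightarrow> smooth_alg f"
| const: "smooth_alg (\<lambda>_. r)"
| coord: "smooth_alg (\<lambda>p. p c)"
| add: "smooth_alg f \<Longrightarrow> smooth_alg g \<Longrightarrow> smooth_alg (\<lambda>p. f p + g p)"
| mult: "smooth_alg f \<Longrightarrow> smooth_alg g \<Longrightarrow> smooth_alg (\<lambda>p. f p * g p)"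

lemma smooth_continuous: "smooth f \<Longrightarrow> continuous_on UNIV f"
  by (erule smooth.cases) auto

lemma smooth_pd: "smooth f \<Longrightarrow> smooth (pd c f)"
  by (erule smooth.cases) auto

lemma smooth_DERIV:
  assumes "smooth f"
  shows "((\<lambda>t. f (p(c := t))) has_field_derivative pd c f (p(c := s))) (at s)"
proof -
  have "(\<lambda>t. f ((p(c := s))(c := t))) differentiable at ((p(c := s)) c)"
    using assms by (cases rule: smooth.cases) blast
  then have "(\<lambda>t. f (p(c := t))) differentiable at s"
    by simp
  then show ?thesis
    unfolding pd_def by (simp add: DERIV_deriv_iff_real_differentiable)
qed

lemma smooth_alg_continuous: "smooth_alg f \<Longrightarrow> continuous_on UNIV f"
  by (induction rule: smooth_alg.induct)
     (auto intro: smooth_continuous continuous_on_product_coordinates continuous_on_add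
        continuous_on_mult)

lemma smooth_alg_DERIV:
  assumes "smooth_alg f"
  shows "\<exists>g. smooth_alg g \<and> (\<forall>p. ((\<lambda>t. f (p(c := t))) has_field_derivative g p) (at (p c)))"
  using assms
proof (induction rule: smooth_alg.induct)
  case (base f)
  have "\<forall>p. ((\<lambda>t. f (p(c := t))) has_field_derivative pd c f p) (at (p c))"
    using smooth_DERIV[OF base, of _ c] by (metis fun_upd_triv)
  then show ?case using smooth_pd[OF base] smooth_alg.base by blast
next
  case (const r)
  show ?case by (rule exI[of _ "\<lambda>_. 0"]) (auto intro: smooth_alg.const)
next
  case (coord c')
  show ?case
    by (rule exI[of _ "\<lambda>_. if c' = c then 1 else 0"]) (auto intro: smooth_alg.const)
next
  case (add f g)
  then obtain f' g' where *: "smooth_alg f'" "smooth_alg g'"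
    "\<forall>p. ((\<lambda>t. f (p(c := t))) has_field_derivative f' p) (at (p c))"
    "\<forall>p. ((\<lambda>t. g (p(c := t))) has_field_derivative g' p) (at (p c))" by blast
  have "((\<lambda>t. f (p(c := t)) + g (p(c := t))) has_field_derivative f' p + g' p) (at (p c))" for p
    using DERIV_add[OF *(3)[rule_format, of p] *(4)[rule_format, of p]] .
  moreover have "smooth_alg (\<lambda>p. f' p + g' p)" using * by (intro smooth_alg.add)
  ultimately show ?case by blast
next
  case (mult f g)
  then obtain f' g' where *: "smooth_alg f'" "smooth_alg g'"
    "\<forall>p. ((\<lambda>t. f (p(c := t))) has_field_derivative f' p) (at (p c))"
    "\<forall>p. ((\<lambda>t. g (p(c := t))) has_field_derivative g' p) (at (p c))" by blast
  have "((\<lambda>t. f (p(c := t)) * g (p(c := t))) has_field_derivative f' p * g p + g' p * f p)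
          (at (p c))" for p
    using DERIV_mult[OF *(3)[rule_format, of p] *(4)[rule_format, of p]] by simp
  moreover have "smooth_alg (\<lambda>p. f' p * g p + g' p * f p)"
    using * mult by (intro smooth_alg.add smooth_alg.mult)
  ultimately show ?case by blast
qed

lemma smooth_alg_smooth: "smooth_alg f \<Longrightarrow> smooth f"
proof (coinduction arbitrary: f)
  case (smooth f)
  have 1: "(\<lambda>t. f (p(c := t))) differentiable at (p c)" for c p
    using smooth_alg_DERIV[OF smooth, of c] by (meson real_differentiable_def)
  have 2: "smooth_alg (pd c f)" for c
  proof -
    obtain g where g: "smooth_alg g"
      "\<forall>p. ((\<lambda>t. f (p(c := t))) has_field_derivative g p) (at (p c))"
      using smooth_alg_DERIV[OF smooth, of c] by blast
    then have "pd c f = g"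
      by (auto simp: pd_def fun_eq_iff intro!: DERIV_imp_deriv)
    with g show ?thesis by simp
  qed
  show ?case using smooth_alg_continuous[OF smooth] 1 2 by blast
qed

text \<open>Symmetry of second derivatives.\<close>

lemma smooth_second_difference:
  fixes f :: "('c \<Rightarrow> real) \<Rightarrow> real" and x y :: real
  assumes f: "smooth f" and ab: "a \<noteq> b" and h: "(0::real) < h"
  shows "\<exists>s t. x < s \<and> s < x + h \<and> y < t \<and> t < y + h \<and>
    f (p(a := x + h, b := y + h)) - f (p(a := x + h, b := y))
      - f (p(a := x, b := y + h)) + f (p(a := x, b := y))
    = h * (h * pd b (pd a f) (p(a := s, b := t)))"
proof -
  have D: "((\<lambda>s. f (p(a := s, b := t))) has_field_derivative pd a f (p(a := s, b := t))) (at s)"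
    for s t using smooth_DERIV[OF f, of "p(b := t)" a s] ab by (simp add: fun_upd_twist)
  obtain s where s: "x < s" "s < x + h" and
    "(f (p(a := x + h, b := y + h)) - f (p(a := x + h, b := y)))
       - (f (p(a := x, b := y + h)) - f (p(a := x, b := y)))
     = (x + h - x) * (pd a f (p(a := s, b := y + h)) - pd a f (p(a := s, b := y)))"
    using MVT2[of x "x + h" "\<lambda>s. f (p(a := s, b := y + h)) - f (p(a := s, b := y))"
        "\<lambda>s. pd a f (p(a := s, b := y + h)) - pd a f (p(a := s, b := y))"]
      DERIV_diff[OF D D] h by auto
  moreover obtain t where t: "y < t" "t < y + h" and
    "pd a f (p(a := s, b := y + h)) - pd a f (p(a := s, b := y))
     = (y + h - y) * pd b (pd a f) (p(a := s, b := t))"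
    using MVT2[of y "y + h" "\<lambda>t. pd a f (p(a := s, b := t))"
        "\<lambda>t. pd b (pd a f) (p(a := s, b := t))"]
      smooth_DERIV[OF smooth_pd[OF f, of a], where p = "p(a := s)" and c = b] h by auto
  ultimately show ?thesis
    by (intro exI[of _ s] exI[of _ t]) (simp add: algebra_simps)
qed

lemma pd_commute:
  fixes f :: "('c \<Rightarrow> real) \<Rightarrow> real"
  assumes f: "smooth f"
  shows "pd a (pd b f) = pd b (pd a f)"
proof (cases "a = b")
  case ab: False
  show ?thesis
  proof
    fix p :: "'c \<Rightarrow> real"
    define x y where "x = p a" and "y = p b"
    define \<Delta> where "\<Delta> h = f (p(a := x + h, b := y + h)) - f (p(a := x + h, b := y))
      - f (p(a := x, b := y + h)) + f (p(a := x, b := y))" for h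
    have p: "p(a := x, b := y) = p" by (simp add: x_def y_def)
    have lim: "(\<lambda>n. \<Delta> (1 / real (Suc n)) * (real (Suc n))\<^sup>2) \<longlonglongrightarrow> g p"
      if g: "continuous_on UNIV g" and
        ex: "\<And>h. 0 < h \<Longrightarrow> \<exists>s t. x < s \<and> s < x + h \<and> y < t \<and> t < y + h \<and>
               \<Delta> h = h * (h * g (p(a := s, b := t)))" for g
    proof -
      have "\<forall>n. \<exists>s t. x < s \<and> s < x + 1 / real (Suc n) \<and> y < t \<and> t < y + 1 / real (Suc n) \<and>
               \<Delta> (1 / real (Suc n)) = 1 / real (Suc n) * (1 / real (Suc n) * g (p(a := s, b := t)))"
        by (intro allI ex) simp
      then obtain s t where st: "\<And>n. x < s n" "\<And>n. s n < x + 1 / real (Suc n)"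
          "\<And>n. y < t n" "\<And>n. t n < y + 1 / real (Suc n)"
        and e: "\<And>n. \<Delta> (1 / real (Suc n))
            = 1 / real (Suc n) * (1 / real (Suc n) * g (p(a := s n, b := t n)))"
        by metis
      have inv: "(\<lambda>n. z + 1 / real (Suc n)) \<longlonglongrightarrow> z" for z :: real
        using LIMSEQ_inverse_real_of_nat_add[of z] by (simp add: inverse_eq_divide)
      have s: "s \<longlonglongrightarrow> x"
        by (rule tendsto_sandwich[OF _ _ tendsto_const inv])
           (auto intro!: always_eventually less_imp_le st simp del: of_nat_Suc)
      have t: "t \<longlonglongrightarrow> y"
        by (rule tendsto_sandwich[OF _ _ tendsto_const inv])
           (auto intro!: always_eventually less_imp_le st simp del: of_nat_Suc)
      have "continuous_on UNIV (\<lambda>z::real \<times> real. p(a := fst z, b := snd z))"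
      proof (rule continuous_on_coordinatewise_then_product)
        fix i
        show "continuous_on UNIV (\<lambda>z::real \<times> real. (p(a := fst z, b := snd z)) i)"
          by (cases "i = b"; cases "i = a") (auto intro!: continuous_intros)
      qed
      then have "continuous_on UNIV (\<lambda>z. g (p(a := fst z, b := snd z)))"
        by (rule continuous_on_compose2[OF g]) auto
      then have "(\<lambda>n. g (p(a := fst (s n, t n), b := snd (s n, t n))))
            \<longlonglongrightarrow> g (p(a := fst (x, y), b := snd (x, y)))"
        by (rule continuous_on_tendsto_compose) (auto intro: tendsto_Pair s t)
      moreover have "\<Delta> (1 / real (Suc n)) * (real (Suc n))\<^sup>2 = g (p(a := s n, b := t n))" for n
        unfolding e by (simp add: power2_eq_square del: of_nat_Suc)
      ultimately show ?thesis by (simp add: p del: of_nat_Suc)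
    qed
    have "(\<lambda>n. \<Delta> (1 / real (Suc n)) * (real (Suc n))\<^sup>2) \<longlonglongrightarrow> pd b (pd a f) p"
      using smooth_second_difference[OF f ab, of _ x y p]
      by (intro lim[of "pd b (pd a f)"] smooth_continuous smooth_pd f) (simp add: \<Delta>_def)
    moreover have "(\<lambda>n. \<Delta> (1 / real (Suc n)) * (real (Suc n))\<^sup>2) \<longlonglongrightarrow> pd a (pd b f) p"
    proof (intro lim[of "pd a (pd b f)"] smooth_continuous smooth_pd f)
      fix h :: real assume "0 < h"
      from smooth_second_difference[OF f ab[symmetric] this, of y x p]
      obtain s t where "y < s \<and> s < y + h \<and> x < t \<and> t < x + h \<and>
        f (p(b := y + h, a := x + h)) - f (p(b := y + h, a := x))
          - f (p(b := y, a := x + h)) + f (p(b := y, a := x))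
        = h * (h * pd a (pd b f) (p(b := s, a := t)))" by blast
      then show "\<exists>s t. x < s \<and> s < x + h \<and> y < t \<and> t < y + h \<and>
               \<Delta> h = h * (h * pd a (pd b f) (p(a := s, b := t)))"
        using ab by (intro exI[of _ t] exI[of _ s]) (simp add: \<Delta>_def fun_upd_twist)
    qed
    ultimately show "pd a (pd b f) p = pd b (pd a f) p"
      by (metis LIMSEQ_unique)
  qed
qed simp

lemma depends_uptoD:
  assumes "depends_upto k f" "\<And>i. p (Base i) = q (Base i)"
    and "\<And>J. mi_size J \<le> k \<Longrightarrow> p (Fibre J) = q (Fibre J)"
  shows "f p = f q"
  by (rule assms(1)[unfolded depends_upto_def, THEN spec, THEN spec, THEN mp])
     (simp add: assms(2,3))

lemma depends_uptoI:
  assumes "\<And>p q. (\<And>i. p (Base i) = q (Base i)) \<Longrightarrow>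
    (\<And>J. mi_size J \<le> k \<Longrightarrow> p (Fibre J) = q (Fibre J)) \<Longrightarrow> f p = f q"
  shows "depends_upto k f"
  unfolding depends_upto_def by (intro allI impI assms) simp_all

lemma depends_upto_mono:
  fixes f :: "'d::finite jet \<Rightarrow> real"
  assumes "depends_upto k f" "k \<le> l"
  shows "depends_upto l f"
proof (rule depends_uptoI)
  fix p q :: "'d jet"
  assume "\<And>i. p (Base i) = q (Base i)"
    and "\<And>J. mi_size J \<le> l \<Longrightarrow> p (Fibre J) = q (Fibre J)"
  with assms(2) show "f p = f q" by (intro depends_uptoD[OF assms(1)]) simp_all
qed

lemma local_fun_const: "local_fun (\<lambda>_. r)"
  unfolding local_fun_def by (auto simp: depends_upto_def smooth_alg_smooth[OF smooth_alg.const])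

lemma local_fun_coord: "local_fun (\<lambda>p. p c)"
proof -
  have "depends_upto (case c of Base _ \<Rightarrow> 0 | Fibre J \<Rightarrow> mi_size J) (\<lambda>p. p c)"
    by (cases c) (auto simp: depends_upto_def)
  then show ?thesis
    unfolding local_fun_def by (intro conjI exI smooth_alg_smooth smooth_alg.coord)
qed

lemma local_fun_comb:
  fixes f g :: "'d::finite jet \<Rightarrow> real"
  assumes "local_fun f" "local_fun g"
  shows "local_fun (\<lambda>p. f p + g p)" "local_fun (\<lambda>p. f p * g p)"
proof -
  obtain k l where "depends_upto k f" "depends_upto l g"
    using assms unfolding local_fun_def by blast
  then have kl: "depends_upto (max k l) f" "depends_upto (max k l) g"
    by (auto elim: depends_upto_mono)
  have fg: "f p = f q" "g p = g q"
    if "\<And>i. p (Base i) = q (Base i)"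
      "\<And>J. mi_size J \<le> max k l \<Longrightarrow> p (Fibre J) = q (Fibre J)" for p q
    by (rule depends_uptoD[OF kl(1) that] depends_uptoD[OF kl(2) that]; assumption)+
  have "depends_upto (max k l) (\<lambda>p. f p + g p)"
    by (rule depends_uptoI, rule arg_cong2[where f = "(+)"]; rule fg; assumption)
  moreover have "depends_upto (max k l) (\<lambda>p. f p * g p)"
    by (rule depends_uptoI, rule arg_cong2[where f = "(*)"]; rule fg; assumption)
  moreover have "smooth_alg f" "smooth_alg g"
    using assms by (simp_all add: local_fun_def smooth_alg.base)
  then have "smooth (\<lambda>p. f p + g p)" "smooth (\<lambda>p. f p * g p)"
    by (rule smooth_alg_smooth[OF smooth_alg.add], rule smooth_alg_smooth[OF smooth_alg.mult])
  ultimately show "local_fun (\<lambda>p. f p + g p)" "local_fun (\<lambda>p. f p * g p)"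
    unfolding local_fun_def by blast+
qed

lemma depends_upto_pd:
  assumes "depends_upto k f"
  shows "depends_upto k (pd c f)"
proof (rule depends_uptoI)
  fix p q :: "'a coord \<Rightarrow> real"
  assume pq: "\<And>i. p (Base i) = q (Base i)"
    "\<And>J. mi_size J \<le> k \<Longrightarrow> p (Fibre J) = q (Fibre J)"
  have eq: "(\<lambda>t. f (p(c := t))) = (\<lambda>t. f (q(c := t)))"
    by (intro ext depends_uptoD[OF assms]) (simp_all add: pq)
  consider "p c = q c" | J where "c = Fibre J" "\<not> mi_size J \<le> k"
    using pq by (metis coord.exhaust)
  then show "pd c f p = pd c f q"
  proof cases
    case 1
    then show ?thesis by (simp add: pd_def eq)
  next
    case J: 2
    have "(\<lambda>t. f (r(c := t))) = (\<lambda>_. f r)" for r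
      using J by (intro ext depends_uptoD[OF assms]) auto
    then show ?thesis by (simp add: pd_def)
  qed
qed

lemma local_fun_pd: "local_fun f \<Longrightarrow> local_fun (pd c f)"
  unfolding local_fun_def by (auto intro: smooth_pd intro!: exI elim!: depends_upto_pd)


subsection \<open>The algebra of local functions\<close>

typedef (overloaded) 'd loc = "{f :: ('d::finite) jet \<Rightarrow> real. local_fun f}"
  morphisms loc_apply Abs_loc
  using local_fun_const by blast

setup_lifting type_definition_loc

instantiation loc :: (finite) "{comm_ring_1, real_algebra_1}"
begin

lift_definition zero_loc :: "'a loc" is "\<lambda>_. 0" by (rule local_fun_const)
lift_definition one_loc :: "'a loc" is "\<lambda>_. 1" by (rule local_fun_const)
lift_definition plus_loc :: "'a loc \<Rightarrow> 'a loc \<Rightarrow> 'a loc" is "\<lambda>f g p. f p + g p"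
  by (rule local_fun_comb)
lift_definition times_loc :: "'a loc \<Rightarrow> 'a loc \<Rightarrow> 'a loc" is "\<lambda>f g p. f p * g p"
  by (rule local_fun_comb)
lift_definition uminus_loc :: "'a loc \<Rightarrow> 'a loc" is "\<lambda>f p. - f p"
  using local_fun_comb(2)[OF local_fun_const[of "-1"]] by simp
lift_definition minus_loc :: "'a loc \<Rightarrow> 'a loc \<Rightarrow> 'a loc" is "\<lambda>f g p. f p - g p"
  using local_fun_comb(1)[OF _ local_fun_comb(2)[OF local_fun_const[of "-1"]]] by simp
lift_definition scaleR_loc :: "real \<Rightarrow> 'a loc \<Rightarrow> 'a loc" is "\<lambda>r f p. r * f p"
  by (rule local_fun_comb(2)[OF local_fun_const])

instance
proof
  show "(0::'a loc) \<noteq> 1" by transfer (simp add: fun_eq_iff)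
qed (transfer; simp add: fun_eq_iff algebra_simps)+

end

lift_definition jet_coord :: "'d::finite coord \<Rightarrow> 'd loc" is "\<lambda>c p. p c"
  by (rule local_fun_coord)

lift_definition partial :: "'d::finite coord \<Rightarrow> 'd loc \<Rightarrow> 'd loc" is pd
  by (rule local_fun_pd)

text \<open>The sum over all multi-indices is finite, see \<open>finite_partial\<close> below.\<close>

definition total_deriv :: "'d::finite \<Rightarrow> 'd loc \<Rightarrow> 'd loc" where
  "total_deriv i f = partial (Base i) f +
     Sum_any (\<lambda>J. jet_coord (Fibre (mi_raise i J)) * partial (Fibre J) f)"

lemma partial_commute: "partial c (partial c' f) = partial c' (partial c f)"
  by transfer (simp add: local_fun_def pd_commute)

lemma loc_has_partial:
  "((\<lambda>t. loc_apply f (p(c := t))) has_field_derivative loc_apply (partial c f) p) (at (p c))"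
proof -
  have "smooth (loc_apply f)" using loc_apply[of f] by (simp add: local_fun_def)
  from smooth_DERIV[OF this, of p c "p c"] show ?thesis by (simp add: partial.rep_eq)
qed

lemma partial_eqI:
  assumes "\<And>p. ((\<lambda>t. loc_apply f (p(c := t))) has_field_derivative loc_apply g p) (at (p c))"
  shows "partial c f = g"
proof -
  have "loc_apply (partial c f) = loc_apply g"
    using assms by (auto simp: partial.rep_eq pd_def fun_eq_iff intro!: DERIV_imp_deriv)
  then show ?thesis by (simp add: loc_apply_inject)
qed

lemma partial_add: "partial c (f + g) = partial c f + partial c g"
proof (rule partial_eqI)
  fix p
  show "((\<lambda>t. loc_apply (f + g) (p(c := t))) has_field_derivative
          loc_apply (partial c f + partial c g) p) (at (p c))"
    unfolding plus_loc.rep_eq by (rule DERIV_add[OF loc_has_partial loc_has_partial])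
qed

lemma partial_mult: "partial c (f * g) = partial c f * g + f * partial c g"
proof (rule partial_eqI)
  fix p
  show "((\<lambda>t. loc_apply (f * g) (p(c := t))) has_field_derivative
          loc_apply (partial c f * g + f * partial c g) p) (at (p c))"
    using DERIV_mult[OF loc_has_partial[of f p c] loc_has_partial[of g p c]]
    by (simp add: plus_loc.rep_eq times_loc.rep_eq algebra_simps)
qed

lemma partial_zero: "partial c 0 = 0"
  by (rule partial_eqI) (simp add: zero_loc.rep_eq)

lemma partial_jet_coord: "partial c (jet_coord c') = (if c = c' then 1 else 0)"
  by (rule partial_eqI) (auto simp: jet_coord.rep_eq zero_loc.rep_eq one_loc.rep_eq)

lemma finite_mi_size: "finite {J :: 'd::finite \<Rightarrow> nat. mi_size J \<le> k}"
proof -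
  have "J i \<le> mi_size J" for J :: "'d \<Rightarrow> nat" and i
    unfolding mi_size_def by (rule member_le_sum) simp_all
  then have "J i \<le> k" if "mi_size J \<le> k" for J :: "'d \<Rightarrow> nat" and i
    using that le_trans by blast
  then have "{J :: 'd \<Rightarrow> nat. mi_size J \<le> k} \<subseteq> Pi UNIV (\<lambda>_. {..k})"
    by blast
  moreover have "finite (Pi (UNIV :: 'd set) (\<lambda>_. {..k}))"
    unfolding PiE_UNIV_domain[symmetric] by (rule finite_PiE) simp_all
  ultimately show ?thesis by (rule finite_subset)
qed

lemma finite_partial: "finite {J. partial (Fibre J) (f :: 'd::finite loc) \<noteq> 0}"
proof -
  obtain k where k: "depends_upto k (loc_apply f)"
    using loc_apply[of f] by (auto simp: local_fun_def)
  have "partial (Fibre J) f = 0" if "\<not> mi_size J \<le> k" for J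
  proof (rule partial_eqI)
    fix p :: "'d jet"
    have "(\<lambda>t. loc_apply f (p(Fibre J := t))) = (\<lambda>_. loc_apply f p)"
      using that by (intro ext depends_uptoD[OF k]) auto
    then show "((\<lambda>t. loc_apply f (p(Fibre J := t))) has_field_derivative loc_apply 0 p)
                 (at (p (Fibre J)))"
      by (simp add: zero_loc.rep_eq)
  qed
  then show ?thesis by (intro finite_subset[OF _ finite_mi_size[of k]]) auto
qed

lemma total_deriv_sum:
  assumes "finite W" "{J. partial (Fibre J) f \<noteq> 0} \<subseteq> W"
  shows "total_deriv i f =
    partial (Base i) f + (\<Sum>J\<in>W. jet_coord (Fibre (mi_raise i J)) * partial (Fibre J) f)"
proof -
  have "{J. jet_coord (Fibre (mi_raise i J)) * partial (Fibre J) f \<noteq> 0} \<subseteq> W"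
    using assms(2) by auto
  from Sum_any.expand_superset[OF assms(1) this] show ?thesis
    by (simp only: total_deriv_def)
qed

lemma total_deriv_zero: "total_deriv i 0 = 0"
  by (subst total_deriv_sum[of "{}"]) (auto simp: partial_zero)

lemma total_deriv_add: "total_deriv i (f + g) = total_deriv i f + total_deriv i g"
proof -
  define W where "W = {J. partial (Fibre J) f \<noteq> 0} \<union> {J. partial (Fibre J) g \<noteq> 0}"
  have "finite W" by (simp add: W_def finite_partial)
  moreover have "{J. partial (Fibre J) f \<noteq> 0} \<subseteq> W" "{J. partial (Fibre J) g \<noteq> 0} \<subseteq> W"
    "{J. partial (Fibre J) (f + g) \<noteq> 0} \<subseteq> W" by (auto simp: W_def partial_add)
  ultimately have "total_deriv i h = partial (Base i) h
      + (\<Sum>J\<in>W. jet_coord (Fibre (mi_raise i J)) * partial (Fibre J) h)"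
    if "h \<in> {f, g, f + g}" for h
    using that by (auto intro!: total_deriv_sum)
  then show ?thesis by (simp add: partial_add sum.distrib distrib_left)
qed

lemma total_deriv_sum_distrib: "total_deriv i (sum F A) = (\<Sum>a\<in>A. total_deriv i (F a))"
  by (induction A rule: infinite_finite_induct) (auto simp: total_deriv_zero total_deriv_add)

lemma total_deriv_mult: "total_deriv i (f * g) = total_deriv i f * g + f * total_deriv i g"
proof -
  define W where "W = {J. partial (Fibre J) f \<noteq> 0} \<union> {J. partial (Fibre J) g \<noteq> 0}"
  have "finite W" by (simp add: W_def finite_partial)
  moreover have "{J. partial (Fibre J) f \<noteq> 0} \<subseteq> W" "{J. partial (Fibre J) g \<noteq> 0} \<subseteq> W"
    "{J. partial (Fibre J) (f * g) \<noteq> 0} \<subseteq> W" by (auto simp: W_def partial_mult)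
  ultimately have W: "total_deriv i h = partial (Base i) h
      + (\<Sum>J\<in>W. jet_coord (Fibre (mi_raise i J)) * partial (Fibre J) h)"
    if "h \<in> {f, g, f * g}" for h
    using that by (auto intro!: total_deriv_sum)
  have "(\<Sum>J\<in>W. jet_coord (Fibre (mi_raise i J)) * partial (Fibre J) (f * g))
      = (\<Sum>J\<in>W. jet_coord (Fibre (mi_raise i J)) * partial (Fibre J) f) * g
        + f * (\<Sum>J\<in>W. jet_coord (Fibre (mi_raise i J)) * partial (Fibre J) g)"
    by (simp add: partial_mult distrib_left sum.distrib sum_distrib_left sum_distrib_right mult_ac)
  then show ?thesis by (simp add: W partial_mult distrib_left distrib_right add_ac)
qed

lemma total_deriv_jet_coord:
  "total_deriv i (jet_coord (Fibre J)) = jet_coord (Fibre (mi_raise i J))"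
  by (subst total_deriv_sum[of "{J}"]) (auto simp: partial_jet_coord)

lemma mi_raise_commute: "mi_raise i (mi_raise k J) = mi_raise k (mi_raise i J)"
  by (cases "i = k") (auto simp: mi_raise_def fun_upd_twist)

lemma total_deriv_commute:
  "total_deriv i (total_deriv k f) = total_deriv k (total_deriv i f)"
proof -
  define W where "W = {J. partial (Fibre J) f \<noteq> 0}"
  define V where "V = W \<union> (\<Union>c \<in> range Base \<union> Fibre ` W. {J. partial (Fibre J) (partial c f) \<noteq> 0})"
  have fW: "finite W" by (simp add: W_def finite_partial)
  then have fV: "finite V" by (simp add: V_def finite_partial)
  have VW: "W \<subseteq> V" by (simp add: V_def)
  have 0: "total_deriv i f = partial (Base i) f
      + (\<Sum>J\<in>V. jet_coord (Fibre (mi_raise i J)) * partial (Fibre J) f)" for i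
    using fV VW by (intro total_deriv_sum) (auto simp: W_def)
  have 1: "total_deriv i (partial c f) = partial (Base i) (partial c f)
      + (\<Sum>J\<in>V. jet_coord (Fibre (mi_raise i J)) * partial (Fibre J) (partial c f))"
    if "c \<in> range Base \<union> range Fibre" for i c
  proof (cases "c \<in> range Base \<union> Fibre ` W")
    case True
    then show ?thesis using fV by (intro total_deriv_sum) (auto simp: V_def)
  next
    case False
    with that have "partial c f = 0" by (auto simp: W_def)
    then show ?thesis by (simp add: partial_zero total_deriv_zero)
  qed
  have 2: "total_deriv i (total_deriv k f) =
      partial (Base i) (partial (Base k) f)
      + (\<Sum>J\<in>V. jet_coord (Fibre (mi_raise i J)) * partial (Fibre J) (partial (Base k) f))
      + (\<Sum>J\<in>V. jet_coord (Fibre (mi_raise k J)) * partial (Fibre J) (partial (Base i) f))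
      + (\<Sum>J\<in>V. jet_coord (Fibre (mi_raise i (mi_raise k J))) * partial (Fibre J) f)
      + (\<Sum>J\<in>V. \<Sum>K\<in>V. jet_coord (Fibre (mi_raise k J)) * jet_coord (Fibre (mi_raise i K))
           * partial (Fibre K) (partial (Fibre J) f))" for i k
    by (simp add: 0[of k] 1 total_deriv_add total_deriv_sum_distrib total_deriv_mult
        total_deriv_jet_coord sum.distrib distrib_left sum_distrib_left partial_commute[of "Base i"]
        mult.assoc add_ac)
  have 3: "(\<Sum>J\<in>V. \<Sum>K\<in>V. jet_coord (Fibre (mi_raise k J)) * jet_coord (Fibre (mi_raise i K))
           * partial (Fibre K) (partial (Fibre J) f))
      = (\<Sum>J\<in>V. \<Sum>K\<in>V. jet_coord (Fibre (mi_raise i J)) * jet_coord (Fibre (mi_raise k K))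
           * partial (Fibre K) (partial (Fibre J) f))"
    by (subst sum.swap) (simp add: partial_commute mult_ac)
  show ?thesis
    unfolding 2[of i k] 2[of k i] 3 mi_raise_commute[of i k] partial_commute[of "Base i" "Base k"]
    by (simp only: add_ac)
qed

text \<open>
  The composition of the powers \<open>T a ^^ k a\<close> over all \<open>a\<close>, for a family of commuting operators
  \<open>T\<close> and an exponent function \<open>k\<close> of finite support.  The families to which this is
  applied commute, see \<open>partial_commute\<close>, \<open>total_deriv_commute\<close> and \<open>polar_deriv_commute\<close> below.
\<close>

definition op_monomial :: "('a \<Rightarrow> 'b \<Rightarrow> 'b) \<Rightarrow> ('a \<Rightarrow> nat) \<Rightarrow> 'b \<Rightarrow> 'b" where
  "op_monomial T k x = Finite_Set.fold (\<lambda>a. T a ^^ k a) x {a. k a \<noteq> 0}"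

lemma comp_fun_commute_monomial:
  assumes "\<And>a b x. T a (T b x) = T b (T a x)"
  shows "comp_fun_commute (\<lambda>a. T a ^^ (k a :: nat))"
proof
  have *: "(T a ^^ m) (T b x) = T b ((T a ^^ m) x)" for a b m x
    by (induction m) (auto simp: assms)
  have "(T a ^^ m) ((T b ^^ l) x) = (T b ^^ l) ((T a ^^ m) x)" for a b m l x
    by (induction l) (auto simp: *)
  then show "(T b ^^ k b) \<circ> (T a ^^ k a) = (T a ^^ k a) \<circ> (T b ^^ k b)" for a b
    by (simp add: fun_eq_iff)
qed

definition total_derivs :: "('d::finite \<Rightarrow> nat) \<Rightarrow> 'd loc \<Rightarrow> 'd loc" where
  "total_derivs I = op_monomial total_deriv I"

definition vert_derivs :: "(('d::finite \<Rightarrow> nat) \<Rightarrow>\<^sub>0 nat) \<Rightarrow> 'd loc \<Rightarrow> 'd loc" where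
  "vert_derivs \<alpha> = op_monomial (\<lambda>J. partial (Fibre J)) (Poly_Mapping.lookup \<alpha>)"

definition fdeg :: "(('d::finite \<Rightarrow> nat) \<Rightarrow>\<^sub>0 nat) \<Rightarrow> nat" where
  "fdeg \<alpha> = Max (insert 0 (mi_size ` Poly_Mapping.keys \<alpha>))"


section \<open>Multilinear local differential operators\<close>

type_synonym ('n, 'd) multi_op = "('n \<Rightarrow> 'd loc) \<Rightarrow> 'd loc"

type_synonym ('n, 'd) coeffs =
  "('n \<Rightarrow> 'd \<Rightarrow> nat) \<Rightarrow> ('n \<Rightarrow> (('d \<Rightarrow> nat) \<Rightarrow>\<^sub>0 nat)) \<Rightarrow> 'd loc"

text \<open>Linear maps on the \<open>n\<close>-th tensor power of \<open>V\<close> are rendered as \<open>n\<close>-linear maps on \<open>V\<close>.\<close>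

definition multilinear :: "(('n \<Rightarrow> 'v::real_vector) \<Rightarrow> 'w::real_vector) \<Rightarrow> bool" where
  "multilinear A \<longleftrightarrow> (\<forall>j f. linear (\<lambda>g. A (f(j := g))))"

definition admissible :: "('n::finite, 'd::finite) coeffs \<Rightarrow> bool" where
  "admissible p \<longleftrightarrow> (\<forall>m. finite {(I, \<alpha>). p I \<alpha> \<noteq> 0 \<and> (\<Sum>j\<in>UNIV. fdeg (\<alpha> j)) \<le> m})"

text \<open>
  For admissible coefficients all but finitely many terms vanish on given arguments, because the
  arguments have finite order.
\<close>

definition ldo_op :: "('n::finite, 'd::finite) coeffs \<Rightarrow> ('n, 'd) multi_op" where
  "ldo_op p f =
     Sum_any (\<lambda>(I, \<alpha>). p I \<alpha> * (\<Prod>j\<in>UNIV. total_derivs (I j) (vert_derivs (\<alpha> j) (f j))))"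

definition LDO :: "('n::finite, 'd::finite) multi_op set" where
  "LDO = {A. multilinear A \<and> (\<exists>p. admissible p \<and> A = ldo_op p)}"

text \<open>\<open>precomp_total j i A\<close> is \<open>A \<circ> d/dx\<^sup>i\<^sub>j\<close>.\<close>

definition precomp_total ::
    "'n \<Rightarrow> 'd::finite \<Rightarrow> ('n, 'd) multi_op \<Rightarrow> ('n, 'd) multi_op" where
  "precomp_total j i A = (\<lambda>f. A (f(j := total_deriv i (f j))))"


subsection \<open>The characteristic\<close>

abbreviation first :: "'n::{finite,linorder}" where
  "first \<equiv> Min UNIV"

text \<open>\<open>polar_deriv j i A\<close> is \<open>A \<circ> d/dy\<^sup>i\<^sub>j\<close>.\<close>

definition polar_deriv ::
    "'n::{finite,linorder} \<Rightarrow> 'd::finite \<Rightarrow> ('n, 'd) multi_op \<Rightarrow> ('n, 'd) multi_op" where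
  "polar_deriv j i A =
     (if j = first then (\<lambda>f. \<Sum>l\<in>UNIV. precomp_total l i A f) else precomp_total j i A)"

lemma precomp_total_commute:
  "precomp_total j i (precomp_total l k A) = precomp_total l k (precomp_total j i A)"
  unfolding precomp_total_def
  by (cases "j = l") (auto simp: total_deriv_commute fun_upd_twist)

lemma polar_deriv_commute:
  "polar_deriv j i (polar_deriv l k A) = polar_deriv l k (polar_deriv j i A)"
proof -
  have sum: "precomp_total j i (\<lambda>f. \<Sum>m\<in>UNIV. precomp_total m k B f)
      = (\<lambda>f. \<Sum>m\<in>UNIV. precomp_total j i (precomp_total m k B) f)"
    for j :: 'a and i k B by (simp add: precomp_total_def)
  have "(\<Sum>m\<in>UNIV. \<Sum>m'\<in>UNIV. precomp_total m i (precomp_total m' k A) f)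
      = (\<Sum>m\<in>UNIV. \<Sum>m'\<in>UNIV. precomp_total m k (precomp_total m' i A) f)" for f
    by (subst sum.swap) (simp add: precomp_total_commute[of _ k])
  then show ?thesis
    by (cases "j = first"; cases "l = first")
       (simp_all add: polar_deriv_def sum precomp_total_commute[of _ i l k]
         precomp_total_commute[of j i _ k])
qed

text \<open>
  The operators \<open>d/dy\<^sub>j\<close> (with exponents \<open>I\<close>) after the vertical derivatives (with exponents
  \<open>\<alpha>\<close>), followed by the multiplication of the resulting \<open>n\<close> functions.
\<close>

definition polar_monomial ::
    "('n::{finite,linorder} \<Rightarrow> 'd::finite \<Rightarrow> nat) \<Rightarrow> ('n \<Rightarrow> (('d \<Rightarrow> nat) \<Rightarrow>\<^sub>0 nat)) \<Rightarrow>
     ('n, 'd) multi_op" where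
  "polar_monomial I \<alpha> f =
     op_monomial (\<lambda>(j, i). polar_deriv j i) (\<lambda>(j, i). I j i) (\<lambda>g. \<Prod>j\<in>UNIV. g j)
       (\<lambda>j. vert_derivs (\<alpha> j) (f j))"

definition polar_op :: "('n::{finite,linorder}, 'd::finite) coeffs \<Rightarrow> ('n, 'd) multi_op" where
  "polar_op q f = Sum_any (\<lambda>(I, \<alpha>). q I \<alpha> * polar_monomial I \<alpha> f)"

definition char_op :: "('n::{finite,linorder}, 'd::finite) coeffs \<Rightarrow> ('n, 'd) multi_op" where
  "char_op q f =
     Sum_any (\<lambda>(I, \<alpha>). (-1) ^ mi_size (I first) * total_derivs (I first) (q I \<alpha>)
                          * polar_monomial (I(first := (\<lambda>_. 0))) \<alpha> f)"

text \<open>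
  Every \<open>A\<close> in \<^term>\<open>LDO\<close> has a unique polarized form, so \<open>SOME\<close> makes no actual choice there.
\<close>

definition characteristic ::
    "('n::{finite,linorder}, 'd::finite) multi_op \<Rightarrow> ('n, 'd) multi_op" where
  "characteristic A = char_op (SOME q. admissible q \<and> A = polar_op q)"


section \<open>Horizontal forms and the complex of operators\<close>

text \<open>
  A horizontal form is the family of its coefficients; the basis element
  \<open>(dx)\<^sup>\<epsilon>\<close> corresponds to the set \<open>{i. \<epsilon>\<^sup>i = 1}\<close>, the differentials being wedged in increasing order.
\<close>

type_synonym 'd form = "('d::finite) loc ^ 'd set"

definition wedge_dx :: "'d::{finite,linorder} \<Rightarrow> 'd form \<Rightarrow> 'd form" where
  "wedge_dx i \<omega> =
     (\<chi> S. if i \<in> S then (-1) ^ card {s \<in> S. s < i} * \<omega> $ (S - {i}) else 0)"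

definition dH :: "'d::{finite,linorder} form \<Rightarrow> 'd form" where
  "dH \<omega> = (\<Sum>i\<in>UNIV. wedge_dx i (\<chi> S. total_deriv i (\<omega> $ S)))"

text \<open>Degree of the basis element \<open>S\<close> in the regraded (homological) complex.\<close>

definition chain_deg :: "('d::finite) set \<Rightarrow> int" where
  "chain_deg S = int CARD('d) - int (card S)"

definition sign_twist :: "('d::finite) form \<Rightarrow> 'd form" where
  "sign_twist \<omega> = (\<chi> S. (-1) ^ (CARD('d) - card S) * \<omega> $ S)"

type_synonym ('n, 'd) form_op = "('n \<Rightarrow> 'd form) \<Rightarrow> 'd form"

text \<open>
  Composition with the differential of the tensor power,
  \<open>\<omega>\<^sub>1 \<otimes> \<cdots> \<otimes> \<omega>\<^sub>n \<mapsto> \<Sum>\<^sub>j (-1)\<^bsup>deg \<omega>\<^sub>1 + \<cdots> + deg \<omega>\<^sub>j\<^sub>-\<^sub>1\<^esup> \<omega>\<^sub>1 \<otimes> \<cdots> \<otimes> d\<^sub>H\<omega>\<^sub>j \<otimes> \<cdots> \<otimes> \<omega>\<^sub>n\<close>.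
\<close>

definition precomp_dH ::
    "('n::{finite,linorder}, 'd::{finite,linorder}) form_op \<Rightarrow> ('n, 'd) form_op" where
  "precomp_dH F = (\<lambda>\<omega>. \<Sum>j\<in>UNIV.
     F (\<lambda>l. if l < j then sign_twist (\<omega> l) else if l = j then dH (\<omega> l) else \<omega> l))"

definition matrix_coeff ::
    "('n, 'd::finite) form_op \<Rightarrow> ('n \<Rightarrow> 'd set) \<Rightarrow> 'd set \<Rightarrow> ('n, 'd) multi_op" where
  "matrix_coeff F \<epsilon> S = (\<lambda>h. F (\<lambda>j. axis (\<epsilon> j) (h j)) $ S)"

text \<open>
  The components \<open>f\<^sub>s\<close> of an element \<open>f\<close> of \<open>DEnd\<^sub>k(n)\<close> are put together to one map; \<open>f\<^sub>s\<close> is recovered by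
  restriction to basis elements of total degree \<open>s\<close>.
\<close>

definition DEnd ::
    "int \<Rightarrow> ('n::{finite,linorder}, 'd::{finite,linorder}) form_op set" where
  "DEnd k = {F. multilinear F \<and>
     (\<forall>\<epsilon> S. matrix_coeff F \<epsilon> S \<in> LDO \<and>
        (chain_deg S \<noteq> (\<Sum>j\<in>UNIV. chain_deg (\<epsilon> j)) + k \<longrightarrow> matrix_coeff F \<epsilon> S = (\<lambda>_. 0)))}"

definition delta ::
    "int \<Rightarrow> ('n::{finite,linorder}, 'd::{finite,linorder}) form_op \<Rightarrow> ('n, 'd) form_op" where
  "delta k F = (\<lambda>\<omega>. dH (F \<omega>) - ((-1) powi k) *\<^sub>R precomp_dH F \<omega>)"

definition cycles ::
    "int \<Rightarrow> ('n::{finite,linorder}, 'd::{finite,linorder}) form_op set" where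
  "cycles k = {F \<in> DEnd k. delta k F = (\<lambda>_. 0)}"

definition boundaries ::
    "int \<Rightarrow> ('n::{finite,linorder}, 'd::{finite,linorder}) form_op set" where
  "boundaries k = delta (k + 1) ` DEnd (k + 1)"

definition pointwise_group :: "('a \<Rightarrow> 'b::ab_group_add) set \<Rightarrow> ('a \<Rightarrow> 'b) monoid" where
  "pointwise_group V = \<lparr>carrier = V, monoid.mult = (\<lambda>f g x. f x + g x), one = (\<lambda>_. 0)\<rparr>"

definition homology ::
    "int \<Rightarrow> ('n::{finite,linorder}, 'd::{finite,linorder}) form_op set monoid" where
  "homology k = pointwise_group (cycles k) Mod boundaries k"

text \<open>The component \<open>f\<^sub>0\<close>, with \<open>h dx\<^sup>1 \<and> \<cdots> \<and> dx\<^sup>N\<close> identified with \<open>h\<close>.\<close>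

definition B0 ::
    "('n::{finite,linorder}, 'd::{finite,linorder}) form_op \<Rightarrow> ('n, 'd) multi_op" where
  "B0 F = matrix_coeff F (\<lambda>_. UNIV) UNIV"

definition char_cycles :: "('n::{finite,linorder}, 'd::{finite,linorder}) multi_op set" where
  "char_cycles = {A \<in> LDO. \<forall>i j. characteristic (precomp_total j i A) = (\<lambda>_. 0)}"

definition char_kernel :: "('n::{finite,linorder}, 'd::{finite,linorder}) multi_op set" where
  "char_kernel = {A \<in> LDO. characteristic A = (\<lambda>_. 0)}"

end

(*
  Moving total derivatives to the left, every operator in LDO(n) is uniquely a locally finite sum
  of D^I o R_I, where R_I contains no total derivative of the first argument or of the product.
  Left composition with d/dx^i shifts I, and the characteristic is the term R_0.  Hence for fixed
  degrees of the arguments the complex d_H o - is the Koszul complex of multiplication by the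
  variables of a polynomial ring: it is exact except in form degree N, where its homology is
  LDO(n) / ker chi.  Filtering DEnd by the degree of the arguments, a cycle is therefore killed one
  degree at a time, and only the degree 0 component B_0 is an obstruction.
*)

theory Submission
  imports Defs
begin

section \<open>Monomials in commuting operators\<close>

text \<open>The obstacle is local finiteness. An operator is an infinite sum, and rewriting it term
  by term piles up contributions in each new coefficient; that only finitely many arrive is
  controlled by the total fibre degree \<open>wt\<close>. Passing between the forms preserves it,
  while moving a total derivative past vertical derivatives may lower it by one. The Koszul homotopy
  divides by m + N - p, where m counts the outer total derivatives and p is the form degree. This is
  zero only for m = 0 and p = N, that is, at the term R_0 of a top form. A map of degree k sends
  argument degree a to degree a + k, so top forms occur only for a = -k: never if k > 0, and at a =
  0 if k = 0. Surjectivity of B_0 is the case k = -1: the operator A is extended by zero, and the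
  obstructions to correcting this extension to a cycle sit at a = 1 and are multiples of the
  compositions of A with d/dx^i_j. In top degree, exactness says that the kernel of chi consists of
  the sums of total derivatives of operators; this makes it stable under precomposition.\<close>

lemma op_monomial_zero [simp]: "op_monomial T (\<lambda>_. 0) x = x"
  by (simp add: op_monomial_def)

text \<open>The fold runs over the support, which grows if the exponent of \<open>a\<close> was
  zero. Splitting off the factor of \<open>a\<close> in either case gives a recursion from which the
  later facts about monomials follow by induction.\<close>

lemma op_monomial_raise:
  assumes comm: "\<And>a b x. T a (T b x) = T b (T a x)" and fin: "finite {a. k a \<noteq> 0}"
  shows "op_monomial T (k(a := Suc (k a))) x = T a (op_monomial T k x)"
proof -
  let ?k = "k(a := Suc (k a))"
  let ?S = "{b. k b \<noteq> 0} - {a}"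
  interpret F: comp_fun_commute "\<lambda>b. T b ^^ k b" by (rule comp_fun_commute_monomial[where T = T]) (rule comm)
  interpret F': comp_fun_commute "\<lambda>b. T b ^^ ?k b" by (rule comp_fun_commute_monomial[where T = T]) (rule comm)
  have S: "finite ?S" "a \<notin> ?S" using fin by auto
  have 1: "op_monomial T k x = (T a ^^ k a) (Finite_Set.fold (\<lambda>b. T b ^^ k b) x ?S)"
  proof (cases "k a = 0")
    case True
    then have "{b. k b \<noteq> 0} = ?S" by auto
    with True show ?thesis by (simp add: op_monomial_def)
  next
    case False
    then have "{b. k b \<noteq> 0} = insert a ?S" by auto
    then show ?thesis unfolding op_monomial_def using F.fold_insert[OF S] by simp
  qed
  have "Finite_Set.fold (\<lambda>b. T b ^^ ?k b) x ?S = Finite_Set.fold (\<lambda>b. T b ^^ k b) x ?S"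
    by (rule Finite_Set.fold_cong[OF F'.comp_fun_commute_on_axioms F.comp_fun_commute_on_axioms])
       (use S in auto)
  moreover have "{b. ?k b \<noteq> 0} = insert a ?S" by auto
  ultimately have "op_monomial T ?k x = (T a ^^ Suc (k a)) (Finite_Set.fold (\<lambda>b. T b ^^ k b) x ?S)"
    unfolding op_monomial_def using F'.fold_insert[OF S] by simp
  with 1 show ?thesis by simp
qed

text \<open>Lowering a nonzero value lowers the sum of the values. The sum is a
  \<open>Sum_any\<close>, as the index type is infinite for vertical exponents.\<close>

lemma finite_support_induct [consumes 1, case_names zero raise]:
  fixes k :: "'a \<Rightarrow> nat"
  assumes "finite {a. k a \<noteq> 0}" and zero: "P (\<lambda>_. 0)"
    and raise: "\<And>k a. finite {a. k a \<noteq> 0} \<Longrightarrow> P k \<Longrightarrow> P (k(a := Suc (k a)))"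
  shows "P k"
  using assms(1)
proof (induction "Sum_any k" arbitrary: k rule: less_induct)
  case less
  show ?case
  proof (cases "k = (\<lambda>_. 0)")
    case True
    then show ?thesis by (simp only: zero)
  next
    case False
    then obtain a where a: "k a \<noteq> 0" by (auto simp: fun_eq_iff)
    let ?k = "k(a := k a - 1)"
    have fin: "finite {a. ?k a \<noteq> 0}"
      by (rule finite_subset[OF _ less.prems]) auto
    have "Sum_any ?k < Sum_any k"
    proof -
      have "Sum_any ?k = sum ?k {a. k a \<noteq> 0}"
        by (rule Sum_any.expand_superset) (use less.prems in auto)
      also have "\<dots> < sum k {a. k a \<noteq> 0}"
        by (rule sum_strict_mono_ex1) (use less.prems a in auto)
      finally show ?thesis by (simp add: Sum_any.expand_set)
    qed
    then have "P ?k" by (rule less.hyps) (rule fin)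
    from raise[OF fin this, of a] a show ?thesis by simp
  qed
qed

lemma op_monomial_right:
  assumes comm: "\<And>a b x. T a (T b x) = T b (T a x)" and fin: "finite {a. k a \<noteq> 0}"
  shows "op_monomial T k (T a x) = T a (op_monomial T k x)"
  using fin
proof (induction rule: finite_support_induct)
  case (raise k b)
  then show ?case by (simp only: op_monomial_raise[where T = T and k = k, OF comm raise(1)] comm[of b])
qed simp

lemma op_monomial_linear:
  assumes comm: "\<And>a b x. T a (T b x) = T b (T a x)" and fin: "finite {a. k a \<noteq> 0}"
    and lin: "\<And>a. linear (T a)"
  shows "linear (op_monomial T k)"
  using fin
proof (induction rule: finite_support_induct)
  case zero
  then show ?case by (simp add: linear_iff)
next
  case (raise k b)
  have "linear (\<lambda>x. T b (op_monomial T k x))"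
    using linear_compose[OF raise(2) lin[of b]] by (simp add: o_def)
  then show ?case by (simp only: op_monomial_raise[where T = T and k = k, OF comm raise(1)])
qed


section \<open>Total and vertical derivatives\<close>

lemma partial_scaleR: "partial c (r *\<^sub>R f) = r *\<^sub>R partial c f"
proof (rule partial_eqI)
  fix p
  show "((\<lambda>t. loc_apply (r *\<^sub>R f) (p(c := t))) has_field_derivative
          loc_apply (r *\<^sub>R partial c f) p) (at (p c))"
    unfolding scaleR_loc.rep_eq by (rule DERIV_cmult[OF loc_has_partial])
qed

lemma linear_partial: "linear (partial c)"
  by (rule linearI) (simp_all add: partial_add partial_scaleR)

lemma total_deriv_const: "total_deriv i (r *\<^sub>R (1 :: 'a::finite loc)) = 0"
proof -
  have "partial c 1 = 0" for c :: "'a coord"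
    by (rule partial_eqI) (simp add: one_loc.rep_eq zero_loc.rep_eq)
  then show ?thesis by (subst total_deriv_sum[of "{}"]) (auto simp: partial_scaleR)
qed

lemma linear_total_deriv: "linear (total_deriv (i :: 'a::finite))"
proof (rule linearI)
  fix r and f :: "'a::finite loc"
  \<comment> \<open>Reading the scalar as a constant function turns homogeneity into the Leibniz
    rule.\<close>
  have "total_deriv i (r *\<^sub>R f) = total_deriv i ((r *\<^sub>R 1) * f)" by simp
  also have "\<dots> = r *\<^sub>R total_deriv i f" unfolding total_deriv_mult total_deriv_const by simp
  finally show "total_deriv i (r *\<^sub>R f) = r *\<^sub>R total_deriv i f" .
qed (rule total_deriv_add)

lemma total_derivs_zero [simp]: "total_derivs (\<lambda>_. 0) f = f"
  by (simp add: total_derivs_def)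

lemma total_derivs_raise: "total_derivs (mi_raise i I) f = total_deriv i (total_derivs I f)"
  unfolding total_derivs_def mi_raise_def
  by (rule op_monomial_raise[where T = total_deriv, OF total_deriv_commute]) simp

lemma total_derivs_deriv: "total_derivs I (total_deriv i f) = total_deriv i (total_derivs I f)"
  unfolding total_derivs_def by (rule op_monomial_right[where T = total_deriv, OF total_deriv_commute]) simp

lemma linear_total_derivs: "linear (total_derivs I)"
  unfolding total_derivs_def[abs_def]
  by (rule op_monomial_linear[where T = total_deriv, OF total_deriv_commute _ linear_total_deriv]) simp

lemma multi_index_induct [case_names zero raise]:
  fixes I :: "'d::finite \<Rightarrow> nat"
  assumes "P (\<lambda>_. 0)" "\<And>I i. P I \<Longrightarrow> P (mi_raise i I)"
  shows "P I"
  by (rule finite_support_induct[of I P]) (use assms in \<open>auto simp: mi_raise_def\<close>)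

lemma finite_lookup: "finite {a. Poly_Mapping.lookup \<alpha> a \<noteq> 0}"
  by simp

lemma lookup_raise:
  "Poly_Mapping.lookup (\<alpha> + Poly_Mapping.single K 1)
     = (Poly_Mapping.lookup \<alpha>)(K := Suc (Poly_Mapping.lookup \<alpha> K))"
  by (auto simp: fun_eq_iff lookup_add lookup_single when_def)

lemma mapping_induct [case_names zero raise]:
  fixes \<alpha> :: "'a \<Rightarrow>\<^sub>0 nat"
  assumes "P 0" "\<And>\<alpha> K. P \<alpha> \<Longrightarrow> P (\<alpha> + Poly_Mapping.single K 1)"
  shows "P \<alpha>"
proof -
  have "\<forall>\<alpha>. Poly_Mapping.lookup \<alpha> = k \<longrightarrow> P \<alpha>" if "finite {a. k a \<noteq> 0}" for k :: "'a \<Rightarrow> nat"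
    using that
  proof (induction rule: finite_support_induct)
    case zero
    have "\<alpha> = 0" if "Poly_Mapping.lookup \<alpha> = (\<lambda>_. 0)" for \<alpha> :: "'a \<Rightarrow>\<^sub>0 nat"
      by (rule poly_mapping_eqI) (simp add: that)
    with assms(1) show ?case by blast
  next
    case (raise k a)
    show ?case
    proof (intro allI impI)
      fix \<alpha> :: "'a \<Rightarrow>\<^sub>0 nat" assume \<alpha>: "Poly_Mapping.lookup \<alpha> = k(a := Suc (k a))"
      define \<beta> where "\<beta> = Abs_poly_mapping k"
      have \<beta>: "Poly_Mapping.lookup \<beta> = k"
        unfolding \<beta>_def using raise(1) by (simp add: Abs_poly_mapping_inverse)
      have "\<alpha> = \<beta> + Poly_Mapping.single a 1"
        by (rule poly_mapping_eqI) (simp only: \<alpha> lookup_raise \<beta>)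
      with raise(2) \<beta> assms(2) show "P \<alpha>" by blast
    qed
  qed
  from this[OF finite_lookup, of \<alpha>] show ?thesis by blast
qed

lemma vert_derivs_zero [simp]: "vert_derivs 0 f = f"
  by (simp add: vert_derivs_def lookup_zero[abs_def])

lemma vert_derivs_raise:
  "vert_derivs (\<alpha> + Poly_Mapping.single K 1) f = partial (Fibre K) (vert_derivs \<alpha> f)"
  unfolding vert_derivs_def lookup_raise
  by (rule op_monomial_raise[where T = "\<lambda>J. partial (Fibre J)", OF partial_commute finite_lookup])

lemma vert_derivs_partial:
  "vert_derivs \<alpha> (partial (Fibre K) f) = partial (Fibre K) (vert_derivs \<alpha> f)"
  unfolding vert_derivs_def
  by (rule op_monomial_right[where T = "\<lambda>J. partial (Fibre J)", OF partial_commute finite_lookup])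

lemma linear_vert_derivs: "linear (vert_derivs \<alpha>)"
  unfolding vert_derivs_def[abs_def]
  by (rule op_monomial_linear[where T = "\<lambda>J. partial (Fibre J)", OF partial_commute finite_lookup linear_partial])

text \<open>Vertical derivatives commute, so the one that kills \<open>f\<close> may be applied
  first.\<close>

lemma vert_derivs_eq_zero:
  assumes "K \<in> Poly_Mapping.keys \<alpha>" "partial (Fibre K) f = 0"
  shows "vert_derivs \<alpha> f = 0"
proof -
  define \<beta> where "\<beta> = \<alpha> - Poly_Mapping.single K 1"
  have "\<alpha> = \<beta> + Poly_Mapping.single K 1"
    using assms(1) by (intro poly_mapping_eqI)
      (auto simp: \<beta>_def lookup_add lookup_minus lookup_single when_def in_keys_iff)
  then have "vert_derivs \<alpha> f = vert_derivs \<beta> (partial (Fibre K) f)"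
    by (simp only: vert_derivs_raise vert_derivs_partial)
  with assms(2) show ?thesis by (simp add: linear_0 linear_vert_derivs)
qed

lemma fdeg_le_iff: "fdeg \<alpha> \<le> m \<longleftrightarrow> (\<forall>J\<in>Poly_Mapping.keys \<alpha>. mi_size J \<le> m)"
  by (simp add: fdeg_def)

text \<open>\<open>f\<close> has nonzero derivatives in finitely many fibre coordinates only. Beyond
  the largest order among these, every exponent contains a derivative that kills \<open>f\<close>.
  All pointwise finiteness below comes from here.\<close>

lemma vert_derivs_bound:
  fixes f :: "'d::finite loc"
  obtains m where "\<And>\<alpha> :: ('d \<Rightarrow> nat) \<Rightarrow>\<^sub>0 nat. m < fdeg \<alpha> \<Longrightarrow> vert_derivs \<alpha> f = 0"
proof
  let ?m = "Max (insert 0 (mi_size ` {J. partial (Fibre J) f \<noteq> 0}))"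
  fix \<alpha> :: "('d \<Rightarrow> nat) \<Rightarrow>\<^sub>0 nat" assume "?m < fdeg \<alpha>"
  then obtain J where J: "J \<in> Poly_Mapping.keys \<alpha>" "?m < mi_size J"
    using fdeg_le_iff[of \<alpha> ?m] by auto
  have "partial (Fibre J) f = 0"
  proof (rule ccontr)
    assume "partial (Fibre J) f \<noteq> 0"
    then have "mi_size J \<le> ?m" by (intro Max_ge) (auto simp: finite_partial)
    with J(2) show False by simp
  qed
  with J(1) show "vert_derivs \<alpha> f = 0" by (rule vert_derivs_eq_zero)
qed

text \<open>The commutator arises from the coefficient \<open>u_{iK}\<close> of the total
  derivative, which depends on \<open>u_J\<close> exactly when \<open>iK = J\<close>. The
  \<open>of_bool\<close> guards against \<open>J i = 0\<close>, where natural subtraction would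
  return \<open>J\<close>.\<close>

lemma partial_total_deriv:
  fixes f :: "'a::finite loc"
  shows
  "partial (Fibre J) (total_deriv i f)
     = total_deriv i (partial (Fibre J) f) + of_bool (J i > 0) * partial (Fibre (J(i := J i - 1))) f"
proof -
  \<comment> \<open>The last index is included so that the Kronecker sum below meets it even when
    the derivative of \<open>f\<close> there vanishes.\<close>
  define W where "W = {K. partial (Fibre K) f \<noteq> 0} \<union> {K. partial (Fibre K) (partial (Fibre J) f) \<noteq> 0}
     \<union> {J(i := J i - 1)}"
  have fW: "finite W" by (simp add: W_def finite_partial)
  have 1: "total_deriv i g = partial (Base i) g
    + (\<Sum>K\<in>W. jet_coord (Fibre (mi_raise i K)) * partial (Fibre K) g)"
    if "g \<in> {f, partial (Fibre J) f}" for g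
    using that fW by (intro total_deriv_sum) (auto simp: W_def)
  have ps: "partial c (sum F A) = (\<Sum>a\<in>A. partial c (F a))" for c and F :: "('a \<Rightarrow> nat) \<Rightarrow> 'a loc" and A
    by (rule linear_sum[OF linear_partial])
  have ri: "J = mi_raise i K \<longleftrightarrow> J i > 0 \<and> K = J(i := J i - 1)" for K
    unfolding mi_raise_def by auto
  have "partial (Fibre J) (total_deriv i f) = total_deriv i (partial (Fibre J) f)
     + (\<Sum>K\<in>W. (if J = mi_raise i K then 1 else 0) * partial (Fibre K) f)"
    by (simp add: 1 partial_add ps partial_mult partial_jet_coord sum.distrib
        partial_commute[of "Fibre J"] add_ac cong: if_cong)
  also have "(\<Sum>K\<in>W. (if J = mi_raise i K then 1 else 0) * partial (Fibre K) f)
    = (\<Sum>K\<in>W. if K = J(i := J i - 1) then of_bool (J i > 0) * partial (Fibre K) f else 0)"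
    by (rule sum.cong) (auto simp: ri)
  also have "\<dots> = of_bool (J i > 0) * partial (Fibre (J(i := J i - 1))) f"
    using fW by (simp add: sum.delta W_def)
  finally show ?thesis .
qed


section \<open>Locally finite sums of monomials\<close>

text \<open>
  \<open>X k r\<close> is the monomial with index \<open>k\<close> and coefficient \<open>r\<close>; the weight \<open>w k\<close> will be
  the total fibre degree of \<open>k\<close>.
\<close>

definition expansion :: "('k \<Rightarrow> 'r \<Rightarrow> 'f \<Rightarrow> 'v) \<Rightarrow> ('k \<Rightarrow> 'r) \<Rightarrow> 'f \<Rightarrow> 'v::comm_monoid_add" where
  "expansion X p f = Sum_any (\<lambda>k. X k (p k) f)"

definition admissible_wt :: "('k \<Rightarrow> nat) \<Rightarrow> ('k \<Rightarrow> 'r::zero) \<Rightarrow> bool" where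
  "admissible_wt w p \<longleftrightarrow> (\<forall>m. finite {k. p k \<noteq> 0 \<and> w k \<le> m})"

text \<open>The second condition is uniform in the coefficient: on fixed arguments only bounded
  weights survive. Against admissible coefficients it leaves finitely many terms.\<close>

definition monomials ::
    "('k \<Rightarrow> nat) \<Rightarrow> ('k \<Rightarrow> 'r::ab_group_add \<Rightarrow> 'f \<Rightarrow> 'v::ab_group_add) \<Rightarrow> bool" where
  "monomials w X \<longleftrightarrow> (\<forall>k r s f. X k (r + s) f = X k r f + X k s f) \<and>
     (\<forall>f. \<exists>m. \<forall>k r. m < w k \<longrightarrow> X k r f = 0)"

lemma monomials_add: "monomials w X \<Longrightarrow> X k (r + s) f = X k r f + X k s f"
  by (simp add: monomials_def)

lemma monomials_zero: "monomials w X \<Longrightarrow> X k 0 f = 0"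
  using monomials_add[of w X k 0 0 f] by simp

lemma monomials_sum: "monomials w X \<Longrightarrow> X k (sum r A) f = (\<Sum>a\<in>A. X k (r a) f)"
  by (induction A rule: infinite_finite_induct) (auto simp: monomials_add monomials_zero)

lemma monomials_bound:
  assumes "monomials w X"
  obtains m where "\<And>k r. m < w k \<Longrightarrow> X k r f = 0"
proof -
  have "\<exists>m. \<forall>k r. m < w k \<longrightarrow> X k r f = 0" using assms unfolding monomials_def by blast
  with that show ?thesis by blast
qed

text \<open>The finite set \<open>A\<close> is left free so that several expansions can be evaluated
  over a common index set.\<close>

lemma expansion_sum:
  assumes "monomials w X" "\<And>k r. m < w k \<Longrightarrow> X k r f = 0"
    and "finite A" "{k. p k \<noteq> 0 \<and> w k \<le> m} \<subseteq> A"
  shows "expansion X p f = (\<Sum>k\<in>A. X k (p k) f)"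
  unfolding expansion_def
proof (rule Sum_any.expand_superset[OF assms(3)])
  have "k \<in> {k. p k \<noteq> 0 \<and> w k \<le> m}" if "X k (p k) f \<noteq> 0" for k
    using that assms(2) monomials_zero[OF assms(1)] by (auto simp: not_less[symmetric])
  with assms(4) show "{k. X k (p k) f \<noteq> 0} \<subseteq> A" by blast
qed

lemma admissible_wt_add:
  fixes p q :: "'k \<Rightarrow> 'r::ab_group_add"
  assumes "admissible_wt w p" "admissible_wt w q"
  shows "admissible_wt w (\<lambda>k. p k + q k)"
  unfolding admissible_wt_def
proof
  fix m
  have "{k. p k + q k \<noteq> 0 \<and> w k \<le> m}
      \<subseteq> {k. p k \<noteq> 0 \<and> w k \<le> m} \<union> {k. q k \<noteq> 0 \<and> w k \<le> m}" by auto
  then show "finite {k. p k + q k \<noteq> 0 \<and> w k \<le> m}"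
    by (rule finite_subset) (use assms in \<open>auto simp: admissible_wt_def\<close>)
qed

lemma expansion_add:
  fixes p q :: "'k \<Rightarrow> 'r::ab_group_add"
  assumes X: "monomials w X" and "admissible_wt w p" "admissible_wt w q"
  shows "expansion X (\<lambda>k. p k + q k) f = expansion X p f + expansion X q f"
proof -
  obtain m where m: "\<And>k r. m < w k \<Longrightarrow> X k r f = 0" using monomials_bound[OF X] by blast
  define A where "A = {k. p k \<noteq> 0 \<and> w k \<le> m} \<union> {k. q k \<noteq> 0 \<and> w k \<le> m}"
  have "finite A" using assms by (auto simp: A_def admissible_wt_def)
  then have "expansion X s f = (\<Sum>k\<in>A. X k (s k) f)" if "s \<in> {p, q, \<lambda>k. p k + q k}" for s
    using that by (intro expansion_sum[OF X m]) (auto simp: A_def)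
  then show ?thesis by (simp add: monomials_add[OF X] sum.distrib)
qed

lemma expansion_zero: "monomials w X \<Longrightarrow> expansion X (\<lambda>_. 0) f = 0"
  by (simp add: expansion_def monomials_zero)

lemma expansion_hom:
  fixes \<Phi> :: "'v::ab_group_add \<Rightarrow> 'w::ab_group_add"
  assumes X: "monomials w X" and p: "admissible_wt w p"
    and \<Phi>: "\<Phi> 0 = 0" "\<And>x y. \<Phi> (x + y) = \<Phi> x + \<Phi> y"
  shows "\<Phi> (expansion X p f) = expansion (\<lambda>k r f. \<Phi> (X k r f)) p f"
proof -
  obtain m where m: "\<And>k r. m < w k \<Longrightarrow> X k r f = 0" using monomials_bound[OF X] by blast
  define A where "A = {k. p k \<noteq> 0 \<and> w k \<le> m}"
  have A: "finite A" using p by (auto simp: A_def admissible_wt_def)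
  have "expansion (\<lambda>k r f. \<Phi> (X k r f)) p f = (\<Sum>k\<in>A. \<Phi> (X k (p k) f))"
    unfolding expansion_def
  proof (rule Sum_any.expand_superset[OF A])
    have "k \<in> A" if "\<Phi> (X k (p k) f) \<noteq> 0" for k
      using that m monomials_zero[OF X] \<Phi>(1) by (auto simp: A_def not_less[symmetric])
    then show "{k. \<Phi> (X k (p k) f) \<noteq> 0} \<subseteq> A" by blast
  qed
  moreover have "\<Phi> (sum h A) = (\<Sum>k\<in>A. \<Phi> (h k))" for h
    by (induction A rule: infinite_finite_induct) (auto simp: \<Phi>)
  moreover have "expansion X p f = (\<Sum>k\<in>A. X k (p k) f)"
    using A by (intro expansion_sum[OF X m]) (auto simp: A_def)
  ultimately show ?thesis by simp
qed

text \<open>An additive span with arbitrary coefficients in the generators. A span over the ring of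
  local functions would not fit, because in \<open>left_mon\<close> the coefficient stands under
  total derivatives.\<close>

inductive_set fspan :: "('k \<Rightarrow> 'r \<Rightarrow> 'f \<Rightarrow> 'v::ab_group_add) \<Rightarrow> 'k set \<Rightarrow> ('f \<Rightarrow> 'v) set"
  for X K where
    zero: "(\<lambda>_. 0) \<in> fspan X K"
  | gen: "k \<in> K \<Longrightarrow> X k r \<in> fspan X K"
  | add: "A \<in> fspan X K \<Longrightarrow> B \<in> fspan X K \<Longrightarrow> (\<lambda>f. A f + B f) \<in> fspan X K"

lemma fspan_sum:
  "(\<And>a. a \<in> S \<Longrightarrow> A a \<in> fspan X K) \<Longrightarrow> (\<lambda>f. \<Sum>a\<in>S. A a f) \<in> fspan X K"
  by (induction S rule: infinite_finite_induct) (auto intro: fspan.intros)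

lemma fspan_mono: "A \<in> fspan X K \<Longrightarrow> K \<subseteq> L \<Longrightarrow> A \<in> fspan X L"
  by (induction rule: fspan.induct) (auto intro: fspan.intros)

lemma fspan_uminus:
  assumes "A \<in> fspan X K" "\<And>k r f. X k (- r) f = - X k r f"
  shows "(\<lambda>f. - A f) \<in> fspan X K"
  using assms(1)
proof (induction rule: fspan.induct)
  case (gen k r)
  have "(\<lambda>f. - X k r f) = X k (- r)" by (rule ext) (simp add: assms(2))
  with gen show ?case by (simp only: fspan.gen)
next
  case (add A B)
  then show ?case using fspan.add[OF add.IH] by (simp only: minus_add_distrib)
qed (simp add: fspan.zero)

lemma fspan_transfer:
  assumes "A \<in> fspan X K" "\<And>A B. \<Phi> (\<lambda>f. A f + B f) = (\<lambda>f. \<Phi> A f + \<Phi> B f)"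
    and "\<And>k r. k \<in> K \<Longrightarrow> \<Phi> (X k r) \<in> fspan Y L"
  shows "\<Phi> A \<in> fspan Y L"
  using assms(1)
proof (induction rule: fspan.induct)
  case zero
  have "\<Phi> (\<lambda>_. 0) f = 0" for f
    using fun_cong[OF assms(2)[of "\<lambda>_. 0" "\<lambda>_. 0"], of f] by simp
  then have "\<Phi> (\<lambda>_. 0) = (\<lambda>_. 0)" by blast
  then show ?case by (simp add: fspan.zero)
qed (use assms in \<open>auto intro: fspan.add\<close>)

lemma fspan_expansion:
  assumes "A \<in> fspan X K" and X: "monomials w X"
  shows "\<exists>t. finite {k. t k \<noteq> 0} \<and> {k. t k \<noteq> 0} \<subseteq> K \<and> A = expansion X t"
  using assms(1)
proof (induction rule: fspan.induct)
  case zero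
  then show ?case using expansion_zero[OF X] by (intro exI[of _ "\<lambda>_. 0"]) auto
next
  case (gen k r)
  have "expansion X (\<lambda>k'. if k' = k then r else 0) f = X k r f" for f
  proof -
    have "X k' (if k' = k then r else 0) f = (if k' = k then X k' r f else 0)" for k'
      by (simp add: monomials_zero[OF X])
    then show ?thesis by (simp add: expansion_def)
  qed
  with gen show ?case by (intro exI[of _ "\<lambda>k'. if k' = k then r else 0"]) auto
next
  case (add A B)
  then obtain s t where s: "finite {k. s k \<noteq> 0}" "{k. s k \<noteq> 0} \<subseteq> K" "A = expansion X s"
    and t: "finite {k. t k \<noteq> 0}" "{k. t k \<noteq> 0} \<subseteq> K" "B = expansion X t" by blast
  have sub: "{k. s k + t k \<noteq> 0} \<subseteq> {k. s k \<noteq> 0} \<union> {k. t k \<noteq> 0}" by auto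
  have "admissible_wt w s" "admissible_wt w t"
    using s(1) t(1) by (auto simp: admissible_wt_def)
  then have "(\<lambda>f. A f + B f) = expansion X (\<lambda>k. s k + t k)"
    by (auto simp: expansion_add[OF X] s(3) t(3))
  moreover have "finite {k. s k + t k \<noteq> 0}" using sub s(1) t(1) by (blast intro: finite_subset)
  ultimately show ?case using sub s(2) t(2) by (intro exI[of _ "\<lambda>k. s k + t k"]) blast
qed

text \<open>A coefficient at \<open>l\<close> receives contributions only from \<open>k\<close> with
  \<open>w k \<le> u l + c\<close>, and admissibility leaves finitely many of these. The slack
  \<open>c\<close> is 0 for changes of form and 1 for precomposition with a total
  derivative.\<close>

lemma expansion_convert:
  fixes X :: "'k \<Rightarrow> 'r::ab_group_add \<Rightarrow> 'f \<Rightarrow> 'v::ab_group_add"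
    and Y :: "'l \<Rightarrow> 's::ab_group_add \<Rightarrow> 'f \<Rightarrow> 'v"
  assumes X: "monomials w X" and Y: "monomials u Y" and p: "admissible_wt w p"
    and XY: "\<And>k r. X k r \<in> fspan Y (L \<inter> {l. w k \<le> u l + c})"
  shows "\<exists>q. admissible_wt u q \<and> {l. q l \<noteq> 0} \<subseteq> L \<and> expansion X p = expansion Y q"
proof -
  have "\<exists>t. finite {l. t l \<noteq> 0} \<and> {l. t l \<noteq> 0} \<subseteq> L \<inter> {l. w k \<le> u l + c} \<and>
      X k (p k) = expansion Y t" for k
    using fspan_expansion[OF XY Y] by blast
  then obtain t where t: "\<And>k. finite {l. t k l \<noteq> 0}"
      "\<And>k. {l. t k l \<noteq> 0} \<subseteq> L \<inter> {l. w k \<le> u l + c}" "\<And>k. X k (p k) = expansion Y (t k)"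
    by metis
  define P where "P m = {k. p k \<noteq> 0 \<and> w k \<le> m}" for m
  have P: "finite (P m)" for m using p by (simp add: P_def admissible_wt_def)
  define q where "q l = (\<Sum>k\<in>P (u l + c). t k l)" for l
  \<comment> \<open>Raising the cutoff adds only \<open>k\<close> too heavy to reach
    \<open>l\<close>, so one finite set computes all coefficients up to weight
    \<open>m\<close>.\<close>
  have q: "q l = (\<Sum>k\<in>P (m + c). t k l)" if "u l \<le> m" for l m
    unfolding q_def
  proof (rule sum.mono_neutral_left)
    show "\<forall>k\<in>P (m + c) - P (u l + c). t k l = 0"
      using t(2) by (fastforce simp: P_def)
  qed (use that P in \<open>auto simp: P_def\<close>)
  have supp: "{l. q l \<noteq> 0 \<and> u l \<le> m} \<subseteq> (\<Union>k\<in>P (m + c). {l. t k l \<noteq> 0})" for m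
  proof
    fix l assume "l \<in> {l. q l \<noteq> 0 \<and> u l \<le> m}"
    then have "(\<Sum>k\<in>P (m + c). t k l) \<noteq> 0" using q[of l m] by auto
    then obtain k where "k \<in> P (m + c)" "t k l \<noteq> 0" by (rule sum.not_neutral_contains_not_neutral)
    then show "l \<in> (\<Union>k\<in>P (m + c). {l. t k l \<noteq> 0})" by blast
  qed
  have "admissible_wt u q"
    unfolding admissible_wt_def using finite_subset[OF supp] P t(1) by blast
  moreover have "{l. q l \<noteq> 0} \<subseteq> L"
    using supp t(2) by fastforce
  moreover have "expansion X p = expansion Y q"
  proof
    fix f
    obtain m1 where m1: "\<And>k r. m1 < w k \<Longrightarrow> X k r f = 0" using monomials_bound[OF X] by blast
    obtain m2 where m2: "\<And>k r. m2 < u k \<Longrightarrow> Y k r f = 0" using monomials_bound[OF Y] by blast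
    define m where "m = max m1 m2"
    have m: "\<And>k r. m < w k \<Longrightarrow> X k r f = 0" "\<And>k r. m < u k \<Longrightarrow> Y k r f = 0"
      using m1 m2 by (auto simp: m_def)
    define S where "S = (\<Union>k\<in>P (m + c). {l. t k l \<noteq> 0})"
    have S: "finite S" using P t(1) by (auto simp: S_def)
    have "expansion X p f = (\<Sum>k\<in>P (m + c). X k (p k) f)"
      by (rule expansion_sum[OF X m(1) P]) (auto simp: P_def)
    also have "\<dots> = (\<Sum>k\<in>P (m + c). \<Sum>l\<in>S. Y l (t k l) f)"
      unfolding t(3) using S
      by (intro sum.cong refl expansion_sum[OF Y m(2)]) (auto simp: S_def)
    also have "\<dots> = (\<Sum>l\<in>S. Y l (\<Sum>k\<in>P (m + c). t k l) f)"
      unfolding monomials_sum[OF Y] by (rule sum.swap)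
    also have "\<dots> = (\<Sum>l\<in>S. Y l (q l) f)"
    proof (rule sum.cong)
      \<comment> \<open>Above weight \<open>m\<close> the two coefficients may differ, but there
        \<open>Y l\<close> vanishes on \<open>f\<close>.\<close>
      fix l show "Y l (\<Sum>k\<in>P (m + c). t k l) f = Y l (q l) f"
        by (cases "u l \<le> m") (simp_all add: q[of l m] m(2))
    qed simp
    also have "\<dots> = expansion Y q f"
      by (rule expansion_sum[OF Y m(2) S, symmetric]) (use supp S_def in auto)
    finally show "expansion X p f = expansion Y q f" .
  qed
  ultimately show ?thesis by blast
qed


section \<open>Standard, polarized and left forms\<close>

definition raise_at :: "'n \<Rightarrow> 'd \<Rightarrow> ('n \<Rightarrow> 'd \<Rightarrow> nat) \<Rightarrow> 'n \<Rightarrow> 'd \<Rightarrow> nat" where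
  "raise_at j i I = I(j := mi_raise i (I j))"

abbreviation deriv_at :: "'n \<Rightarrow> 'd::finite \<Rightarrow> ('n \<Rightarrow> 'd loc) \<Rightarrow> 'n \<Rightarrow> 'd loc" where
  "deriv_at j i g \<equiv> g(j := total_deriv i (g j))"

definition product_tail :: "('n::{finite,linorder} \<Rightarrow> 'd::finite \<Rightarrow> nat) \<Rightarrow> ('n, 'd) multi_op" where
  "product_tail I g = g first * (\<Prod>j\<in>-{first}. total_derivs (I j) (g j))"

definition std_mon ::
    "('n::finite \<Rightarrow> 'd::finite \<Rightarrow> nat) \<Rightarrow> 'd loc \<Rightarrow> ('n, 'd) multi_op" where
  "std_mon I r g = r * (\<Prod>j\<in>UNIV. total_derivs (I j) (g j))"

text \<open>By the Leibniz rule, precomposition with d/dy_1, the sum of the d/dx_j, is the total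
  derivative of the whole product (\<open>total_deriv_product_tail\<close>). Powers of d/dy_1
  therefore become outer derivatives, and the first argument itself stays undifferentiated.\<close>

definition polar_mon ::
    "('n::{finite,linorder} \<Rightarrow> 'd::finite \<Rightarrow> nat) \<Rightarrow> 'd loc \<Rightarrow> ('n, 'd) multi_op" where
  "polar_mon I r g = r * total_derivs (I first) (product_tail I g)"

definition left_mon ::
    "('n::{finite,linorder} \<Rightarrow> 'd::finite \<Rightarrow> nat) \<Rightarrow> 'd loc \<Rightarrow> ('n, 'd) multi_op" where
  "left_mon I r g = total_derivs (I first) (r * product_tail I g)"

lemma raise_at_same [simp]: "raise_at j i I j = mi_raise i (I j)"
  and raise_at_other [simp]: "l \<noteq> j \<Longrightarrow> raise_at j i I l = I l"
  and raise_at_upd: "raise_at j i (I(j := K)) = I(j := mi_raise i K)"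
  by (auto simp: raise_at_def)

lemma mi_size_raise: "mi_size (mi_raise i I) = Suc (mi_size I)"
proof -
  have "mi_size (mi_raise i I) = (\<Sum>k\<in>UNIV. I k + (if k = i then 1 else 0))"
    unfolding mi_size_def mi_raise_def by (rule sum.cong) auto
  then show ?thesis by (simp add: sum.distrib mi_size_def)
qed

lemma total_deriv_one [simp]: "total_deriv i 1 = 0"
  using total_deriv_const[of i 1] by simp

lemma total_deriv_minus: "total_deriv i (- f) = - total_deriv i f"
  by (rule linear_neg[OF linear_total_deriv])

lemma total_deriv_prod:
  "finite S \<Longrightarrow> total_deriv i (\<Prod>l\<in>S. F l)
     = (\<Sum>j\<in>S. \<Prod>l\<in>S. if l = j then total_deriv i (F l) else F l)"
proof (induction S rule: finite_induct)
  case (insert a S)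
  have 1: "(\<Prod>l\<in>S. if l = a then total_deriv i (F l) else F l) = (\<Prod>l\<in>S. F l)"
    using insert.hyps by (intro prod.cong) auto
  have 2: "(\<Prod>l\<in>insert a S. if l = j then total_deriv i (F l) else F l)
      = F a * (\<Prod>l\<in>S. if l = j then total_deriv i (F l) else F l)" if "j \<in> S" for j
    using insert.hyps that by auto
  have 3: "(\<Prod>l\<in>insert a S. if l = a then total_deriv i (F l) else F l)
      = total_deriv i (F a) * (\<Prod>l\<in>S. F l)"
    using insert.hyps by (simp add: 1)
  have "(\<Sum>j\<in>insert a S. \<Prod>l\<in>insert a S. if l = j then total_deriv i (F l) else F l)
      = total_deriv i (F a) * (\<Prod>l\<in>S. F l)
        + F a * (\<Sum>j\<in>S. \<Prod>l\<in>S. if l = j then total_deriv i (F l) else F l)"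
    by (simp only: sum.insert[OF insert.hyps] 3 sum_distrib_left 2 cong: sum.cong)
  then show ?case by (simp only: prod.insert[OF insert.hyps] total_deriv_mult insert.IH)
qed simp

lemma total_derivs_add: "total_derivs I (f + g) = total_derivs I f + total_derivs I g"
  by (rule linear_add[OF linear_total_derivs])

lemma total_derivs_0 [simp]: "total_derivs I 0 = 0"
  by (rule linear_0[OF linear_total_derivs])

lemma total_derivs_sum: "total_derivs I (sum F A) = (\<Sum>a\<in>A. total_derivs I (F a))"
  by (rule linear_sum[OF linear_total_derivs])

lemma total_derivs_raise': "total_derivs (mi_raise i I) f = total_derivs I (total_deriv i f)"
  by (simp add: total_derivs_raise total_derivs_deriv)

lemma product_tail_raise:
  "j \<noteq> first \<Longrightarrow> product_tail (raise_at j i I) g = product_tail I (deriv_at j i g)"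
  unfolding product_tail_def
  by (auto intro!: prod.cong arg_cong2[of _ _ _ _ "(*)"] simp: raise_at_def total_derivs_raise'
      split: if_split_asm)

lemma product_tail_upd [simp]: "product_tail (I(first := K)) = product_tail I"
  by (auto simp: product_tail_def fun_eq_iff intro!: prod.cong arg_cong2[of _ _ _ _ "(*)"])

lemma product_tail_raise_first [simp]: "product_tail (raise_at first i I) = product_tail I"
  by (simp add: raise_at_def)

lemma total_deriv_product_tail:
  "total_deriv i (product_tail I g) = (\<Sum>j\<in>UNIV. product_tail I (deriv_at j i g))"
proof -
  have U: "UNIV = insert first (-{first})" by auto
  have "product_tail I (deriv_at first i g)
      = total_deriv i (g first) * (\<Prod>j\<in>-{first}. total_derivs (I j) (g j))"
    by (auto simp: product_tail_def intro!: prod.cong arg_cong2[of _ _ _ _ "(*)"])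
  moreover have "product_tail I (deriv_at j i g) = g first *
      (\<Prod>l\<in>-{first}. if l = j then total_deriv i (total_derivs (I l) (g l)) else total_derivs (I l) (g l))"
    if "j \<in> -{first}" for j
    using that by (auto simp: product_tail_def total_derivs_deriv split: if_split_asm
        intro!: prod.cong arg_cong2[of _ _ _ _ "(*)"])
  ultimately show ?thesis
    by (subst U, subst sum.insert)
      (simp_all add: product_tail_def[of I g] total_deriv_mult total_deriv_prod sum_distrib_left)
qed

lemma total_deriv_product_tail':
  "total_deriv i (product_tail I g) = product_tail I (deriv_at first i g)
     + (\<Sum>j\<in>-{first}. product_tail (raise_at j i I) g)"
proof -
  have U: "UNIV = insert first (-{first})" by auto
  show ?thesis
    unfolding total_deriv_product_tail by (subst U, subst sum.insert) (simp_all add: product_tail_raise)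
qed

lemma std_mon_raise: "std_mon (raise_at j i I) r g = std_mon I r (deriv_at j i g)"
  unfolding std_mon_def
  by (auto intro!: prod.cong arg_cong2[of _ _ _ _ "(*)"] simp: raise_at_def total_derivs_raise')

lemma total_deriv_std_mon:
  "total_deriv i (std_mon I r g)
     = std_mon I (total_deriv i r) g + (\<Sum>j\<in>UNIV. std_mon (raise_at j i I) r g)"
proof -
  have "(\<Prod>l\<in>UNIV. if l = j then total_deriv i (total_derivs (I l) (g l)) else total_derivs (I l) (g l))
      = (\<Prod>l\<in>UNIV. total_derivs (raise_at j i I l) (g l))" for j
    by (rule prod.cong) (auto simp: raise_at_def total_derivs_raise)
  then show ?thesis
    by (simp add: std_mon_def total_deriv_mult total_deriv_prod sum_distrib_left)
qed

text \<open>This is the definition of d/dy_1 solved for d/dx_1: it equals d/dy_1 minus the d/dy_j of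
  the other slots.\<close>

lemma polar_mon_deriv_first:
  "polar_mon I r (deriv_at first i g)
     = polar_mon (raise_at first i I) r g + (\<Sum>j\<in>-{first}. polar_mon (raise_at j i I) (- r) g)"
proof -
  have "polar_mon (raise_at first i I) r g = r * total_derivs (I first) (total_deriv i (product_tail I g))"
    by (simp add: polar_mon_def total_derivs_raise')
  moreover have "polar_mon (raise_at j i I) (- r) g
      = - (r * total_derivs (I first) (product_tail (raise_at j i I) g))" if "j \<in> -{first}" for j
    using that by (simp add: polar_mon_def)
  ultimately show ?thesis
    by (simp add: total_deriv_product_tail' total_derivs_add total_derivs_sum
        polar_mon_def[of I r] distrib_left sum_distrib_left sum_negf)
qed

lemma total_deriv_left_mon: "total_deriv i (left_mon I r g) = left_mon (raise_at first i I) r g"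
  by (simp add: left_mon_def total_derivs_raise)

lemma std_mon_add: "std_mon I (r + s) g = std_mon I r g + std_mon I s g"
  by (simp add: std_mon_def distrib_right)

lemma polar_mon_add: "polar_mon I (r + s) g = polar_mon I r g + polar_mon I s g"
  and left_mon_add: "left_mon I (r + s) g = left_mon I r g + left_mon I s g"
  by (simp_all add: polar_mon_def left_mon_def distrib_right total_derivs_add)

lemma product_tail_zero: "g j = 0 \<Longrightarrow> product_tail I g = 0"
proof (cases "j = first")
  case False
  assume "g j = 0"
  with False have "(\<Prod>j\<in>-{first}. total_derivs (I j) (g j)) = 0"
    by (intro prod_zero) (auto intro: bexI[of _ j])
  then show ?thesis by (simp add: product_tail_def)
qed (simp add: product_tail_def)

lemma std_mon_zero:
  assumes "g j = 0"
  shows "std_mon I r g = 0"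
proof -
  have "(\<Prod>j\<in>UNIV. total_derivs (I j) (g j)) = 0"
    using assms by (intro prod_zero) (auto intro: exI[of _ j])
  then show ?thesis by (simp add: std_mon_def)
qed

lemma polar_mon_zero: "g j = 0 \<Longrightarrow> polar_mon I r g = 0"
  and left_mon_zero: "g j = 0 \<Longrightarrow> left_mon I r g = 0"
  by (simp_all add: polar_mon_def left_mon_def product_tail_zero)

lemma left_mon_uminus: "left_mon I (- r) g = - left_mon I r g"
  unfolding left_mon_def by (simp add: linear_neg[OF linear_total_derivs])

text \<open>Standard and polarized monomials treat all slots but the first alike, hence the
  induction on the exponent of the first slot alone.\<close>

lemma std_in_polar: "std_mon I r \<in> fspan polar_mon UNIV"
proof -
  have "std_mon (I(first := K)) r \<in> fspan polar_mon UNIV" for K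
  proof (induction K rule: multi_index_induct)
    case zero
    have U: "UNIV = insert first (-{first :: 'a})" by auto
    have "std_mon (I(first := (\<lambda>_. 0))) r = polar_mon (I(first := (\<lambda>_. 0))) r"
      unfolding std_mon_def polar_mon_def product_tail_def
      by (rule ext, subst U, subst prod.insert) (auto intro!: prod.cong arg_cong2[of _ _ _ _ "(*)"])
    then show ?case by (simp only: fspan.gen UNIV_I)
  next
    case (raise K i)
    have "(\<lambda>g. std_mon (I(first := K)) r (deriv_at first i g)) \<in> fspan polar_mon UNIV"
      using raise
    proof (rule fspan_transfer[where \<Phi> = "\<lambda>A g. A (deriv_at first i g)"])
      fix J :: "'a \<Rightarrow> 'b \<Rightarrow> nat" and s :: "'b loc"
      show "(\<lambda>g. polar_mon J s (deriv_at first i g)) \<in> fspan polar_mon UNIV"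
        unfolding polar_mon_deriv_first by (intro fspan.add fspan_sum fspan.gen UNIV_I)
    qed (rule refl)
    then show ?case by (simp only: std_mon_raise[symmetric] raise_at_upd fun_upd_same)
  qed
  from this[of "I first"] show ?thesis by simp
qed

text \<open>
  Moving a total derivative across the coefficient: \<open>r D = D \<circ> r - (D r)\<close>.  What remains after all
  moves without an outer total derivative is the monomial of the characteristic.
\<close>

lemma polar_in_left:
  "(\<lambda>g. polar_mon I r g
       - left_mon (I(first := (\<lambda>_. 0))) ((-1) ^ mi_size (I first) * total_derivs (I first) r) g)
     \<in> fspan left_mon {J. J first \<noteq> (\<lambda>_. 0)}"
proof -
  let ?I0 = "I(first := (\<lambda>_. 0))"
  define E where "E K r g = polar_mon (I(first := K)) r g
    - left_mon ?I0 ((-1) ^ mi_size K * total_derivs K r) g" for K r g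
  \<comment> \<open>The coefficient is generalized: the step uses the hypothesis for
    \<open>r\<close> and for \<open>total_deriv i r\<close>.\<close>
  have "E K r \<in> fspan left_mon {J. J first \<noteq> (\<lambda>_. 0)}" for K r
  proof (induction K arbitrary: r rule: multi_index_induct)
    case zero
    have "E (\<lambda>_. 0) r = (\<lambda>_. 0)"
      by (auto simp: E_def polar_mon_def left_mon_def mi_size_def)
    then show ?case by (simp only: fspan.zero)
  next
    case (raise K i)
    have "(\<lambda>g. E K r g + left_mon ?I0 ((-1) ^ mi_size K * total_derivs K r) g) \<in> fspan left_mon UNIV"
      by (intro fspan.add fspan_mono[OF raise] fspan.gen) auto
    then have "polar_mon (I(first := K)) r \<in> fspan left_mon UNIV"
      by (simp add: E_def)
    then have "(\<lambda>g. total_deriv i (polar_mon (I(first := K)) r g))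
        \<in> fspan left_mon {J. J first \<noteq> (\<lambda>_. 0)}"
    proof (rule fspan_transfer[where \<Phi> = "\<lambda>A g. total_deriv i (A g)"])
      fix J :: "'a \<Rightarrow> 'b \<Rightarrow> nat" and s :: "'b loc"
      have "mi_raise i (J first) \<noteq> (\<lambda>_. 0)" by (auto simp: mi_raise_def fun_eq_iff)
      then show "(\<lambda>g. total_deriv i (left_mon J s g)) \<in> fspan left_mon {J. J first \<noteq> (\<lambda>_. 0)}"
        unfolding total_deriv_left_mon by (intro fspan.gen) simp
    qed (simp add: total_deriv_add)
    moreover have "(\<lambda>g. - E K (total_deriv i r) g) \<in> fspan left_mon {J. J first \<noteq> (\<lambda>_. 0)}"
      by (intro fspan_uminus raise left_mon_uminus)
    ultimately have "(\<lambda>g. total_deriv i (polar_mon (I(first := K)) r g) + - E K (total_deriv i r) g)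
        \<in> fspan left_mon {J. J first \<noteq> (\<lambda>_. 0)}"
      by (rule fspan.add)
    also have "(\<lambda>g. total_deriv i (polar_mon (I(first := K)) r g) + - E K (total_deriv i r) g)
        = E (mi_raise i K) r"
    proof
      fix g
      have "total_deriv i (polar_mon (I(first := K)) r g) = polar_mon (I(first := mi_raise i K)) r g
          + polar_mon (I(first := K)) (total_deriv i r) g"
        by (simp add: polar_mon_def total_deriv_mult total_derivs_raise)
      then show "total_deriv i (polar_mon (I(first := K)) r g) + - E K (total_deriv i r) g
          = E (mi_raise i K) r g"
        by (simp add: E_def mi_size_raise total_derivs_raise' left_mon_uminus)
    qed
    finally show ?case .
  qed
  from this[of "I first" r] show ?thesis by (simp add: E_def[abs_def])
qed

text \<open>The outer derivatives are expanded by the Leibniz rule. This closes the circle from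
  standard over polarized to left form, so that the left form describes the same operators.\<close>

lemma left_in_std: "left_mon I r \<in> fspan std_mon UNIV"
proof -
  have "left_mon (I(first := K)) r \<in> fspan std_mon UNIV" for K
  proof (induction K rule: multi_index_induct)
    case zero
    have U: "UNIV = insert first (-{first :: 'a})" by auto
    have "left_mon (I(first := (\<lambda>_. 0))) r = std_mon (I(first := (\<lambda>_. 0))) r"
      unfolding std_mon_def left_mon_def product_tail_def
      by (rule ext, subst (3) U, subst prod.insert)
         (auto intro!: prod.cong arg_cong2[of _ _ _ _ "(*)"])
    then show ?case by (simp only: fspan.gen UNIV_I)
  next
    case (raise K i)
    have "(\<lambda>g. total_deriv i (left_mon (I(first := K)) r g)) \<in> fspan std_mon UNIV"
      using raise
    proof (rule fspan_transfer[where \<Phi> = "\<lambda>A g. total_deriv i (A g)"])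
      fix J :: "'a \<Rightarrow> 'b \<Rightarrow> nat" and s :: "'b loc"
      show "(\<lambda>g. total_deriv i (std_mon J s g)) \<in> fspan std_mon UNIV"
        unfolding total_deriv_std_mon by (intro fspan.add fspan_sum fspan.gen UNIV_I)
    qed (simp add: total_deriv_add)
    then show ?case by (simp only: total_deriv_left_mon raise_at_upd fun_upd_same)
  qed
  from this[of "I first"] show ?thesis by simp
qed


section \<open>Adjoining the vertical derivatives\<close>

definition vertical ::
    "('n \<Rightarrow> (('d \<Rightarrow> nat) \<Rightarrow>\<^sub>0 nat)) \<Rightarrow> ('n \<Rightarrow> 'd::finite loc) \<Rightarrow> 'n \<Rightarrow> 'd loc" where
  "vertical \<alpha> f = (\<lambda>j. vert_derivs (\<alpha> j) (f j))"

text \<open>In all forms the vertical derivatives act first. Conversions leave their exponents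
  fixed, so identities between finite sums in the total derivatives lift to admissible sums without
  change of weight.\<close>

definition lift_vert ::
    "(('n \<Rightarrow> 'd \<Rightarrow> nat) \<Rightarrow> 'd loc \<Rightarrow> ('n, 'd) multi_op) \<Rightarrow>
     ('n \<Rightarrow> 'd \<Rightarrow> nat) \<times> ('n \<Rightarrow> (('d \<Rightarrow> nat) \<Rightarrow>\<^sub>0 nat)) \<Rightarrow> 'd::finite loc \<Rightarrow> ('n, 'd) multi_op" where
  "lift_vert M k r f = M (fst k) r (vertical (snd k) f)"

definition wt ::
    "('n::finite \<Rightarrow> 'd \<Rightarrow> nat) \<times> ('n \<Rightarrow> (('d::finite \<Rightarrow> nat) \<Rightarrow>\<^sub>0 nat)) \<Rightarrow> nat" where
  "wt k = (\<Sum>j\<in>UNIV. fdeg (snd k j))"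

text \<open>A single summand of \<open>char_op\<close>: integration by parts moves the outer
  derivatives onto the coefficient. It is phrased as a \<open>left_mon\<close> so that it can be
  compared with left forms directly.\<close>

definition char_mon ::
    "('n::{finite,linorder} \<Rightarrow> 'd::finite \<Rightarrow> nat) \<Rightarrow> 'd loc \<Rightarrow> ('n, 'd) multi_op" where
  "char_mon I r = left_mon (I(first := (\<lambda>_. 0))) ((-1) ^ mi_size (I first) * total_derivs (I first) r)"

text \<open>Pigeonhole: if the total fibre degree exceeds the sum of the bounds for the arguments,
  it exceeds the bound in some slot, and a zero in one slot kills the monomial.\<close>

lemma monomials_lift:
  fixes M :: "('n::finite \<Rightarrow> 'd::finite \<Rightarrow> nat) \<Rightarrow> 'd loc \<Rightarrow> ('n, 'd) multi_op"
  assumes "\<And>I r s g. M I (r + s) g = M I r g + M I s g" "\<And>I r g j. g j = 0 \<Longrightarrow> M I r g = 0"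
  shows "monomials wt (lift_vert M)"
  unfolding monomials_def
proof (intro conjI allI)
  fix f :: "'n \<Rightarrow> 'd loc"
  have "\<exists>m. \<forall>\<alpha>. m < fdeg \<alpha> \<longrightarrow> vert_derivs \<alpha> (f j) = 0" for j
    using vert_derivs_bound[of "f j"] by metis
  then obtain m where m: "\<And>j \<alpha>. m j < fdeg \<alpha> \<Longrightarrow> vert_derivs \<alpha> (f j) = 0" by metis
  have "lift_vert M k r f = 0" if "(\<Sum>j\<in>UNIV. m j) < wt k" for k r
  proof -
    have "\<exists>j. m j < fdeg (snd k j)"
    proof (rule ccontr)
      assume "\<nexists>j. m j < fdeg (snd k j)"
      then have "wt k \<le> (\<Sum>j\<in>UNIV. m j)"
        unfolding wt_def by (intro sum_mono) (auto simp: not_less)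
      with that show False by simp
    qed
    then obtain j where "m j < fdeg (snd k j)" ..
    then show ?thesis unfolding lift_vert_def
      by (intro assms(2)[of _ j]) (simp add: vertical_def m)
  qed
  then show "\<exists>m. \<forall>k r. m < wt k \<longrightarrow> lift_vert M k r f = 0" by blast
qed (simp add: lift_vert_def assms(1))

lemma monomials_std: "monomials wt (lift_vert std_mon)"
  by (rule monomials_lift) (simp_all add: std_mon_add std_mon_zero)

lemma monomials_polar: "monomials wt (lift_vert polar_mon)"
  by (rule monomials_lift) (simp_all add: polar_mon_add polar_mon_zero)

lemma monomials_left: "monomials wt (lift_vert left_mon)"
  by (rule monomials_lift) (simp_all add: left_mon_add left_mon_zero)

lemma monomials_char: "monomials wt (lift_vert char_mon)"
  by (rule monomials_lift)
    (simp_all add: char_mon_def left_mon_zero total_derivs_add distrib_left left_mon_add)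

lemma lift_vert_fspan:
  assumes "M (fst k) r \<in> fspan M' K"
  shows "lift_vert M k r \<in> fspan (lift_vert M') (K \<times> {snd k})"
proof -
  have "(\<lambda>f. M (fst k) r (vertical (snd k) f)) \<in> fspan (lift_vert M') (K \<times> {snd k})"
    using assms
  proof (rule fspan_transfer[where \<Phi> = "\<lambda>A f. A (vertical (snd k) f)"])
    fix I s assume "I \<in> K"
    then have "lift_vert M' (I, snd k) s \<in> fspan (lift_vert M') (K \<times> {snd k})"
      by (intro fspan.gen) simp
    then show "(\<lambda>f. M' I s (vertical (snd k) f)) \<in> fspan (lift_vert M') (K \<times> {snd k})"
      by (simp add: lift_vert_def[abs_def])
  qed (rule refl)
  then show ?thesis by (simp add: lift_vert_def[abs_def])
qed

lemma lift_vert_convert: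
  fixes M M' :: "('n::finite \<Rightarrow> 'd::finite \<Rightarrow> nat) \<Rightarrow> 'd loc \<Rightarrow> ('n, 'd) multi_op"
  assumes "monomials wt (lift_vert M)" "monomials wt (lift_vert M')" "admissible_wt wt p"
    and "\<And>I r. M I r \<in> fspan M' K"
  shows "\<exists>q. admissible_wt wt q \<and> {k. q k \<noteq> 0} \<subseteq> K \<times> UNIV
    \<and> expansion (lift_vert M) p = expansion (lift_vert M') q"
proof (rule expansion_convert[OF assms(1-3), of _ 0])
  fix k r
  show "lift_vert M k r \<in> fspan (lift_vert M') (K \<times> UNIV \<inter> {l. wt k \<le> wt l + 0})"
    by (rule fspan_mono[OF lift_vert_fspan[OF assms(4)]]) (auto simp: wt_def)
qed

text \<open>Induction over the exponents of all pairs \<open>(j, i)\<close>, starting from the plain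
  product: a derivative in the first slot turns into an outer one, any other raises an exponent of
  the tail.\<close>

lemma polar_monomial_eq:
  fixes f :: "'a::{finite,linorder} \<Rightarrow> 'b::finite loc"
  shows
  "polar_monomial I \<alpha> f = total_derivs (I first) (product_tail I (vertical \<alpha> f))"
proof -
  let ?T = "\<lambda>(j, i). polar_deriv j i"
  define P where "P k = (\<lambda>g :: 'a \<Rightarrow> 'b loc.
    total_derivs (curry k first) (product_tail (curry k) g))" for k
  have comm: "?T a (?T b A) = ?T b (?T a A)" for a b and A :: "('a, 'b) multi_op"
    by (cases a; cases b) (simp only: polar_deriv_commute split)
  have "op_monomial ?T k (\<lambda>g. \<Prod>j\<in>UNIV. g j) = P k" if "finite {a. k a \<noteq> 0}" for k
    using that
  proof (induction rule: finite_support_induct)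
    case zero
    have U: "UNIV = insert first (-{first :: 'a})" by auto
    have "(\<Prod>j\<in>UNIV. g j) = P (\<lambda>_. 0) g" for g
      unfolding P_def product_tail_def by (subst U, subst prod.insert) (auto simp: curry_def)
    then show ?case by auto
  next
    case (raise k a)
    obtain j i where a: "a = (j, i)" by force
    have c: "curry (k(a := Suc (k a))) = raise_at j i (curry k)"
      by (auto simp: fun_eq_iff a raise_at_def mi_raise_def)
    have "op_monomial ?T (k(a := Suc (k a))) (\<lambda>g. \<Prod>j\<in>UNIV. g j) = polar_deriv j i (P k)"
      unfolding op_monomial_raise[where T = ?T and k = k, OF comm raise(1)] raise(2) by (simp add: a)
    also have "\<dots> = P (k(a := Suc (k a)))"
    proof (cases "j = first")
      case True
      then show ?thesis unfolding P_def c
        by (simp add: polar_deriv_def precomp_total_def total_derivs_raise'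
            total_deriv_product_tail total_derivs_sum)
    next
      case False
      then show ?thesis unfolding P_def c
        by (simp add: polar_deriv_def precomp_total_def product_tail_raise curry_def)
    qed
    finally show ?case .
  qed
  from this[of "\<lambda>(j, i). I j i"]
  have "op_monomial ?T (\<lambda>(j, i). I j i) (\<lambda>g. \<Prod>j\<in>UNIV. g j) = P (\<lambda>(j, i). I j i)" by simp
  then show ?thesis by (simp add: polar_monomial_def P_def curry_def vertical_def)
qed

lemma admissible_iff: "admissible p \<longleftrightarrow> admissible_wt wt (case_prod p)"
  by (simp add: admissible_def admissible_wt_def wt_def split_def)

lemma ldo_op_eq: "ldo_op p = expansion (lift_vert std_mon) (case_prod p)"
  by (simp add: ldo_op_def[abs_def] expansion_def[abs_def] lift_vert_def vertical_def std_mon_def split_def)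

lemma polar_op_eq: "polar_op p = expansion (lift_vert polar_mon) (case_prod p)"
  by (simp add: polar_op_def[abs_def] expansion_def[abs_def] lift_vert_def polar_monomial_eq
      polar_mon_def split_def)

lemma char_op_eq: "char_op p = expansion (lift_vert char_mon) (case_prod p)"
  by (simp add: char_op_def[abs_def] expansion_def[abs_def] lift_vert_def polar_monomial_eq
      char_mon_def left_mon_def split_def)

lemma multilinear_std: "multilinear (lift_vert std_mon k r)"
  unfolding multilinear_def
proof (intro allI)
  fix j and f :: "'a \<Rightarrow> 'b loc"
  define c where "c = r * (\<Prod>l\<in>UNIV - {j}. total_derivs (fst k l) (vert_derivs (snd k l) (f l)))"
  have "lift_vert std_mon k r (f(j := g)) = c * total_derivs (fst k j) (vert_derivs (snd k j) g)" for g
  proof -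
    have "(\<Prod>l\<in>UNIV - {j}. total_derivs (fst k l) (vert_derivs (snd k l) ((f(j := g)) l)))
        = (\<Prod>l\<in>UNIV - {j}. total_derivs (fst k l) (vert_derivs (snd k l) (f l)))"
      by (rule prod.cong) auto
    then show ?thesis
      by (simp add: lift_vert_def std_mon_def vertical_def c_def prod.remove[of UNIV j] mult_ac
          del: fun_upd_apply) simp
  qed
  moreover have "linear (\<lambda>g. c * total_derivs (fst k j) (vert_derivs (snd k j) g))"
    by (rule linearI) (simp_all add: linear_add[OF linear_vert_derivs] linear_scale[OF linear_vert_derivs]
      linear_scale[OF linear_total_derivs] total_derivs_add distrib_left)
  ultimately show "linear (\<lambda>g. lift_vert std_mon k r (f(j := g)))" by simp
qed

lemma multilinear_expansion:
  fixes X :: "'k \<Rightarrow> 'r::ab_group_add \<Rightarrow> ('n \<Rightarrow> 'v::real_vector) \<Rightarrow> 'w::real_vector"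
  assumes X: "monomials w X" and p: "admissible_wt w p" and lin: "\<And>k r. multilinear (X k r)"
  shows "multilinear (expansion X p)"
  unfolding multilinear_def
proof (intro allI)
  fix j f
  have ex: "\<exists>m. \<forall>k r. m < w k \<longrightarrow> X k r f = 0" for f using X unfolding monomials_def by blast
  have L: "linear (\<lambda>g. X k r (f(j := g)))" for k r using lin unfolding multilinear_def by blast
  have fin: "finite {k. p k \<noteq> 0 \<and> w k \<le> m}" for m using p by (simp add: admissible_wt_def)
  have S: "expansion X p (f(j := g)) = (\<Sum>k\<in>{k. p k \<noteq> 0 \<and> w k \<le> m}. X k (p k) (f(j := g)))"
    if "\<forall>k r. m < w k \<longrightarrow> X k r (f(j := g)) = 0" for g m
    by (rule expansion_sum[OF X _ fin]) (use that in auto)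
  show "linear (\<lambda>g. expansion X p (f(j := g)))"
  proof (rule linearI)
    fix g h
    obtain m1 m2 m3 where m: "\<forall>k r. m1 < w k \<longrightarrow> X k r (f(j := g)) = 0"
      "\<forall>k r. m2 < w k \<longrightarrow> X k r (f(j := h)) = 0" "\<forall>k r. m3 < w k \<longrightarrow> X k r (f(j := g + h)) = 0"
      using ex by metis
    \<comment> \<open>The bound depends on the argument; the maximum puts all terms of the identity
      on one finite index set.\<close>
    define m where "m = max m1 (max m2 m3)"
    have "\<forall>k r. m < w k \<longrightarrow> X k r (f(j := g')) = 0" if "g' \<in> {g, h, g + h}" for g'
      using m that by (auto simp: m_def)
    then show "expansion X p (f(j := g + h)) = expansion X p (f(j := g)) + expansion X p (f(j := h))"
      using S[of m] by (simp add: linear_add[OF L] sum.distrib)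
  next
    fix c g
    obtain m1 m2 where m: "\<forall>k r. m1 < w k \<longrightarrow> X k r (f(j := g)) = 0"
      "\<forall>k r. m2 < w k \<longrightarrow> X k r (f(j := c *\<^sub>R g)) = 0"
      using ex by metis
    define m where "m = max m1 m2"
    have "\<forall>k r. m < w k \<longrightarrow> X k r (f(j := g')) = 0" if "g' \<in> {g, c *\<^sub>R g}" for g'
      using m that by (auto simp: m_def)
    then show "expansion X p (f(j := c *\<^sub>R g)) = c *\<^sub>R expansion X p (f(j := g))"
      using S[of m] by (simp add: linear_scale[OF L] scaleR_sum_right)
  qed
qed

lemma LDO_std: "A \<in> LDO \<longleftrightarrow> (\<exists>p. admissible_wt wt p \<and> A = expansion (lift_vert std_mon) p)"
proof
  assume "A \<in> LDO"
  then show "\<exists>p. admissible_wt wt p \<and> A = expansion (lift_vert std_mon) p"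
    by (auto simp: LDO_def ldo_op_eq admissible_iff)
next
  assume "\<exists>p. admissible_wt wt p \<and> A = expansion (lift_vert std_mon) p"
  then obtain p where p: "admissible_wt wt p" "A = expansion (lift_vert std_mon) p" by blast
  moreover have "multilinear A"
    unfolding p(2) by (rule multilinear_expansion[OF monomials_std p(1) multilinear_std])
  moreover have "admissible (curry p) \<and> A = ldo_op (curry p)"
    using p by (simp add: ldo_op_eq admissible_iff)
  ultimately show "A \<in> LDO" unfolding LDO_def by blast
qed

lemma LDO_left: "A \<in> LDO \<longleftrightarrow> (\<exists>p. admissible_wt wt p \<and> A = expansion (lift_vert left_mon) p)"
proof
  assume "A \<in> LDO"
  then obtain p where p: "admissible_wt wt p" "A = expansion (lift_vert std_mon) p"
    unfolding LDO_std by blast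
  obtain q where q: "admissible_wt wt q" "A = expansion (lift_vert polar_mon) q"
    using lift_vert_convert[OF monomials_std monomials_polar p(1) std_in_polar] p(2) by blast
  have "polar_mon I r \<in> fspan left_mon UNIV" for I :: "'a \<Rightarrow> 'b \<Rightarrow> nat" and r
  proof -
    have "(\<lambda>g. (polar_mon I r g - char_mon I r g) + char_mon I r g) \<in> fspan left_mon UNIV"
      unfolding char_mon_def by (intro fspan.add fspan_mono[OF polar_in_left] fspan.gen) auto
    then show ?thesis by simp
  qed
  from lift_vert_convert[OF monomials_polar monomials_left q(1) this] q(2)
  show "\<exists>p. admissible_wt wt p \<and> A = expansion (lift_vert left_mon) p" by auto
next
  assume "\<exists>p. admissible_wt wt p \<and> A = expansion (lift_vert left_mon) p"
  then show "A \<in> LDO" unfolding LDO_std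
    using lift_vert_convert[OF monomials_left monomials_std _ left_in_std] by metis
qed

lemma LDO_polar: "A \<in> LDO \<Longrightarrow> \<exists>q. admissible q \<and> A = polar_op q"
proof -
  assume "A \<in> LDO"
  then obtain p where p: "admissible_wt wt p" "A = expansion (lift_vert std_mon) p"
    unfolding LDO_std by blast
  obtain q where "admissible_wt wt q" "A = expansion (lift_vert polar_mon) q"
    using lift_vert_convert[OF monomials_std monomials_polar p(1) std_in_polar] p(2) by blast
  then have "admissible (curry q) \<and> A = polar_op (curry q)"
    by (simp add: admissible_iff polar_op_eq)
  then show ?thesis by blast
qed

text \<open>The left form of a polarized operator is split by whether a term carries an outer
  derivative. The supports are disjoint and the part without outer derivatives is
  \<open>char_op q\<close>; uniqueness of the left form will then read off the
  characteristic.\<close>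

lemma polar_op_char_op:
  fixes q :: "('n::{finite,linorder}, 'd::finite) coeffs"
  assumes "admissible q"
  shows "\<exists>s t. admissible_wt wt s \<and> admissible_wt wt t \<and> {k. s k \<noteq> 0} \<subseteq> {k. fst k first = (\<lambda>_. 0)} \<and>
    {k. t k \<noteq> 0} \<subseteq> {k. fst k first \<noteq> (\<lambda>_. 0)} \<and>
    char_op q = expansion (lift_vert left_mon) s \<and>
    polar_op q = expansion (lift_vert left_mon) (\<lambda>k. s k + t k)"
proof -
  let ?q = "case_prod q"
  have q: "admissible_wt wt ?q" using assms by (simp add: admissible_iff)
  \<comment> \<open>What \<open>polar_in_left\<close> leaves of a polarized monomial: a sum of terms
    with outer derivatives.\<close>
  define Z where "Z I r g = polar_mon I r g - char_mon I r g" for I r and g :: "'n \<Rightarrow> 'd loc"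
  have Z: "monomials wt (lift_vert Z)"
    by (rule monomials_lift)
      (simp_all add: Z_def char_mon_def polar_mon_add polar_mon_zero left_mon_zero
        total_derivs_add distrib_left left_mon_add)
  have "char_mon I r \<in> fspan left_mon {J. J first = (\<lambda>_. 0)}" for I :: "'n \<Rightarrow> 'd \<Rightarrow> nat" and r
    unfolding char_mon_def by (intro fspan.gen) simp
  from lift_vert_convert[OF monomials_char monomials_left q this]
  obtain s where s: "admissible_wt wt s" "{k. s k \<noteq> 0} \<subseteq> {J. J first = (\<lambda>_. 0)} \<times> UNIV"
    "expansion (lift_vert char_mon) ?q = expansion (lift_vert left_mon) s" by blast
  have "Z I r \<in> fspan left_mon {J. J first \<noteq> (\<lambda>_. 0)}" for I r
    using polar_in_left[of I r] by (simp add: Z_def[abs_def] char_mon_def)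
  from lift_vert_convert[OF Z monomials_left q this]
  obtain t where t: "admissible_wt wt t" "{k. t k \<noteq> 0} \<subseteq> {J. J first \<noteq> (\<lambda>_. 0)} \<times> UNIV"
    "expansion (lift_vert Z) ?q = expansion (lift_vert left_mon) t" by blast
  have "expansion (lift_vert polar_mon) ?q f
      = expansion (lift_vert char_mon) ?q f + expansion (lift_vert Z) ?q f" for f
  proof -
    obtain m1 where m1: "\<And>k r. m1 < wt k \<Longrightarrow> lift_vert char_mon k r f = 0"
      using monomials_bound[OF monomials_char] by blast
    obtain m2 where m2: "\<And>k r. m2 < wt k \<Longrightarrow> lift_vert Z k r f = 0"
      using monomials_bound[OF Z] by blast
    obtain m3 where m3: "\<And>k r. m3 < wt k \<Longrightarrow> lift_vert polar_mon k r f = 0"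
      using monomials_bound[OF monomials_polar] by blast
    define m where "m = max m1 (max m2 m3)"
    define A where "A = {k. ?q k \<noteq> 0 \<and> wt k \<le> m}"
    have A: "finite A" using q unfolding A_def admissible_wt_def by blast
    have "expansion (lift_vert char_mon) ?q f = (\<Sum>k\<in>A. lift_vert char_mon k (?q k) f)"
      by (rule expansion_sum[OF monomials_char _ A, of m]) (auto simp: A_def m_def m1)
    moreover have "expansion (lift_vert Z) ?q f = (\<Sum>k\<in>A. lift_vert Z k (?q k) f)"
      by (rule expansion_sum[OF Z _ A, of m]) (auto simp: A_def m_def m2)
    moreover have "expansion (lift_vert polar_mon) ?q f = (\<Sum>k\<in>A. lift_vert polar_mon k (?q k) f)"
      by (rule expansion_sum[OF monomials_polar _ A, of m]) (auto simp: A_def m_def m3)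
    ultimately show ?thesis
      by (simp add: lift_vert_def Z_def flip: sum.distrib)
  qed
  then have "polar_op q = expansion (lift_vert left_mon) (\<lambda>k. s k + t k)"
    by (simp add: polar_op_eq fun_eq_iff expansion_add[OF monomials_left s(1) t(1)] s(3) t(3))
  moreover have "char_op q = expansion (lift_vert left_mon) s" by (simp add: char_op_eq s(3))
  moreover have "{k. s k \<noteq> 0} \<subseteq> {k. fst k first = (\<lambda>_. 0)}" "{k. t k \<noteq> 0} \<subseteq> {k. fst k first \<noteq> (\<lambda>_. 0)}"
    using s(2) t(2) by force+
  ultimately show ?thesis using s(1) t(1) by blast
qed


section \<open>Closure properties of LDO(n)\<close>

lemma multilinear_zero: "multilinear A \<Longrightarrow> f j = 0 \<Longrightarrow> A f = 0"
proof -
  assume "multilinear A" "f j = 0"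
  then have "linear (\<lambda>g. A (f(j := g)))" "f(j := 0) = f" by (auto simp: multilinear_def)
  then show "A f = 0" using linear_0 by fastforce
qed

lemma LDO_multilinear: "A \<in> LDO \<Longrightarrow> multilinear A"
  by (simp add: LDO_def)

lemma LDO_zero: "(\<lambda>_. 0) \<in> LDO"
  unfolding LDO_std
  by (rule exI[of _ "\<lambda>_. 0"]) (auto simp: admissible_wt_def expansion_zero[OF monomials_std])

lemma LDO_add: "A \<in> LDO \<Longrightarrow> B \<in> LDO \<Longrightarrow> (\<lambda>f. A f + B f) \<in> LDO"
proof -
  assume "A \<in> LDO" "B \<in> LDO"
  then obtain p q where p: "admissible_wt wt p" "A = expansion (lift_vert std_mon) p"
    and q: "admissible_wt wt q" "B = expansion (lift_vert std_mon) q" unfolding LDO_std by blast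
  have "(\<lambda>f. A f + B f) = expansion (lift_vert std_mon) (\<lambda>k. p k + q k)"
    by (simp add: p(2) q(2) fun_eq_iff expansion_add[OF monomials_std p(1) q(1)])
  then show ?thesis unfolding LDO_std using admissible_wt_add[OF p(1) q(1)] by blast
qed

text \<open>Meant for total derivatives and scalars: both send a left monomial to a single left
  monomial of equal weight, so the infinite sum is preserved term by term.\<close>

lemma LDO_compose:
  fixes A :: "('n::{finite,linorder}, 'd::finite) multi_op"
  assumes A: "A \<in> LDO" and \<Phi>: "linear \<Phi>"
    and "\<And>k r. \<exists>k' r'. wt k' = wt k \<and> (\<forall>f :: 'n \<Rightarrow> 'd loc. \<Phi> (lift_vert left_mon k r f) = lift_vert left_mon k' r' f)"
  shows "(\<lambda>f. \<Phi> (A f)) \<in> LDO"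
proof -
  obtain p where p: "admissible_wt wt p" "A = expansion (lift_vert left_mon) p"
    using A unfolding LDO_left by blast
  have X: "monomials wt (\<lambda>k r (f :: 'n \<Rightarrow> 'd loc). \<Phi> (lift_vert left_mon k r f))"
    unfolding monomials_def
  proof (intro conjI allI)
    fix f :: "'n \<Rightarrow> 'd loc"
    obtain m where "\<And>k r. m < wt k \<Longrightarrow> lift_vert left_mon k r f = 0"
      using monomials_bound[OF monomials_left, of f] by blast
    then show "\<exists>m. \<forall>k r. m < wt k \<longrightarrow> \<Phi> (lift_vert left_mon k r f) = 0"
      by (intro exI[of _ m]) (simp add: linear_0[OF \<Phi>])
  qed (simp add: monomials_add[OF monomials_left] linear_add[OF \<Phi>])
  have "(\<lambda>f :: 'n \<Rightarrow> 'd loc. \<Phi> (lift_vert left_mon k r f)) \<in> fspan (lift_vert left_mon) (UNIV \<inter> {l. wt k \<le> wt l + 0})"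
    for k r
  proof -
    obtain k' r' where k': "wt k' = wt k" "\<forall>f. \<Phi> (lift_vert left_mon k r f) = lift_vert left_mon k' r' f"
      using assms(3) by blast
    have "lift_vert left_mon k' r' \<in> fspan (lift_vert left_mon) (UNIV \<inter> {l. wt k \<le> wt l + 0})"
      by (rule fspan.gen) (simp add: k'(1))
    then show ?thesis by (simp add: k'(2))
  qed
  from expansion_convert[OF X monomials_left p(1) this]
  obtain q where q: "admissible_wt wt q"
    "expansion (\<lambda>k r f. \<Phi> (lift_vert left_mon k r f)) p = expansion (lift_vert left_mon) q" by blast
  have "(\<lambda>f. \<Phi> (A f)) = expansion (lift_vert left_mon) q"
    unfolding q(2)[symmetric] p(2)
    by (rule ext, rule expansion_hom[OF monomials_left p(1) linear_0[OF \<Phi>] linear_add[OF \<Phi>]])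
  with q(1) show ?thesis unfolding LDO_left by blast
qed

lemma LDO_total_deriv:
  fixes A :: "('a::{finite,linorder}, 'b::finite) multi_op"
  shows "A \<in> LDO \<Longrightarrow> (\<lambda>f. total_deriv i (A f)) \<in> LDO"
proof (rule LDO_compose[OF _ linear_total_deriv])
  fix k :: "('a \<Rightarrow> 'b \<Rightarrow> nat) \<times> ('a \<Rightarrow> (('b \<Rightarrow> nat) \<Rightarrow>\<^sub>0 nat))" and r
  show "\<exists>k' r'. wt k' = wt k \<and> (\<forall>f. total_deriv i (lift_vert left_mon k r f) = lift_vert left_mon k' r' f)"
    by (rule exI[of _ "(raise_at first i (fst k), snd k)"])
      (auto simp: wt_def lift_vert_def total_deriv_left_mon)
qed

lemma LDO_scaleR:
  fixes A :: "('a::{finite,linorder}, 'b::finite) multi_op"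
  shows "A \<in> LDO \<Longrightarrow> (\<lambda>f. c *\<^sub>R A f) \<in> LDO"
proof (rule LDO_compose[of A "\<lambda>x. c *\<^sub>R x"])
  fix k :: "('a \<Rightarrow> 'b \<Rightarrow> nat) \<times> ('a \<Rightarrow> (('b \<Rightarrow> nat) \<Rightarrow>\<^sub>0 nat))" and r
  show "\<exists>k' r'. wt k' = wt k \<and> (\<forall>f. c *\<^sub>R (lift_vert left_mon k r f) = lift_vert left_mon k' r' f)"
    by (rule exI[of _ k], rule exI[of _ "c *\<^sub>R r"])
      (simp add: lift_vert_def left_mon_def linear_scale[OF linear_total_derivs, symmetric])
qed (auto simp: linear_iff scaleR_right_distrib)

lemma LDO_sum: "(\<And>a. a \<in> S \<Longrightarrow> A a \<in> LDO) \<Longrightarrow> (\<lambda>f. \<Sum>a\<in>S. A a f) \<in> LDO"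
  by (induction S rule: infinite_finite_induct) (auto intro: LDO_zero LDO_add)

text \<open>Each commutator replaces one \<open>K\<close> in the exponent by \<open>K\<close>
  lowered at \<open>i\<close>, so the fibre degree drops by at most one; this bound is what
  admissibility needs. A list is used because equal exponents count with multiplicity.\<close>

lemma vert_derivs_total_deriv:
  "\<exists>\<beta>s. (\<forall>\<beta>\<in>set \<beta>s. fdeg \<alpha> \<le> fdeg \<beta> + 1) \<and>
     (\<forall>f. vert_derivs \<alpha> (total_deriv i f)
        = total_deriv i (vert_derivs \<alpha> f) + (\<Sum>\<beta>\<leftarrow>\<beta>s. vert_derivs \<beta> f))"
proof (induction \<alpha> rule: mapping_induct)
  case zero
  show ?case by (rule exI[of _ "[]"]) simp
next
  case (raise \<alpha> K)
  then obtain \<beta>s where \<beta>s: "\<forall>\<beta>\<in>set \<beta>s. fdeg \<alpha> \<le> fdeg \<beta> + 1"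
    "\<And>f. vert_derivs \<alpha> (total_deriv i f)
        = total_deriv i (vert_derivs \<alpha> f) + (\<Sum>\<beta>\<leftarrow>\<beta>s. vert_derivs \<beta> f)" by blast
  have keys: "Poly_Mapping.keys (\<gamma> + Poly_Mapping.single L 1) = insert L (Poly_Mapping.keys \<gamma>)"
    for \<gamma> :: "('a \<Rightarrow> nat) \<Rightarrow>\<^sub>0 nat" and L
    by (auto simp: in_keys_iff lookup_add lookup_single when_def split: if_splits)
  have fdeg: "fdeg (\<gamma> + Poly_Mapping.single L 1) = max (mi_size L) (fdeg \<gamma>)"
    for \<gamma> :: "('a \<Rightarrow> nat) \<Rightarrow>\<^sub>0 nat" and L
    unfolding fdeg_def keys image_insert by (simp add: insert_commute[of 0])
  define L where "L = K(i := K i - 1)"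
  define \<gamma>s where "\<gamma>s = (if K i > 0 then [\<alpha> + Poly_Mapping.single L 1] else [])
    @ map (\<lambda>\<beta>. \<beta> + Poly_Mapping.single K 1) \<beta>s"
  have L: "mi_size K \<le> mi_size L + 1" if "K i > 0"
  proof -
    have "K = mi_raise i L" using that by (simp add: L_def mi_raise_def)
    then show ?thesis by (simp add: mi_size_raise)
  qed
  have "\<forall>\<gamma>\<in>set \<gamma>s. fdeg (\<alpha> + Poly_Mapping.single K 1) \<le> fdeg \<gamma> + 1"
    using \<beta>s(1) L by (auto simp: \<gamma>s_def fdeg[unfolded One_nat_def])
  moreover have "vert_derivs (\<alpha> + Poly_Mapping.single K 1) (total_deriv i f)
      = total_deriv i (vert_derivs (\<alpha> + Poly_Mapping.single K 1) f) + (\<Sum>\<gamma>\<leftarrow>\<gamma>s. vert_derivs \<gamma> f)" for f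
  proof -
    have ps: "partial (Fibre K) (\<Sum>\<beta>\<leftarrow>xs. vert_derivs \<beta> f)
        = (\<Sum>\<beta>\<leftarrow>xs. partial (Fibre K) (vert_derivs \<beta> f))" for xs
      by (induction xs) (simp_all add: partial_zero partial_add)
    show ?thesis
      unfolding vert_derivs_raise \<beta>s(2) partial_add partial_total_deriv ps \<gamma>s_def
      by (simp add: vert_derivs_raise[unfolded One_nat_def] o_def L_def add.assoc)
  qed
  ultimately show ?case by blast
qed

text \<open>The standard form is suited to precomposition, because each slot carries its own total
  derivatives there.\<close>

lemma LDO_precomp_total:
  fixes A :: "('n::{finite,linorder}, 'd::finite) multi_op"
  assumes "A \<in> LDO"
  shows "precomp_total j i A \<in> LDO"
proof -
  obtain p where p: "admissible_wt wt p" "A = expansion (lift_vert std_mon) p"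
    using assms unfolding LDO_std by blast
  define X where "X k r f = lift_vert std_mon k r (deriv_at j i f)" for k r and f :: "'n \<Rightarrow> 'd loc"
  have X: "monomials wt X"
    using monomials_std unfolding monomials_def X_def by blast
  \<comment> \<open>The weight may drop by one, through the commutators with the vertical
    derivatives; this is the slack of \<open>expansion_convert\<close>.\<close>
  have "X k r \<in> fspan (lift_vert std_mon) (UNIV \<inter> {l. wt k \<le> wt l + 1})" for k r
  proof -
    obtain I \<alpha> where k: "k = (I, \<alpha>)" by force
    obtain \<beta>s where \<beta>s: "\<And>\<beta>. \<beta> \<in> set \<beta>s \<Longrightarrow> fdeg (\<alpha> j) \<le> fdeg \<beta> + 1"
      "\<And>f. vert_derivs (\<alpha> j) (total_deriv i f)
        = total_deriv i (vert_derivs (\<alpha> j) f) + (\<Sum>\<beta>\<leftarrow>\<beta>s. vert_derivs \<beta> f)"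
      using vert_derivs_total_deriv by metis
    have lin: "linear (\<lambda>x. std_mon I r (g(j := x)))" for g
    proof -
      have "multilinear (lift_vert std_mon (I, \<lambda>_. 0) r)" by (rule multilinear_std)
      then show ?thesis by (simp add: multilinear_def lift_vert_def vertical_def fun_upd_def)
    qed
    have "X k r f = lift_vert std_mon (raise_at j i I, \<alpha>) r f
        + (\<Sum>\<beta>\<leftarrow>\<beta>s. lift_vert std_mon (I, \<alpha>(j := \<beta>)) r f)" for f
    proof -
      have v: "vertical \<alpha> (deriv_at j i f) = (vertical \<alpha> f)(j := vert_derivs (\<alpha> j) (total_deriv i (f j)))"
        by (auto simp: vertical_def)
      have w: "vertical (\<alpha>(j := \<beta>)) f = (vertical \<alpha> f)(j := vert_derivs \<beta> (f j))" for \<beta>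
        by (auto simp: vertical_def)
      have s: "std_mon I r (g(j := (\<Sum>\<beta>\<leftarrow>xs. h \<beta>))) = (\<Sum>\<beta>\<leftarrow>xs. std_mon I r (g(j := h \<beta>)))"
        for g xs and h :: "(('d \<Rightarrow> nat) \<Rightarrow>\<^sub>0 nat) \<Rightarrow> 'd loc"
        by (induction xs) (simp_all add: linear_add[OF lin] linear_0[OF lin] del: fun_upd_apply)
      have "std_mon (raise_at j i I) r (vertical \<alpha> f)
          = std_mon I r ((vertical \<alpha> f)(j := total_deriv i (vert_derivs (\<alpha> j) (f j))))"
        unfolding std_mon_raise by (simp add: vertical_def)
      then show ?thesis
        unfolding X_def k lift_vert_def fst_conv snd_conv v w \<beta>s(2) linear_add[OF lin] s by simp
    qed
    then have "X k r = (\<lambda>f. lift_vert std_mon (raise_at j i I, \<alpha>) r f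
        + (\<Sum>\<beta>\<leftarrow>\<beta>s. lift_vert std_mon (I, \<alpha>(j := \<beta>)) r f))" by (rule ext)
    moreover have "(\<lambda>f. lift_vert std_mon (raise_at j i I, \<alpha>) r f
        + (\<Sum>\<beta>\<leftarrow>\<beta>s. lift_vert std_mon (I, \<alpha>(j := \<beta>)) r f))
      \<in> fspan (lift_vert std_mon) (UNIV \<inter> {l. wt k \<le> wt l + 1})"
    proof (rule fspan.add)
      show "lift_vert std_mon (raise_at j i I, \<alpha>) r \<in> fspan (lift_vert std_mon) (UNIV \<inter> {l. wt k \<le> wt l + 1})"
        by (rule fspan.gen) (simp add: k wt_def)
      have "wt k \<le> wt (I, \<alpha>(j := \<beta>)) + 1" if "fdeg (\<alpha> j) \<le> fdeg \<beta> + 1" for \<beta>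
      proof -
        have "(\<Sum>l\<in>UNIV - {j}. fdeg ((\<alpha>(j := \<beta>)) l)) = (\<Sum>l\<in>UNIV - {j}. fdeg (\<alpha> l))"
          by (rule sum.cong) auto
        then show ?thesis using that
          by (simp add: k wt_def sum.remove[of UNIV j] del: fun_upd_apply) simp
      qed
      then have gen: "lift_vert std_mon (I, \<alpha>(j := \<beta>)) r
          \<in> fspan (lift_vert std_mon) (UNIV \<inter> {l. wt k \<le> wt l + 1})" if "\<beta> \<in> set \<beta>s" for \<beta>
        using \<beta>s(1)[OF that] by (intro fspan.gen) blast
      have "(\<lambda>f. \<Sum>\<beta>\<leftarrow>xs. lift_vert std_mon (I, \<alpha>(j := \<beta>)) r f)
          \<in> fspan (lift_vert std_mon) (UNIV \<inter> {l. wt k \<le> wt l + 1})" if "set xs \<subseteq> set \<beta>s" for xs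
        using that
      proof (induction xs)
        case (Cons \<beta> xs)
        then have "\<beta> \<in> set \<beta>s" "set xs \<subseteq> set \<beta>s" by auto
        from fspan.add[OF gen[OF this(1)] Cons.IH[OF this(2)]] show ?case by (simp only: list.map sum_list.Cons)
      qed (simp add: fspan.zero)
      then show "(\<lambda>f. \<Sum>\<beta>\<leftarrow>\<beta>s. lift_vert std_mon (I, \<alpha>(j := \<beta>)) r f)
          \<in> fspan (lift_vert std_mon) (UNIV \<inter> {l. wt k \<le> wt l + 1})" by blast
    qed
    ultimately show ?thesis by (simp only:)
  qed
  from expansion_convert[OF X monomials_std p(1) this]
  obtain q where "admissible_wt wt q" "expansion X p = expansion (lift_vert std_mon) q" by blast
  moreover have "precomp_total j i A = expansion X p"
    by (simp add: precomp_total_def p(2) expansion_def X_def fun_eq_iff)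
  ultimately show ?thesis unfolding LDO_std by metis
qed


section \<open>Uniqueness of the left form\<close>

text \<open>Functions of the base coordinates are constants for the vertical derivatives, so with
  them the exponents of the total derivatives can be tested separately.\<close>

definition base_fun :: "'d::finite loc \<Rightarrow> bool" where
  "base_fun a \<longleftrightarrow> (\<forall>J. partial (Fibre J) a = 0)"

lemma base_fun_one: "base_fun 1"
  unfolding base_fun_def
  by (intro allI partial_eqI) (simp add: one_loc.rep_eq zero_loc.rep_eq)

lemma base_fun_mult_coord: "base_fun a \<Longrightarrow> base_fun (jet_coord (Base i) * a)"
  by (simp add: base_fun_def partial_mult partial_jet_coord)

lemma base_fun_scaleR: "base_fun a \<Longrightarrow> base_fun (c *\<^sub>R a)"
  by (simp add: base_fun_def partial_scaleR)

lemma total_deriv_base_coord: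
  "total_deriv i (jet_coord (Base k)) = (if i = k then 1 else 0)"
  by (subst total_deriv_sum[of "{}"]) (auto simp: partial_jet_coord)

text \<open>The commutator with multiplication by x^i differentiates the symbol of the operator. For
  \<open>I i = 0\<close> the factor zero hides the truncated subtraction.\<close>

lemma total_derivs_base_coord:
  "total_derivs I (jet_coord (Base i) * G)
     = jet_coord (Base i) * total_derivs I G + real (I i) *\<^sub>R total_derivs (I(i := I i - 1)) G"
proof (induction I rule: multi_index_induct)
  case (raise I k)
  show ?case
  proof (cases "k = i")
    case True
    have "real (I i) *\<^sub>R total_deriv i (total_derivs (I(i := I i - 1)) G) = real (I i) *\<^sub>R total_derivs I G"
    proof (cases "I i = 0")
      case False
      then have "mi_raise i (I(i := I i - 1)) = I" by (simp add: mi_raise_def)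
      then show ?thesis using total_derivs_raise[of i "I(i := I i - 1)" G] by simp
    qed simp
    moreover have "(mi_raise i I)(i := mi_raise i I i - 1) = I" "mi_raise i I i = Suc (I i)"
      by (auto simp: mi_raise_def)
    ultimately show ?thesis
      by (simp add: True total_derivs_raise raise total_deriv_add total_deriv_mult
          total_deriv_base_coord linear_scale[OF linear_total_deriv] scaleR_left_distrib
          del: fun_upd_apply)
  next
    case False
    then have "(mi_raise k I)(i := mi_raise k I i - 1) = mi_raise k (I(i := I i - 1))" "mi_raise k I i = I i"
      by (auto simp: mi_raise_def)
    with False show ?thesis
      by (simp add: total_derivs_raise raise total_deriv_add total_deriv_mult
          total_deriv_base_coord linear_scale[OF linear_total_deriv] del: fun_upd_apply)
  qed
qed simp

definition lower_at :: "'n \<Rightarrow> 'd \<Rightarrow> ('n \<Rightarrow> 'd \<Rightarrow> nat) \<Rightarrow> 'n \<Rightarrow> 'd \<Rightarrow> nat" where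
  "lower_at j i J = J(j := (J j)(i := J j i - 1))"

lemma lower_raise: "lower_at j i (raise_at j i J) = J"
  and raise_lower: "J j i \<noteq> 0 \<Longrightarrow> raise_at j i (lower_at j i J) = J"
  by (auto simp: lower_at_def raise_at_def mi_raise_def)

text \<open>\<open>product_tail\<close> does not differentiate its first argument, so multiplying
  that argument by x^i multiplies the whole product, and only the outer derivatives contribute to
  the commutator.\<close>

lemma left_mon_coord_first:
  "left_mon J r (g(first := jet_coord (Base i) * g first)) - jet_coord (Base i) * left_mon J r g
     = real (J first i) *\<^sub>R left_mon (lower_at first i J) r g"
proof -
  have "(\<Prod>j\<in>-{first}. total_derivs (J j) ((g(first := jet_coord (Base i) * g first)) j))
      = (\<Prod>j\<in>-{first}. total_derivs (J j) (g j))"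
    by (rule prod.cong) auto
  then have "product_tail J (g(first := jet_coord (Base i) * g first)) = jet_coord (Base i) * product_tail J g"
    by (simp add: product_tail_def mult_ac del: fun_upd_apply) (simp add: mult_ac)
  then have "left_mon J r (g(first := jet_coord (Base i) * g first))
      = total_derivs (J first) (jet_coord (Base i) * (r * product_tail J g))"
    by (simp add: left_mon_def mult_ac)
  then show ?thesis
    by (simp add: total_derivs_base_coord left_mon_def lower_at_def)
qed

text \<open>Comparing slot \<open>j\<close> with the first slot, rather than with multiplication of
  the result, cancels the outer derivatives and isolates the exponent \<open>J j\<close>.\<close>

lemma left_mon_coord_other:
  assumes "j \<noteq> first"
  shows "left_mon J r (g(j := jet_coord (Base i) * g j))
       - left_mon J r (g(first := jet_coord (Base i) * g first))
     = real (J j i) *\<^sub>R left_mon (lower_at j i J) r g"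
proof -
  let ?x = "jet_coord (Base i)"
  define P where "P = (\<Prod>l\<in>-{first}-{j}. total_derivs (J l) (g l))"
  have tail: "product_tail K h = h first * (total_derivs (K j) (h j) * P)"
    if "\<And>l. l \<noteq> first \<Longrightarrow> l \<noteq> j \<Longrightarrow> K l = J l \<and> h l = g l" for K and h :: "'a \<Rightarrow> 'b loc"
  proof -
    have "(\<Prod>l\<in>-{first}-{j}. total_derivs (K l) (h l)) = P"
      unfolding P_def by (rule prod.cong) (use that in auto)
    then show ?thesis using assms by (simp add: product_tail_def prod.remove[of "-{first}" j])
  qed
  have "product_tail J (g(j := ?x * g j)) = g first * (total_derivs (J j) (?x * g j) * P)"
    using assms tail[of J "g(j := ?x * g j)"] by simp
  moreover have "product_tail J (g(first := ?x * g first)) = ?x * g first * (total_derivs (J j) (g j) * P)"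
    using assms tail[of J "g(first := ?x * g first)"] by simp
  moreover have "product_tail (lower_at j i J) g
      = g first * (total_derivs ((J j)(i := J j i - 1)) (g j) * P)"
    using assms tail[of "lower_at j i J" g] by (simp add: lower_at_def)
  ultimately have "product_tail J (g(j := ?x * g j)) = product_tail J (g(first := ?x * g first))
      + real (J j i) *\<^sub>R product_tail (lower_at j i J) g"
    by (simp only: total_derivs_base_coord) (simp add: algebra_simps)
  moreover have "lower_at j i J first = J first" using assms by (simp add: lower_at_def)
  ultimately show ?thesis
    by (simp add: left_mon_def distrib_left total_derivs_add linear_scale[OF linear_total_derivs])
qed

definition total_size :: "('n::finite \<Rightarrow> 'd::finite \<Rightarrow> nat) \<Rightarrow> nat" where
  "total_size J = (\<Sum>j\<in>UNIV. mi_size (J j))"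

lemma total_size_raise: "total_size (raise_at j i J) = Suc (total_size J)"
proof -
  have "total_size (raise_at j i J) = (\<Sum>l\<in>UNIV. mi_size (J l) + (if l = j then 1 else 0))"
    unfolding total_size_def by (rule sum.cong) (auto simp: raise_at_def mi_size_raise)
  then show ?thesis by (simp add: sum.distrib total_size_def)
qed

text \<open>
  Commutators with multiplication by base coordinates act on the coefficients as partial
  derivatives of polynomials, which lowers the order until only the constant term is left.
\<close>

lemma left_mon_unique:
  fixes q :: "('n::{finite,linorder} \<Rightarrow> 'd::finite \<Rightarrow> nat) \<Rightarrow> 'd loc"
  assumes "finite {J. q J \<noteq> 0}"
    and "\<And>g. (\<And>j. base_fun (g j)) \<Longrightarrow> (\<Sum>J | q J \<noteq> 0. left_mon J (q J) g) = 0"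
  shows "q J = 0"
proof -
  have lz: "left_mon J 0 g = 0" for J and g :: "'n \<Rightarrow> 'd loc"
    by (simp add: left_mon_def)
  \<comment> \<open>Once only the zero index is left, the arguments equal to 1 read off its
    coefficient.\<close>
  have const: "q = (\<lambda>_. 0)"
    if "\<And>J. q J \<noteq> 0 \<Longrightarrow> J = (\<lambda>_ _. 0)"
      "\<And>g. (\<And>j. base_fun (g j)) \<Longrightarrow> (\<Sum>J | q J \<noteq> 0. left_mon J (q J) g) = 0"
    for q :: "('n \<Rightarrow> 'd \<Rightarrow> nat) \<Rightarrow> 'd loc"
  proof -
    have "(\<Sum>J | q J \<noteq> 0. left_mon J (q J) (\<lambda>_. 1)) = (\<Sum>J\<in>{\<lambda>_ _. 0}. left_mon J (q J) (\<lambda>_. 1))"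
      by (rule sum.mono_neutral_left) (use that(1) in \<open>auto simp: lz\<close>)
    then have "q (\<lambda>_ _. 0) = 0"
      using that(2)[of "\<lambda>_. 1"] by (simp add: base_fun_one left_mon_def product_tail_def)
    with that(1) show ?thesis by blast
  qed
  have "q = (\<lambda>_. 0)"
    if "finite {J. q J \<noteq> 0}" "\<And>J. q J \<noteq> 0 \<Longrightarrow> total_size J \<le> d"
      "\<And>g. (\<And>j. base_fun (g j)) \<Longrightarrow> (\<Sum>J | q J \<noteq> 0. left_mon J (q J) g) = 0"
    for d and q :: "('n \<Rightarrow> 'd \<Rightarrow> nat) \<Rightarrow> 'd loc"
    using that
  proof (induction d arbitrary: q)
    case 0
    show ?case
    proof (rule const)
      fix J assume "q J \<noteq> 0"
      then have "J j i = 0" for j i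
        using 0(2)[of J] total_size_raise[of j i "lower_at j i J"] raise_lower[of J j i]
        by (cases "J j i = 0") auto
      then show "J = (\<lambda>_ _. 0)" by auto
    qed (rule 0(3))
  next
    case (Suc d)
    have "q (raise_at j i J) = 0" for j i J
    proof -
      \<comment> \<open>The coefficients of the formal derivative of the symbol in the variable
        belonging to \<open>(j, i)\<close>; the integer factors are invertible over the
        reals.\<close>
      define q' where "q' J = real (Suc (J j i)) *\<^sub>R q (raise_at j i J)" for J
      have nz: "q' J \<noteq> 0 \<longleftrightarrow> q (raise_at j i J) \<noteq> 0" for J
        by (simp add: q'_def del: of_nat_Suc)
      have inj: "inj_on (raise_at j i) A" for A :: "('n \<Rightarrow> 'd \<Rightarrow> nat) set"
        by (rule inj_on_inverseI[of _ "lower_at j i"]) (simp add: lower_raise)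
      have "q' = (\<lambda>_. 0)"
      proof (rule Suc.IH)
        show "finite {J. q' J \<noteq> 0}"
          using finite_vimageI[OF Suc.prems(1) inj[of UNIV]] by (simp add: nz vimage_def)
        show "total_size J \<le> d" if "q' J \<noteq> 0" for J
          using that Suc.prems(2)[of "raise_at j i J"] by (simp add: nz total_size_raise)
        fix g :: "'n \<Rightarrow> 'd loc" assume g: "\<And>j. base_fun (g j)"
        let ?x = "jet_coord (Base i)"
        have vanish: "(\<Sum>J | q J \<noteq> 0. left_mon J (q J) (g(l := ?x * g l))) = 0" for l
          by (rule Suc.prems(3)) (simp add: g base_fun_mult_coord)
        have vanish': "(\<Sum>J | q J \<noteq> 0. ?x * left_mon J (q J) g) = 0"
          using Suc.prems(3)[OF g] by (simp flip: sum_distrib_left)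
        have "(\<Sum>J | q J \<noteq> 0. real (J j i) *\<^sub>R left_mon (lower_at j i J) (q J) g) = 0"
        proof (cases "j = first")
          case True
          then show ?thesis using vanish[of first] vanish'
            by (simp add: sum_subtractf flip: left_mon_coord_first)
        next
          case False
          then show ?thesis using vanish[of first] vanish[of j]
            by (simp add: sum_subtractf flip: left_mon_coord_other)
        qed
        also have "(\<Sum>J | q J \<noteq> 0. real (J j i) *\<^sub>R left_mon (lower_at j i J) (q J) g)
            = (\<Sum>J \<in> {J. q J \<noteq> 0 \<and> J j i \<noteq> 0}. real (J j i) *\<^sub>R left_mon (lower_at j i J) (q J) g)"
          by (rule sum.mono_neutral_right) (use Suc.prems(1) in auto)
        also have "\<dots> = (\<Sum>J | q' J \<noteq> 0. left_mon J (q' J) g)"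
        proof (rule sum.reindex_bij_witness[of _ "raise_at j i" "lower_at j i"])
          fix J assume "J \<in> {J. q J \<noteq> 0 \<and> J j i \<noteq> 0}"
          then have J: "q J \<noteq> 0" "J j i \<noteq> 0" "raise_at j i (lower_at j i J) = J"
            by (auto simp: raise_lower)
          have "Suc (lower_at j i J j i) = J j i" using J(2) by (simp add: lower_at_def)
          then show "left_mon (lower_at j i J) (q' (lower_at j i J)) g
              = real (J j i) *\<^sub>R left_mon (lower_at j i J) (q J) g"
            unfolding q'_def J(3)
            by (simp add: left_mon_def linear_scale[OF linear_total_derivs] del: of_nat_Suc)
        qed (auto simp: nz lower_raise raise_lower mi_raise_def)
        finally show "(\<Sum>J | q' J \<noteq> 0. left_mon J (q' J) g) = 0" .
      qed
      then show ?thesis using nz by metis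
    qed
    then have "q J = 0" if "J j i \<noteq> 0" for J j i
      using raise_lower[of J j i] that by metis
    then show ?case
      by (intro const[OF _ Suc.prems(3)]) (auto simp: fun_eq_iff)
  qed
  moreover have "total_size J \<le> Max (total_size ` {J. q J \<noteq> 0})" if "q J \<noteq> 0" for J
    using that assms(1) by (intro Max_ge) auto
  ultimately have "q = (\<lambda>_. 0)" using assms by blast
  then show ?thesis by simp
qed

section \<open>Separating the vertical exponents by test functions\<close>

definition vsize :: "('a \<Rightarrow>\<^sub>0 nat) \<Rightarrow> nat" where
  "vsize \<alpha> = Sum_any (Poly_Mapping.lookup \<alpha>)"

lemma vsize_raise: "vsize (\<alpha> + Poly_Mapping.single K 1) = Suc (vsize \<alpha>)"
proof -
  have "vsize (\<alpha> + Poly_Mapping.single K 1)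
      = vsize \<alpha> + Sum_any (Poly_Mapping.lookup (Poly_Mapping.single K (1 :: nat)))"
    unfolding vsize_def lookup_add by (rule Sum_any.distrib) simp_all
  also have "Sum_any (Poly_Mapping.lookup (Poly_Mapping.single K (1 :: nat))) = 1"
    by (simp add: lookup_single[abs_def] when_def)
  finally show ?thesis by simp
qed

lemma mapping_lower:
  fixes \<beta> :: "'a \<Rightarrow>\<^sub>0 nat"
  assumes "Poly_Mapping.lookup \<beta> K \<noteq> 0"
  shows "(\<beta> - Poly_Mapping.single K 1) + Poly_Mapping.single K 1 = \<beta>"
  using assms by (intro poly_mapping_eqI) (auto simp: lookup_add lookup_minus lookup_single when_def)

lemma vert_derivs_fibre_coord:
  "vert_derivs \<beta> (jet_coord (Fibre K) * f) = jet_coord (Fibre K) * vert_derivs \<beta> f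
     + real (Poly_Mapping.lookup \<beta> K) *\<^sub>R vert_derivs (\<beta> - Poly_Mapping.single K 1) f"
proof (induction \<beta> rule: mapping_induct)
  case (raise \<beta> L)
  show ?case
  proof (cases "L = K")
    case True
    have "real (Poly_Mapping.lookup \<beta> K) *\<^sub>R partial (Fibre K) (vert_derivs (\<beta> - Poly_Mapping.single K 1) f)
        = real (Poly_Mapping.lookup \<beta> K) *\<^sub>R vert_derivs \<beta> f"
      using mapping_lower[of \<beta> K]
      by (cases "Poly_Mapping.lookup \<beta> K = 0") (simp_all flip: vert_derivs_raise)
    then show ?thesis
      by (simp only: True vert_derivs_raise raise lookup_raise fun_upd_same)
        (simp add: partial_add partial_mult partial_jet_coord partial_scaleR scaleR_left_distrib)
  next
    case False
    have "\<beta> + Poly_Mapping.single L 1 - Poly_Mapping.single K 1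
        = \<beta> - Poly_Mapping.single K 1 + Poly_Mapping.single L 1"
      using False by (intro poly_mapping_eqI) (auto simp: lookup_add lookup_minus lookup_single when_def)
    with False show ?thesis
      by (simp only: vert_derivs_raise raise lookup_raise)
        (simp add: partial_add partial_mult partial_jet_coord partial_scaleR)
  qed
qed simp

text \<open>The witness is the monomial in the fibre coordinates with exponents \<open>\<alpha>\<close>.\<close>

lemma vert_derivs_test_function:
  fixes \<alpha> :: "('d::finite \<Rightarrow> nat) \<Rightarrow>\<^sub>0 nat"
  shows "\<exists>h c. c \<noteq> 0 \<and> (\<forall>a. base_fun a \<longrightarrow> vert_derivs \<alpha> (a * h) = c *\<^sub>R a \<and>
    (\<forall>\<beta>. vsize \<alpha> \<le> vsize \<beta> \<longrightarrow> \<beta> \<noteq> \<alpha> \<longrightarrow> vert_derivs \<beta> (a * h) = 0))"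
proof (induction \<alpha> rule: mapping_induct)
  case zero
  have "vert_derivs \<beta> a = 0" if a: "base_fun a" and \<beta>: "\<beta> \<noteq> 0" for a :: "'d loc" and \<beta>
  proof -
    obtain K where "K \<in> Poly_Mapping.keys \<beta>" using \<beta> by (metis ex_in_conv keys_eq_empty)
    then show ?thesis by (rule vert_derivs_eq_zero) (use a in \<open>simp add: base_fun_def\<close>)
  qed
  then show ?case by (intro exI[of _ 1]) auto
next
  case (raise \<alpha> K)
  then obtain h c where c: "c \<noteq> 0"
    and h: "\<And>a. base_fun a \<Longrightarrow> vert_derivs \<alpha> (a * h) = c *\<^sub>R a"
    and h0: "\<And>a \<beta>. base_fun a \<Longrightarrow> vsize \<alpha> \<le> vsize \<beta> \<Longrightarrow> \<beta> \<noteq> \<alpha> \<Longrightarrow> vert_derivs \<beta> (a * h) = 0"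
    by blast
  let ?K = "Poly_Mapping.single K (1 :: nat)"
  have eq: "a * (jet_coord (Fibre K) * h) = jet_coord (Fibre K) * (a * h)" for a
    by (simp add: mult_ac)
  show ?case
  proof (intro exI conjI allI impI)
    \<comment> \<open>The constants accumulate to the product of the factorials of the
      exponents.\<close>
    show "c * real (Suc (Poly_Mapping.lookup \<alpha> K)) \<noteq> 0" using c by (simp del: of_nat_Suc)
    fix a :: "'d loc" assume a: "base_fun a"
    have ne: "\<alpha> + ?K \<noteq> \<alpha>" using vsize_raise[of \<alpha> K] by (metis n_not_Suc_n)
    have "vert_derivs (\<alpha> + ?K) (a * h) = 0"
      by (rule h0[OF a _ ne]) (simp add: vsize_raise[unfolded One_nat_def])
    then show "vert_derivs (\<alpha> + ?K) (a * (jet_coord (Fibre K) * h))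
        = (c * real (Suc (Poly_Mapping.lookup \<alpha> K))) *\<^sub>R a"
      unfolding eq vert_derivs_fibre_coord using h[OF a] by (simp add: lookup_add)
    fix \<beta> :: "('d \<Rightarrow> nat) \<Rightarrow>\<^sub>0 nat" assume \<beta>: "vsize (\<alpha> + ?K) \<le> vsize \<beta>" "\<beta> \<noteq> \<alpha> + ?K"
    have "vsize \<alpha> < vsize \<beta>" using \<beta>(1) by (simp add: vsize_raise[unfolded One_nat_def])
    then have "vert_derivs \<beta> (a * h) = 0" by (intro h0[OF a]) auto
    moreover have "real (Poly_Mapping.lookup \<beta> K) *\<^sub>R vert_derivs (\<beta> - ?K) (a * h) = 0"
    proof (cases "Poly_Mapping.lookup \<beta> K = 0")
      case False
      then have e: "(\<beta> - ?K) + ?K = \<beta>" by (rule mapping_lower)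
      with \<beta>(2) have "\<beta> - ?K \<noteq> \<alpha>" by auto
      moreover have "vsize \<alpha> \<le> vsize (\<beta> - ?K)"
        using \<open>vsize \<alpha> < vsize \<beta>\<close> vsize_raise[of "\<beta> - ?K" K] e by simp
      ultimately show ?thesis by (simp add: h0[OF a])
    qed simp
    ultimately show "vert_derivs \<beta> (a * (jet_coord (Fibre K) * h)) = 0"
      unfolding eq vert_derivs_fibre_coord by simp
  qed
qed

text \<open>Induction on the total number of vertical derivatives. With arguments built from the
  test functions for \<open>\<alpha>\<close>, no \<open>\<beta>\<close> other than
  \<open>\<alpha>\<close> survives unless it has fewer derivatives in total, and those coefficients
  vanish by induction. What remains is a finite sum in total derivatives, handled by
  \<open>left_mon_unique\<close>.\<close>

lemma left_form_unique:
  fixes q :: "('n::{finite,linorder} \<Rightarrow> 'd::finite \<Rightarrow> nat) \<times> ('n \<Rightarrow> (('d \<Rightarrow> nat) \<Rightarrow>\<^sub>0 nat)) \<Rightarrow> 'd loc"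
  assumes q: "admissible_wt wt q" and zero: "expansion (lift_vert left_mon) q = (\<lambda>_. 0)"
  shows "q = (\<lambda>_. 0)"
proof -
  have "q (I, \<alpha>) = 0" for I \<alpha>
  proof (induction "\<Sum>j\<in>UNIV. vsize (\<alpha> j)" arbitrary: I \<alpha> rule: less_induct)
    case less
    obtain h c where c: "\<And>j. c j \<noteq> 0"
      and h: "\<And>j a. base_fun a \<Longrightarrow> vert_derivs (\<alpha> j) (a * h j) = c j *\<^sub>R a"
      and h0: "\<And>j a \<beta>. base_fun a \<Longrightarrow> vsize (\<alpha> j) \<le> vsize \<beta> \<Longrightarrow> \<beta> \<noteq> \<alpha> j
        \<Longrightarrow> vert_derivs \<beta> (a * h j) = 0"
      using vert_derivs_test_function[of "\<alpha> _"] by metis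
    \<comment> \<open>For fixed \<open>\<alpha>\<close> the weight is constant, so finitely many
      \<open>I\<close> occur. The weight ignores the first component, which is why
      \<open>undefined\<close> may stand there.\<close>
    have fin: "finite {I. q (I, \<alpha>) \<noteq> 0}"
    proof -
      have "{I. q (I, \<alpha>) \<noteq> 0} \<subseteq> fst ` {k. q k \<noteq> 0 \<and> wt k \<le> wt (undefined, \<alpha>)}"
        by (force simp: wt_def)
      then show ?thesis by (rule finite_subset) (use q in \<open>simp add: admissible_wt_def\<close>)
    qed
    show ?case
    proof (rule left_mon_unique[where q = "\<lambda>I. q (I, \<alpha>)", OF fin])
      fix g :: "'n \<Rightarrow> 'd loc" assume g: "\<And>j. base_fun (g j)"
      \<comment> \<open>Dividing by \<open>c j\<close> makes the vertical derivatives with exponents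
        \<open>\<alpha>\<close> return \<open>g\<close> exactly.\<close>
      define f where "f j = ((1 / c j) *\<^sub>R g j) * h j" for j
      have b: "base_fun ((1 / c j) *\<^sub>R g j)" for j using g by (intro base_fun_scaleR)
      have v: "vertical \<alpha> f = g"
        using c by (simp add: vertical_def f_def h[OF b] fun_eq_iff del: mult_scaleR_left)
      have "(I, \<beta>) \<in> {I. q (I, \<alpha>) \<noteq> 0} \<times> {\<alpha>}" if nz: "lift_vert left_mon (I, \<beta>) (q (I, \<beta>)) f \<noteq> 0" for I \<beta>
      proof -
        have q0: "q (I, \<beta>) \<noteq> 0" using nz monomials_zero[OF monomials_left] by metis
        have "vert_derivs (\<beta> j) (f j) \<noteq> 0" for j
        proof
          assume "vert_derivs (\<beta> j) (f j) = 0"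
          then have "lift_vert left_mon (I, \<beta>) (q (I, \<beta>)) f = 0"
            unfolding lift_vert_def by (intro left_mon_zero[of _ j]) (simp add: vertical_def)
          with nz show False by simp
        qed
        then have small: "vsize (\<beta> j) < vsize (\<alpha> j) \<or> \<beta> j = \<alpha> j" for j
          using h0[OF b[of j], of j "\<beta> j"] by (force simp: f_def not_less[symmetric])
        \<comment> \<open>A different surviving \<open>\<beta>\<close> is strictly smaller in one
          slot and not larger in any, so the induction hypothesis removes it.\<close>
        have "\<beta> = \<alpha>"
        proof (rule ccontr)
          assume "\<beta> \<noteq> \<alpha>"
          then obtain j where "\<beta> j \<noteq> \<alpha> j" by auto
          then have "vsize (\<beta> j) < vsize (\<alpha> j)" using small by blast
          moreover have "vsize (\<beta> l) \<le> vsize (\<alpha> l)" for l using small[of l] by auto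
          ultimately have "(\<Sum>j\<in>UNIV. vsize (\<beta> j)) < (\<Sum>j\<in>UNIV. vsize (\<alpha> j))"
            by (intro sum_strict_mono_ex1) auto
          from less(1)[OF this, of I] q0 show False by simp
        qed
        with q0 show ?thesis by simp
      qed
      then have "expansion (lift_vert left_mon) q f
          = (\<Sum>k\<in>{I. q (I, \<alpha>) \<noteq> 0} \<times> {\<alpha>}. lift_vert left_mon k (q k) f)"
        unfolding expansion_def by (intro Sum_any.expand_superset) (use fin in auto)
      also have "\<dots> = (\<Sum>I | q (I, \<alpha>) \<noteq> 0. lift_vert left_mon (I, \<alpha>) (q (I, \<alpha>)) f)"
        by (rule sum.reindex_bij_witness[of _ "\<lambda>I. (I, \<alpha>)" fst]) auto
      finally show "(\<Sum>I | q (I, \<alpha>) \<noteq> 0. left_mon I (q (I, \<alpha>)) g) = 0"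
        by (simp add: zero lift_vert_def v)
    qed
  qed
  then show ?thesis by auto
qed


section \<open>The Koszul complex of the total derivatives\<close>

text \<open>Only elements below \<open>i\<close> are counted, so the value is the same with or
  without \<open>i\<close> in the set and serves wedging as well as contraction.\<close>

definition wedge_sign :: "'d::linorder \<Rightarrow> 'd set \<Rightarrow> real" where
  "wedge_sign i S = (-1) ^ card {s \<in> S. s < i}"

text \<open>Multiplication by the variable y_i, for polynomials given by their coefficient
  functions.\<close>

definition shift :: "'d \<Rightarrow> (('d \<Rightarrow> nat) \<Rightarrow> 'v::zero) \<Rightarrow> ('d \<Rightarrow> nat) \<Rightarrow> 'v" where
  "shift i f K = (if K i = 0 then 0 else f (K(i := K i - 1)))"

lemma wedge_sign_square [simp]: "wedge_sign i S * wedge_sign i S = 1"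
  by (simp add: wedge_sign_def flip: power_add)

lemma wedge_sign_self [simp]:
  "wedge_sign i (S - {i}) = wedge_sign i S" "wedge_sign i (insert i S) = wedge_sign i S"
  unfolding wedge_sign_def by (auto intro!: arg_cong[of _ _ "\<lambda>S. (-1) ^ card S"])

lemma wedge_sign_insert:
  fixes S :: "'d::{finite,linorder} set"
  shows "j \<notin> S \<Longrightarrow> wedge_sign i (insert j S) = (if j < i then - wedge_sign i S else wedge_sign i S)"
proof -
  assume "j \<notin> S"
  have "{s \<in> insert j S. s < i} = (if j < i then insert j {s \<in> S. s < i} else {s \<in> S. s < i})" by auto
  with \<open>j \<notin> S\<close> show ?thesis by (simp add: wedge_sign_def)
qed

text \<open>Wedging with dx^i anticommutes with contraction in a different direction; this sign lets
  the mixed terms of the homotopy combine with the closedness relation.\<close>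

lemma wedge_sign_swap:
  fixes S :: "'d::{finite,linorder} set"
  assumes "i \<in> S" "j \<notin> S"
  shows "wedge_sign i S * wedge_sign j (S - {i}) = - (wedge_sign j S * wedge_sign i (insert j S))"
proof -
  have ij: "i \<noteq> j" using assms by auto
  have ins: "insert i (S - {i}) = S" using assms(1) by auto
  have 1: "wedge_sign j S = (if i < j then - wedge_sign j (S - {i}) else wedge_sign j (S - {i}))"
    using wedge_sign_insert[of i "S - {i}" j] unfolding ins by simp
  have 2: "wedge_sign i (insert j S) = (if j < i then - wedge_sign i S else wedge_sign i S)"
    by (rule wedge_sign_insert[OF assms(2)])
  show ?thesis
  proof (cases "i < j")
    case True
    then have "\<not> j < i" by simp
    with True show ?thesis by (simp only: 1 2 if_True if_False) simp
  next
    case False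
    with ij have "j < i" by simp
    with False show ?thesis by (simp only: 1 2 if_True if_False) simp
  qed
qed

text \<open>
  With \<open>d = \<Sum> dx\<^sup>i \<and> y\<^sub>i\<close> and \<open>h = \<Sum> \<iota>\<^sub>i \<partial>/\<partial>y\<^sub>i\<close> on polynomials in \<open>y\<close>, the operator \<open>dh + hd\<close>
  multiplies a form of degree \<open>p\<close> whose coefficients are homogeneous of degree \<open>m\<close> by \<open>m + N - p\<close>.
\<close>

lemma koszul_homotopy:
  fixes r :: "'d::{finite,linorder} set \<Rightarrow> ('d \<Rightarrow> nat) \<Rightarrow> 'v::real_vector"
  assumes closed: "\<And>S K. (\<Sum>i\<in>S. wedge_sign i S *\<^sub>R shift i (r (S - {i})) K) = 0"
    and b: "\<And>S K. b S K = (\<Sum>i\<in>-S. (wedge_sign i S * real (K i + 1) / (real (mi_size K) + 1 + c))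
       *\<^sub>R r (insert i S) (mi_raise i K))"
    and c: "c = real CARD('d) - real (card S)" and nz: "real (mi_size K) + c \<noteq> 0 \<or> r S K = 0"
  shows "(\<Sum>i\<in>S. wedge_sign i S *\<^sub>R shift i (b (S - {i})) K) = r S K"
proof -
  define den where "den = real (mi_size K) + c"
  \<comment> \<open>The mixed term: remove \<open>i\<close>, insert \<open>j\<close>, multiply by
    y_i and differentiate by y_j, without the integer factor of the derivative. The value at
    \<open>K i = 0\<close> is the default of \<open>shift\<close>.\<close>
  define X where "X i j = (if K i = 0 then 0 else r (insert j (S - {i})) (mi_raise j (K(i := K i - 1))))" for i j
  \<comment> \<open>Contracting in the direction \<open>i\<close> that was removed restores
    \<open>S\<close> and gives the diagonal term; the other directions give the sum.\<close>
  have 1: "wedge_sign i S *\<^sub>R shift i (b (S - {i})) K = (real (K i) / den) *\<^sub>R r S K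
      + (\<Sum>j\<in>-S. (real (K j + 1) / den) *\<^sub>R ((wedge_sign i S * wedge_sign j (S - {i})) *\<^sub>R X i j))"
    if i: "i \<in> S" for i
  proof (cases "K i = 0")
    case True
    then show ?thesis by (simp add: shift_def X_def)
  next
    case False
    define K' where "K' = K(i := K i - 1)"
    have K': "mi_raise i K' = K" using False by (simp add: K'_def mi_raise_def)
    \<comment> \<open>The \<open>+ 1\<close> in the denominators of \<open>b\<close> makes up for
      the unit that \<open>K'\<close> lacks, so every term has the same denominator.\<close>
    then have sz: "real (mi_size K') + 1 + c = den"
      using mi_size_raise[of i K'] by (simp add: den_def)
    have set: "- (S - {i}) = insert i (- S)" "insert i S = S" using i by auto
    have "b (S - {i}) K' = (wedge_sign i S * real (K' i + 1) / den) *\<^sub>R r S K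
        + (\<Sum>j\<in>-S. (wedge_sign j (S - {i}) * real (K' j + 1) / den) *\<^sub>R r (insert j (S - {i})) (mi_raise j K'))"
      unfolding b sz set(1) using i by (subst sum.insert) (simp_all add: set(2) K')
    moreover have "real (K' i + 1) = real (K i)" using False by (simp add: K'_def)
    moreover have "(\<Sum>j\<in>-S. (wedge_sign j (S - {i}) * real (K' j + 1) / den) *\<^sub>R r (insert j (S - {i})) (mi_raise j K'))
        = (\<Sum>j\<in>-S. (wedge_sign j (S - {i}) * real (K j + 1) / den) *\<^sub>R r (insert j (S - {i})) (mi_raise j K'))"
      by (rule sum.cong) (use i in \<open>auto simp: K'_def\<close>)
    ultimately have "wedge_sign i S *\<^sub>R b (S - {i}) K'
        = wedge_sign i S *\<^sub>R ((wedge_sign i S * real (K i) / den) *\<^sub>R r S K)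
        + wedge_sign i S *\<^sub>R (\<Sum>j\<in>-S. (wedge_sign j (S - {i}) * real (K j + 1) / den)
            *\<^sub>R r (insert j (S - {i})) (mi_raise j K'))"
      by (simp only: scaleR_right_distrib)
    also have "wedge_sign i S *\<^sub>R ((wedge_sign i S * real (K i) / den) *\<^sub>R r S K) = (real (K i) / den) *\<^sub>R r S K"
      using wedge_sign_square[of i S] by (simp flip: mult.assoc)
    also have "wedge_sign i S *\<^sub>R (\<Sum>j\<in>-S. (wedge_sign j (S - {i}) * real (K j + 1) / den)
            *\<^sub>R r (insert j (S - {i})) (mi_raise j K'))
        = (\<Sum>j\<in>-S. (real (K j + 1) / den) *\<^sub>R ((wedge_sign i S * wedge_sign j (S - {i})) *\<^sub>R X i j))"
      unfolding scaleR_sum_right using False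
      by (intro sum.cong) (simp_all add: X_def K'_def mult_ac)
    finally show ?thesis
      by (simp only: shift_def False if_False K'_def)
  qed
  \<comment> \<open>Closedness at the larger set \<open>insert j S\<close> and the raised index
    expresses the mixed terms through \<open>r S K\<close>.\<close>
  have 2: "(\<Sum>i\<in>S. (wedge_sign i S * wedge_sign j (S - {i})) *\<^sub>R X i j) = r S K" if j: "j \<notin> S" for j
  proof -
    let ?T = "insert j S"
    have sh: "shift i (r (?T - {i})) (mi_raise j K) = X i j" if "i \<in> S" for i
    proof -
      have "i \<noteq> j" using that j by auto
      moreover have "?T - {i} = insert j (S - {i})" using \<open>i \<noteq> j\<close> by auto
      moreover have "(mi_raise j K)(i := K i - 1) = mi_raise j (K(i := K i - 1))"
        using \<open>i \<noteq> j\<close> by (auto simp: mi_raise_def)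
      moreover have "mi_raise j K i = K i" using \<open>i \<noteq> j\<close> by (simp add: mi_raise_def)
      ultimately show ?thesis by (simp add: shift_def X_def)
    qed
    have "(\<Sum>i\<in>?T. wedge_sign i ?T *\<^sub>R shift i (r (?T - {i})) (mi_raise j K)) = 0"
      by (rule closed)
    moreover have "shift j (r (?T - {j})) (mi_raise j K) = r S K"
      using j by (simp add: shift_def mi_raise_def insert_Diff_if)
    ultimately have "wedge_sign j S *\<^sub>R r S K + (\<Sum>i\<in>S. wedge_sign i ?T *\<^sub>R X i j) = 0"
      using j by (simp add: sh)
    then have "(\<Sum>i\<in>S. wedge_sign i ?T *\<^sub>R X i j) = - (wedge_sign j S *\<^sub>R r S K)"
      by (simp add: add_eq_0_iff2)
    moreover have "(\<Sum>i\<in>S. (wedge_sign i S * wedge_sign j (S - {i})) *\<^sub>R X i j)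
        = (- wedge_sign j S) *\<^sub>R (\<Sum>i\<in>S. wedge_sign i ?T *\<^sub>R X i j)"
      unfolding scaleR_sum_right by (rule sum.cong) (simp_all add: wedge_sign_swap j)
    ultimately show ?thesis by simp
  qed
  have "(\<Sum>i\<in>S. wedge_sign i S *\<^sub>R shift i (b (S - {i})) K)
      = (\<Sum>i\<in>S. (real (K i) / den) *\<^sub>R r S K) + (\<Sum>j\<in>-S. (real (K j + 1) / den) *\<^sub>R r S K)"
  proof -
    have "(\<Sum>i\<in>S. \<Sum>j\<in>-S. (real (K j + 1) / den) *\<^sub>R ((wedge_sign i S * wedge_sign j (S - {i})) *\<^sub>R X i j))
        = (\<Sum>j\<in>-S. (real (K j + 1) / den) *\<^sub>R (\<Sum>i\<in>S. (wedge_sign i S * wedge_sign j (S - {i})) *\<^sub>R X i j))"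
      unfolding scaleR_sum_right by (rule sum.swap)
    also have "\<dots> = (\<Sum>j\<in>-S. (real (K j + 1) / den) *\<^sub>R r S K)"
      by (intro sum.cong) (simp_all add: 2)
    finally show ?thesis by (simp only: 1 sum.distrib cong: sum.cong)
  qed
  also have "\<dots> = (((\<Sum>i\<in>S. real (K i)) + (\<Sum>j\<in>-S. real (K j + 1))) / den) *\<^sub>R r S K"
    by (simp add: scaleR_sum_left[symmetric] sum_divide_distrib[symmetric] scaleR_left_distrib[symmetric]
        add_divide_distrib[symmetric])
  also have "(\<Sum>i\<in>S. real (K i)) + (\<Sum>j\<in>-S. real (K j + 1)) = den"
  proof -
    have "real (mi_size K) = (\<Sum>i\<in>S. real (K i)) + (\<Sum>j\<in>-S. real (K j))"
      unfolding mi_size_def of_nat_sum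
      by (subst sum.union_disjoint[symmetric]) (auto simp: Compl_partition)
    moreover have "real (card (-S)) = c" by (simp add: c Compl_eq_Diff_UNIV card_Diff_subset of_nat_diff card_mono)
    ultimately show ?thesis by (simp add: den_def sum.distrib)
  qed
  \<comment> \<open>A zero denominator makes the quotient 0, which is correct because
    \<open>r S K\<close> is 0 in that case by \<open>nz\<close>.\<close>
  also have "(den / den) *\<^sub>R r S K = r S K" using nz by (cases "den = 0") (auto simp: den_def)
  finally show ?thesis .
qed

section \<open>The characteristic in left form\<close>

lemma left_form_uminus:
  assumes "admissible_wt wt q"
  shows "admissible_wt wt (\<lambda>k. - q k)"
    "expansion (lift_vert left_mon) (\<lambda>k. - q k) f = - expansion (lift_vert left_mon) q f"
proof -
  show a: "admissible_wt wt (\<lambda>k. - q k)" using assms by (simp add: admissible_wt_def)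
  show "expansion (lift_vert left_mon) (\<lambda>k. - q k) f = - expansion (lift_vert left_mon) q f"
    using expansion_add[OF monomials_left assms a, of f]
    by (simp add: expansion_zero[OF monomials_left] eq_neg_iff_add_eq_0 add.commute)
qed

lemma left_form_inject:
  assumes "admissible_wt wt p" "admissible_wt wt q"
    and "expansion (lift_vert left_mon) p = expansion (lift_vert left_mon) q"
  shows "p = q"
proof -
  have "expansion (lift_vert left_mon) (\<lambda>k. p k + - q k) f = 0" for f
    unfolding expansion_add[OF monomials_left assms(1) left_form_uminus(1)[OF assms(2)]]
      left_form_uminus(2)[OF assms(2)] assms(3) by simp
  then have "(\<lambda>k. p k + - q k) = (\<lambda>_. 0)"
    by (intro left_form_unique admissible_wt_add[OF assms(1) left_form_uminus(1)[OF assms(2)]]) auto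
  then show ?thesis by (auto simp: fun_eq_iff)
qed

lemma admissible_wt_subset:
  "admissible_wt w p \<Longrightarrow> (\<And>k. q k \<noteq> 0 \<Longrightarrow> p k \<noteq> 0) \<Longrightarrow> admissible_wt w q"
proof -
  assume p: "admissible_wt w p" and pq: "\<And>k. q k \<noteq> 0 \<Longrightarrow> p k \<noteq> 0"
  have sub: "{k. q k \<noteq> 0 \<and> w k \<le> m} \<subseteq> {k. p k \<noteq> 0 \<and> w k \<le> m}" for m using pq by auto
  have "finite {k. q k \<noteq> 0 \<and> w k \<le> m}" for m
    by (rule finite_subset[OF sub]) (use p in \<open>simp add: admissible_wt_def\<close>)
  then show "admissible_wt w q" by (simp add: admissible_wt_def)
qed

text \<open>Whichever polarized form \<open>SOME\<close> selects, its left form is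
  \<open>s + t\<close> with \<open>s\<close> free of outer derivatives and \<open>t\<close> not.
  Uniqueness forces \<open>s\<close> to be the corresponding part of \<open>r\<close>, so the choice
  has no influence.\<close>

lemma characteristic_left_form:
  fixes r :: "('n::{finite,linorder} \<Rightarrow> 'd::finite \<Rightarrow> nat) \<times> ('n \<Rightarrow> (('d \<Rightarrow> nat) \<Rightarrow>\<^sub>0 nat)) \<Rightarrow> 'd loc"
  assumes r: "admissible_wt wt r"
  shows "characteristic (expansion (lift_vert left_mon) r)
    = expansion (lift_vert left_mon) (\<lambda>k. if fst k first = (\<lambda>_. 0) then r k else 0)"
proof -
  let ?A = "expansion (lift_vert left_mon) r"
  define q where "q = (SOME q. admissible q \<and> ?A = polar_op q)"
  have "?A \<in> LDO" using r LDO_left by blast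
  then have q: "admissible q" "?A = polar_op q"
    using someI_ex[OF LDO_polar[of ?A]] unfolding q_def by auto
  obtain s t where st: "admissible_wt wt s" "admissible_wt wt t"
    "{k. s k \<noteq> 0} \<subseteq> {k. fst k first = (\<lambda>_. 0)}" "{k. t k \<noteq> 0} \<subseteq> {k. fst k first \<noteq> (\<lambda>_. 0)}"
    "char_op q = expansion (lift_vert left_mon) s"
    "polar_op q = expansion (lift_vert left_mon) (\<lambda>k. s k + t k)"
    using polar_op_char_op[OF q(1)] by blast
  have "r = (\<lambda>k. s k + t k)"
    by (rule left_form_inject[OF r admissible_wt_add[OF st(1,2)]]) (use q(2) st(6) in simp)
  then have "s = (\<lambda>k. if fst k first = (\<lambda>_. 0) then r k else 0)"
    using st(3,4) by (auto simp: fun_eq_iff subset_iff)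
  then show ?thesis using st(5) by (simp add: characteristic_def q_def)
qed

lemma characteristic_eq_0_iff:
  assumes r: "admissible_wt wt r"
  shows "characteristic (expansion (lift_vert left_mon) r) = (\<lambda>_. 0)
    \<longleftrightarrow> (\<forall>k. fst k first = (\<lambda>_. 0) \<longrightarrow> r k = 0)"
proof
  assume "\<forall>k. fst k first = (\<lambda>_. 0) \<longrightarrow> r k = 0"
  then have "(\<lambda>k. if fst k first = (\<lambda>_. 0) then r k else 0) = (\<lambda>_. 0)" by auto
  then show "characteristic (expansion (lift_vert left_mon) r) = (\<lambda>_. 0)"
    by (auto simp: characteristic_left_form[OF r] expansion_zero[OF monomials_left])
next
  let ?s = "\<lambda>k. if fst k first = (\<lambda>_. 0) then r k else 0"
  assume "characteristic (expansion (lift_vert left_mon) r) = (\<lambda>_. 0)"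
  then have "expansion (lift_vert left_mon) ?s = (\<lambda>_. 0)" by (simp add: characteristic_left_form[OF r])
  moreover have "admissible_wt wt ?s" by (rule admissible_wt_subset[OF r]) (auto split: if_splits)
  ultimately have "?s = (\<lambda>_. 0)" by (intro left_form_unique)
  then show "\<forall>k. fst k first = (\<lambda>_. 0) \<longrightarrow> r k = 0" by (metis (mono_tags, lifting))
qed

definition shift_coeff ::
  "'d \<Rightarrow> (('n::{finite,linorder} \<Rightarrow> 'd \<Rightarrow> nat) \<times> 'a \<Rightarrow> 'v::zero) \<Rightarrow> ('n \<Rightarrow> 'd \<Rightarrow> nat) \<times> 'a \<Rightarrow> 'v" where
  "shift_coeff i r k = shift i (\<lambda>K. r ((fst k)(first := K), snd k)) (fst k first)"

lemma raise_lower_first: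
  "fst k first i \<noteq> 0 \<Longrightarrow> (raise_at first i ((fst k)(first := (fst k first)(i := fst k first i - 1))), snd k) = k"
  using raise_lower[of "fst k" first i] by (simp add: lower_at_def prod_eq_iff)

lemma total_deriv_left_form:
  fixes r :: "('n::{finite,linorder} \<Rightarrow> 'd::finite \<Rightarrow> nat) \<times> ('n \<Rightarrow> (('d \<Rightarrow> nat) \<Rightarrow>\<^sub>0 nat)) \<Rightarrow> 'd loc"
  assumes r: "admissible_wt wt r"
  shows "admissible_wt wt (shift_coeff i r)"
    "total_deriv i (expansion (lift_vert left_mon) r f) = expansion (lift_vert left_mon) (shift_coeff i r) f"
proof -
  define up where "up k = (raise_at first i (fst k), snd k)" for
    k :: "('n \<Rightarrow> 'd \<Rightarrow> nat) \<times> ('n \<Rightarrow> (('d \<Rightarrow> nat) \<Rightarrow>\<^sub>0 nat))"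
  have inj: "inj up"
  proof (rule injI)
    fix k l assume "up k = up l"
    then have "lower_at first i (raise_at first i (fst k)) = lower_at first i (raise_at first i (fst l))"
      "snd k = snd l" by (auto simp: up_def)
    then show "k = l" by (simp add: lower_raise prod_eq_iff)
  qed
  have wt_up: "wt (up k) = wt k" for k by (simp add: up_def wt_def)
  have sup: "shift_coeff i r (up k) = r k" for k
    by (simp add: shift_coeff_def shift_def up_def raise_at_def mi_raise_def)
  have img: "k \<in> up ` {k. r k \<noteq> 0 \<and> wt k \<le> m}" if nz: "shift_coeff i r k \<noteq> 0" "wt k \<le> m" for k m
  proof -
    have "fst k first i \<noteq> 0" using nz by (auto simp: shift_coeff_def shift_def split: if_splits)
    then obtain k' where "k = up k'" unfolding up_def using raise_lower_first by (metis fst_conv snd_conv)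
    with nz show ?thesis by (auto simp: sup wt_up)
  qed
  have fin: "finite {k. r k \<noteq> 0 \<and> wt k \<le> m}" for m using r by (simp add: admissible_wt_def)
  show "admissible_wt wt (shift_coeff i r)"
    unfolding admissible_wt_def
  proof
    fix m show "finite {k. shift_coeff i r k \<noteq> 0 \<and> wt k \<le> m}"
      by (rule finite_subset[OF _ finite_imageI[OF fin]]) (use img in blast)
  qed
  obtain m where m: "\<And>k r. m < wt k \<Longrightarrow> lift_vert left_mon k r f = 0"
    using monomials_bound[OF monomials_left] by blast
  let ?A = "{k. r k \<noteq> 0 \<and> wt k \<le> m}"
  have "expansion (lift_vert left_mon) (shift_coeff i r) f
      = (\<Sum>k\<in>up ` ?A. lift_vert left_mon k (shift_coeff i r k) f)"
    by (rule expansion_sum[OF monomials_left, of m]) (use fin img m in auto)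
  also have "\<dots> = (\<Sum>k\<in>?A. lift_vert left_mon (up k) (r k) f)"
    by (subst sum.reindex) (use inj in \<open>auto simp: sup intro: inj_on_subset\<close>)
  also have "\<dots> = total_deriv i (\<Sum>k\<in>?A. lift_vert left_mon k (r k) f)"
    by (simp add: total_deriv_sum_distrib lift_vert_def total_deriv_left_mon up_def)
  also have "(\<Sum>k\<in>?A. lift_vert left_mon k (r k) f) = expansion (lift_vert left_mon) r f"
    by (rule expansion_sum[OF monomials_left, of m, symmetric]) (use fin m in auto)
  finally show "total_deriv i (expansion (lift_vert left_mon) r f)
      = expansion (lift_vert left_mon) (shift_coeff i r) f" ..
qed


lemma left_form_scaleR:
  assumes r: "admissible_wt wt r"
  shows "admissible_wt wt (\<lambda>k. c *\<^sub>R r k)"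
    "expansion (lift_vert left_mon) (\<lambda>k. c *\<^sub>R r k) f = c *\<^sub>R expansion (lift_vert left_mon) r f"
proof -
  show "admissible_wt wt (\<lambda>k. c *\<^sub>R r k)" by (rule admissible_wt_subset[OF r]) auto
  obtain m where m: "\<And>k r. m < wt k \<Longrightarrow> lift_vert left_mon k r f = 0"
    using monomials_bound[OF monomials_left] by blast
  have fin: "finite {k. r k \<noteq> 0 \<and> wt k \<le> m}" using r by (simp add: admissible_wt_def)
  show "expansion (lift_vert left_mon) (\<lambda>k. c *\<^sub>R r k) f = c *\<^sub>R expansion (lift_vert left_mon) r f"
  proof -
    have "expansion (lift_vert left_mon) (\<lambda>k. c *\<^sub>R r k) f
        = (\<Sum>k | r k \<noteq> 0 \<and> wt k \<le> m. lift_vert left_mon k (c *\<^sub>R r k) f)"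
      by (rule expansion_sum[OF monomials_left, of m]) (use fin m in auto)
    moreover have "expansion (lift_vert left_mon) r f
        = (\<Sum>k | r k \<noteq> 0 \<and> wt k \<le> m. lift_vert left_mon k (r k) f)"
      by (rule expansion_sum[OF monomials_left, of m]) (use fin m in auto)
    ultimately show ?thesis
      by (simp add: scaleR_sum_right lift_vert_def left_mon_def linear_scale[OF linear_total_derivs])
  qed
qed

lemma left_form_sum:
  assumes "\<And>a. a \<in> S \<Longrightarrow> admissible_wt wt (r a)"
  shows "admissible_wt wt (\<lambda>k. \<Sum>a\<in>S. r a k) \<and>
    expansion (lift_vert left_mon) (\<lambda>k. \<Sum>a\<in>S. r a k) f
      = (\<Sum>a\<in>S. expansion (lift_vert left_mon) (r a) f)"
  using assms
proof (induction S rule: infinite_finite_induct)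
  case (insert a S)
  then have IH: "admissible_wt wt (\<lambda>k. \<Sum>a\<in>S. r a k)" and a: "admissible_wt wt (r a)"
    and eq: "expansion (lift_vert left_mon) (\<lambda>k. \<Sum>a\<in>S. r a k) f
      = (\<Sum>a\<in>S. expansion (lift_vert left_mon) (r a) f)"
    by simp_all
  show ?case using insert.hyps admissible_wt_add[OF a IH] expansion_add[OF monomials_left a IH, of f] eq
    by simp
qed (simp_all add: admissible_wt_def expansion_zero[OF monomials_left])

section \<open>The kernel of the characteristic as the image of the total derivatives\<close>

lemma char_kernel_left:
  "A \<in> char_kernel \<longleftrightarrow> (\<exists>r. admissible_wt wt r \<and> A = expansion (lift_vert left_mon) r \<and>
     (\<forall>k. fst k first = (\<lambda>_. 0) \<longrightarrow> r k = 0))"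
  unfolding char_kernel_def using LDO_left[of A] characteristic_eq_0_iff by blast

text \<open>A shift by \<open>i\<close> makes the outer exponent positive in every term, so nothing
  is left at outer exponent zero.\<close>

lemma char_kernel_total_deriv: "B \<in> LDO \<Longrightarrow> (\<lambda>f. total_deriv i (B f)) \<in> char_kernel"
proof -
  assume "B \<in> LDO"
  then obtain r where r: "admissible_wt wt r" "B = expansion (lift_vert left_mon) r"
    unfolding LDO_left by blast
  show ?thesis
    unfolding char_kernel_left
  proof (intro exI conjI)
    show "admissible_wt wt (shift_coeff i r)" by (rule total_deriv_left_form(1)[OF r(1)])
    show "(\<lambda>f. total_deriv i (B f)) = expansion (lift_vert left_mon) (shift_coeff i r)"
      by (simp add: r(2) total_deriv_left_form(2)[OF r(1)])
  qed (simp add: shift_coeff_def shift_def)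
qed

lemma char_kernel_scaleR: "A \<in> char_kernel \<Longrightarrow> (\<lambda>f. c *\<^sub>R A f) \<in> char_kernel"
proof -
  assume "A \<in> char_kernel"
  then obtain r where r: "admissible_wt wt r" "A = expansion (lift_vert left_mon) r"
    "\<forall>k. fst k first = (\<lambda>_. 0) \<longrightarrow> r k = 0" unfolding char_kernel_left by blast
  show ?thesis unfolding char_kernel_left
    by (rule exI[of _ "\<lambda>k. c *\<^sub>R r k"]) (use r in \<open>auto simp: left_form_scaleR\<close>)
qed

lemma char_kernel_sum:
  assumes "\<And>a. a \<in> S \<Longrightarrow> A a \<in> char_kernel"
  shows "(\<lambda>f. \<Sum>a\<in>S. A a f) \<in> char_kernel"
proof -
  have "\<forall>a\<in>S. \<exists>r. admissible_wt wt r \<and> A a = expansion (lift_vert left_mon) r \<and>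
     (\<forall>k. fst k first = (\<lambda>_. 0) \<longrightarrow> r k = 0)"
    using assms unfolding char_kernel_left by blast
  then obtain r where r: "\<And>a. a \<in> S \<Longrightarrow> admissible_wt wt (r a)"
    "\<And>a. a \<in> S \<Longrightarrow> A a = expansion (lift_vert left_mon) (r a)"
    "\<And>a k. a \<in> S \<Longrightarrow> fst k first = (\<lambda>_. 0) \<Longrightarrow> r a k = 0" by metis
  have "(\<lambda>f. \<Sum>a\<in>S. A a f) = expansion (lift_vert left_mon) (\<lambda>k. \<Sum>a\<in>S. r a k)"
    using left_form_sum[of S r] r(1,2) by (auto simp: fun_eq_iff)
  then show ?thesis unfolding char_kernel_left
    using left_form_sum[of S r] r by (intro exI[of _ "\<lambda>k. \<Sum>a\<in>S. r a k"]) auto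
qed

text \<open>For the contracting homotopy, which reads coefficients at raised indices with scalar
  factors. Raising is injective and preserves the weight.\<close>

lemma admissible_wt_raise:
  fixes r :: "('a::{finite,linorder} \<Rightarrow> 'b::finite \<Rightarrow> nat) \<times> ('a \<Rightarrow> (('b \<Rightarrow> nat) \<Rightarrow>\<^sub>0 nat)) \<Rightarrow> 'v::real_vector"
  assumes r: "admissible_wt wt r"
  shows "admissible_wt wt (\<lambda>k. g k *\<^sub>R r (raise_at first i (fst k), snd k))"
  unfolding admissible_wt_def
proof
  fix m
  define up where "up k = (raise_at first i (fst k), snd k)" for
    k :: "('a \<Rightarrow> 'b \<Rightarrow> nat) \<times> ('a \<Rightarrow> (('b \<Rightarrow> nat) \<Rightarrow>\<^sub>0 nat))"
  have inj: "inj up"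
  proof (rule injI)
    fix k l assume "up k = up l"
    then have "lower_at first i (raise_at first i (fst k)) = lower_at first i (raise_at first i (fst l))"
      "snd k = snd l" by (auto simp: up_def)
    then show "k = l" by (simp add: lower_raise prod_eq_iff)
  qed
  have "finite (up -` {k. r k \<noteq> 0 \<and> wt k \<le> m})"
    using r inj by (intro finite_vimageI) (auto simp: admissible_wt_def)
  then show "finite {k. g k *\<^sub>R r (raise_at first i (fst k), snd k) \<noteq> 0 \<and> wt k \<le> m}"
    by (rule finite_subset[rotated]) (auto simp: up_def wt_def)
qed

text \<open>Uniqueness of the left form turns the equation between operators into one between
  coefficients, which holds separately for each value of the remaining indices. There it is a Koszul
  complex of polynomials in the outer derivatives. The hypothesis \<open>top\<close> removes the
  constant term in form degree N, where exactness would fail.\<close>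

lemma koszul_LDO:
  fixes A :: "'d::{finite,linorder} set \<Rightarrow> ('n::{finite,linorder}, 'd) multi_op"
  assumes LDO: "\<And>S. A S \<in> LDO" and deg: "\<And>S. A S \<noteq> (\<lambda>_. 0) \<Longrightarrow> card S = p"
    and closed: "\<And>S f. (\<Sum>i\<in>S. wedge_sign i S *\<^sub>R total_deriv i (A (S - {i}) f)) = 0"
    and top: "p = CARD('d) \<Longrightarrow> A UNIV \<in> char_kernel"
  shows "\<exists>B. (\<forall>S. B S \<in> LDO \<and> (B S \<noteq> (\<lambda>_. 0) \<longrightarrow> card S + 1 = p)) \<and>
    (\<forall>S f. A S f = (\<Sum>i\<in>S. wedge_sign i S *\<^sub>R total_deriv i (B (S - {i}) f)))"
proof -
  let ?E = "expansion (lift_vert left_mon)"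
  have "\<forall>S. \<exists>r. admissible_wt wt r \<and> A S = ?E r" using LDO LDO_left by blast
  then obtain r where r: "\<And>S. admissible_wt wt (r S)" "\<And>S. A S = ?E (r S)" by metis
  have r0: "r S = (\<lambda>_. 0)" if "card S \<noteq> p" for S
    by (rule left_form_unique[OF r(1)]) (use deg[of S] that r(2) in auto)
  have comb: "admissible_wt wt (\<lambda>k. \<Sum>i\<in>S. wedge_sign i S *\<^sub>R shift_coeff i (q i) k) \<and>
    ?E (\<lambda>k. \<Sum>i\<in>S. wedge_sign i S *\<^sub>R shift_coeff i (q i) k) f
      = (\<Sum>i\<in>S. wedge_sign i S *\<^sub>R total_deriv i (?E (q i) f))"
    if "\<And>i. admissible_wt wt (q i)" for q and S :: "'d set" and f :: "'n \<Rightarrow> 'd loc"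
    using left_form_sum[of S "\<lambda>i k. wedge_sign i S *\<^sub>R shift_coeff i (q i) k" f]
    by (simp add: left_form_scaleR total_deriv_left_form that)
  have coeff: "(\<Sum>i\<in>S. wedge_sign i S *\<^sub>R shift_coeff i (r (S - {i})) k) = 0" for S k
  proof -
    have "(\<lambda>k. \<Sum>i\<in>S. wedge_sign i S *\<^sub>R shift_coeff i (r (S - {i})) k) = (\<lambda>_. 0)"
      using comb[of "\<lambda>i. r (S - {i})" S, OF r(1)] closed[of S]
      by (intro left_form_unique) (auto simp: fun_eq_iff r(2))
    then show ?thesis by (rule fun_cong)
  qed
  \<comment> \<open>N - p, the part of the denominator that depends on the form degree.\<close>
  define c where "c = real CARD('d) - real p"
  define b where "b S k = (\<Sum>i\<in>-S. (wedge_sign i S * real (fst k first i + 1) / (real (mi_size (fst k first)) + 1 + c))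
       *\<^sub>R r (insert i S) (raise_at first i (fst k), snd k))" for S k
  have b: "admissible_wt wt (b S)" for S
    unfolding b_def by (rule left_form_sum[THEN conjunct1]) (rule admissible_wt_raise[OF r(1)])
  have b0: "b S = (\<lambda>_. 0)" if "card S + 1 \<noteq> p" for S
  proof -
    have "r (insert i S) = (\<lambda>_. 0)" if "i \<in> -S" for i
      using that \<open>card S + 1 \<noteq> p\<close> by (intro r0) simp
    then show ?thesis by (simp add: b_def fun_eq_iff)
  qed
  have hom: "(\<Sum>i\<in>S. wedge_sign i S *\<^sub>R shift_coeff i (b (S - {i})) k) = r S k" for S k
  proof (cases "card S = p")
    case False
    have "b (S - {i}) = (\<lambda>_. 0)" if "i \<in> S" for i
    proof (rule b0)
      have "card S > 0" using that card_gt_0_iff by fastforce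
      then show "card (S - {i}) + 1 \<noteq> p" using that False by simp
    qed
    then show ?thesis by (simp add: r0[OF False] shift_coeff_def shift_def)
  next
    case True
    \<comment> \<open>All indices of \<open>k\<close> except the outer exponent are frozen.\<close>
    define r' where "r' S K = r S ((fst k)(first := K), snd k)" for S K
    define b' where "b' S K = b S ((fst k)(first := K), snd k)" for S K
    have "(\<Sum>i\<in>S. wedge_sign i S *\<^sub>R shift i (b' (S - {i})) (fst k first)) = r' S (fst k first)"
    proof (rule koszul_homotopy)
      show "(\<Sum>i\<in>S. wedge_sign i S *\<^sub>R shift i (r' (S - {i})) K) = 0" for S K
        using coeff[of S "((fst k)(first := K), snd k)"] by (simp add: shift_coeff_def r'_def[abs_def])
      show "b' S K = (\<Sum>i\<in>-S. (wedge_sign i S * real (K i + 1) / (real (mi_size K) + 1 + c))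
         *\<^sub>R r' (insert i S) (mi_raise i K))" for S K
        by (simp add: b'_def b_def r'_def raise_at_upd)
      show "c = real CARD('d) - real (card S)" using True by (simp add: c_def)
      show "real (mi_size (fst k first)) + c \<noteq> 0 \<or> r' S (fst k first) = 0"
      proof (cases "real (mi_size (fst k first)) + c = 0")
        \<comment> \<open>The denominator vanishes only in form degree N at outer exponent zero; the
          coefficient there belongs to the characteristic and is zero by \<open>top\<close>.\<close>
        case z: True
        have "p \<le> CARD('d)" using True card_mono[of UNIV S] by simp
        then have p: "p = CARD('d)" "mi_size (fst k first) = 0" using z by (simp_all add: c_def)
        then have "S = UNIV" using True by (intro card_subset_eq) auto
        have "fst k first = (\<lambda>_. 0)" using p(2) by (auto simp: mi_size_def fun_eq_iff)
        moreover have "characteristic (?E (r UNIV)) = (\<lambda>_. 0)"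
          using top[OF p(1)] r(2) by (simp add: char_kernel_def)
        ultimately have "r S k = 0"
          using characteristic_eq_0_iff[OF r(1), of UNIV] \<open>S = UNIV\<close> by blast
        then show ?thesis by (simp add: r'_def)
      qed simp
    qed
    then show ?thesis by (simp add: shift_coeff_def b'_def[abs_def] r'_def[abs_def])
  qed
  show ?thesis
  proof (intro exI[of _ "\<lambda>S. ?E (b S)"] conjI allI impI)
    show "?E (b S) \<in> LDO" for S using b LDO_left by blast
    show "card S + 1 = p" if "?E (b S) \<noteq> (\<lambda>_. 0)" for S
    proof (rule ccontr)
      assume "card S + 1 \<noteq> p"
      then have "?E (b S) = (\<lambda>_. 0)" by (auto simp: b0 expansion_zero[OF monomials_left])
      with that show False by simp
    qed
    show "A S f = (\<Sum>i\<in>S. wedge_sign i S *\<^sub>R total_deriv i (?E (b (S - {i})) f))" for S f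
      using comb[of "\<lambda>i. b (S - {i})" S f, OF b] by (simp add: hom r(2))
  qed
qed

text \<open>Precomposition disturbs the left form, so the coefficients do not help directly.
  Exactness in form degree N writes \<open>A\<close> as a combination of total derivatives of
  operators, and precomposition passes through those to the inner operators.\<close>

lemma char_kernel_precomp:
  fixes A :: "('n::{finite,linorder}, 'd::{finite,linorder}) multi_op"
  assumes "A \<in> char_kernel"
  shows "precomp_total j i A \<in> char_kernel"
proof -
  \<comment> \<open>\<open>A\<close> viewed as a top form; closedness holds because a proper subset
    never equals \<open>UNIV\<close>.\<close>
  define F where "F S = (if S = UNIV then A else (\<lambda>_. 0))" for S :: "'d set"
  have "\<exists>B. (\<forall>S. B S \<in> LDO \<and> (B S \<noteq> (\<lambda>_. 0) \<longrightarrow> card S + 1 = CARD('d))) \<and>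
    (\<forall>S f. F S f = (\<Sum>i\<in>S. wedge_sign i S *\<^sub>R total_deriv i (B (S - {i}) f)))"
  proof (rule koszul_LDO)
    show "F S \<in> LDO" for S using assms by (auto simp: F_def char_kernel_def intro: LDO_zero)
    show "card S = CARD('d)" if "F S \<noteq> (\<lambda>_. 0)" for S using that by (simp add: F_def split: if_splits)
    show "(\<Sum>i\<in>S. wedge_sign i S *\<^sub>R total_deriv i (F (S - {i}) f)) = 0" for S f
    proof (rule sum.neutral, rule ballI)
      fix i show "wedge_sign i S *\<^sub>R total_deriv i (F (S - {i}) f) = 0"
      proof -
        have "S - {i} \<noteq> UNIV" by auto
        then show ?thesis by (simp add: F_def total_deriv_zero)
      qed
    qed
    show "F UNIV \<in> char_kernel" using assms by (simp add: F_def)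
  qed
  then obtain B where B: "\<And>S. B S \<in> LDO"
    and FB: "\<And>S f. F S f = (\<Sum>i\<in>S. wedge_sign i S *\<^sub>R total_deriv i (B (S - {i}) f))"
    by blast
  have AB: "A f = (\<Sum>i\<in>UNIV. wedge_sign i UNIV *\<^sub>R total_deriv i (B (UNIV - {i}) f))" for f
    using FB[of UNIV f] by (simp add: F_def)
  have "precomp_total j i A = (\<lambda>f. \<Sum>k\<in>UNIV. wedge_sign k UNIV *\<^sub>R
      total_deriv k (precomp_total j i (B (UNIV - {k})) f))"
    unfolding precomp_total_def by (rule ext, rule AB)
  moreover have "(\<lambda>f. \<Sum>k\<in>UNIV. wedge_sign k UNIV *\<^sub>R
      total_deriv k (precomp_total j i (B (UNIV - {k})) f)) \<in> char_kernel"
    by (intro char_kernel_sum char_kernel_scaleR char_kernel_total_deriv LDO_precomp_total B(1))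
  ultimately show ?thesis by (simp only:)
qed


section \<open>Horizontal forms\<close>

lemma minus_one_power_mult: "(-1) ^ n * (x :: 'd::finite loc) = ((-1) ^ n :: real) *\<^sub>R x"
  by (induction n) simp_all

lemma dH_nth:
  "dH \<omega> $ S = (\<Sum>i\<in>S. wedge_sign i S *\<^sub>R total_deriv i (\<omega> $ (S - {i})))"
proof -
  have "dH \<omega> $ S = (\<Sum>i\<in>UNIV. if i \<in> S then wedge_sign i S *\<^sub>R total_deriv i (\<omega> $ (S - {i})) else 0)"
    by (simp add: dH_def wedge_dx_def minus_one_power_mult wedge_sign_def cong: if_cong)
  then show ?thesis by (simp add: sum.If_cases)
qed

lemma sign_twist_nth: "sign_twist \<omega> $ S = ((-1) ^ (CARD('d) - card S) :: real) *\<^sub>R (\<omega> :: 'd::finite form) $ S"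
  by (simp add: sign_twist_def minus_one_power_mult)

lemma linear_dH: "linear dH"
  by (rule linearI) (simp_all add: vec_eq_iff dH_nth total_deriv_add scaleR_right_distrib sum.distrib
      linear_scale[OF linear_total_deriv] scaleR_sum_right mult.commute)

lemma linear_sign_twist: "linear sign_twist"
  by (rule linearI) (simp_all add: vec_eq_iff sign_twist_nth scaleR_right_distrib scaleR_left_commute)

lemma antisym_sum_eq_0:
  fixes T :: "'a \<Rightarrow> 'a \<Rightarrow> 'v::real_vector"
  assumes "\<And>i j. i \<in> S \<Longrightarrow> j \<in> S \<Longrightarrow> T i j = - T j i"
  shows "(\<Sum>i\<in>S. \<Sum>j\<in>S. T i j) = 0"
proof -
  have "(\<Sum>i\<in>S. \<Sum>j\<in>S. T i j) = (\<Sum>i\<in>S. \<Sum>j\<in>S. - T j i)"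
    by (intro sum.cong refl assms)
  also have "\<dots> = - (\<Sum>i\<in>S. \<Sum>j\<in>S. T i j)"
    by (subst sum.swap) (simp add: sum_negf)
  finally have "2 *\<^sub>R (\<Sum>i\<in>S. \<Sum>j\<in>S. T i j) = 0"
    by (simp only: scaleR_2 eq_neg_iff_add_eq_0)
  then show ?thesis by simp
qed

lemma wedge_sign_remove:
  fixes S :: "'d::{finite,linorder} set"
  assumes "i \<in> S"
  shows "wedge_sign j S = (if i < j then - wedge_sign j (S - {i}) else wedge_sign j (S - {i}))"
  using wedge_sign_insert[of i "S - {i}" j] assms by (simp only: insert_Diff Diff_iff) simp

lemma dH_dH: "dH (dH \<omega>) = 0"
proof -
  have "dH (dH \<omega>) $ S = 0" for S
  proof -
    \<comment> \<open>The diagonal is set to zero so that the double sum runs over a square and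
      cancels by antisymmetry.\<close>
    define T where "T i j = (if i = j then 0 else (wedge_sign i S * wedge_sign j (S - {i})) *\<^sub>R
      total_deriv i (total_deriv j (\<omega> $ (S - {i} - {j}))))" for i j
    have "wedge_sign i S *\<^sub>R total_deriv i (\<Sum>j\<in>S - {i}. wedge_sign j (S - {i}) *\<^sub>R
        total_deriv j (\<omega> $ (S - {i} - {j}))) = (\<Sum>j\<in>S. T i j)" if "i \<in> S" for i
    proof -
      have "(\<Sum>j\<in>S. T i j) = (\<Sum>j\<in>S - {i}. T i j)"
        by (rule sum.mono_neutral_right) (auto simp: T_def)
      also have "\<dots> = (\<Sum>j\<in>S - {i}. wedge_sign i S *\<^sub>R (wedge_sign j (S - {i}) *\<^sub>R
        total_deriv i (total_deriv j (\<omega> $ (S - {i} - {j})))))"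
        by (rule sum.cong) (auto simp: T_def)
      finally show ?thesis
        by (simp add: total_deriv_sum_distrib linear_scale[OF linear_total_deriv] scaleR_sum_right)
    qed
    then have "dH (dH \<omega>) $ S = (\<Sum>i\<in>S. \<Sum>j\<in>S. T i j)"
      by (simp add: dH_nth)
    also have "\<dots> = 0"
    proof (rule antisym_sum_eq_0)
      fix i j assume ij: "i \<in> S" "j \<in> S"
      have "wedge_sign i S * wedge_sign j (S - {i}) = - (wedge_sign j S * wedge_sign i (S - {j}))" if "i \<noteq> j"
      proof (cases "i < j")
        case True
        then have "\<not> j < i" by simp
        with True show ?thesis
          by (simp only: wedge_sign_remove[OF ij(1), of j] wedge_sign_remove[OF ij(2), of i] if_True if_False) simp
      next
        case False
        then have "j < i" using that by simp
        with False show ?thesis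
          by (simp only: wedge_sign_remove[OF ij(1), of j] wedge_sign_remove[OF ij(2), of i] if_True if_False) simp
      qed
      moreover have "S - {i} - {j} = S - {j} - {i}" by auto
      ultimately show "T i j = - T j i"
        by (simp add: T_def total_deriv_commute[of i j])
    qed
    finally show ?thesis .
  qed
  then show ?thesis by (simp add: vec_eq_iff)
qed

text \<open>d_H changes the degree by one and hence the sign; this makes the mixed terms cancel in
  \<open>precomp_dH_precomp_dH\<close>.\<close>

lemma sign_twist_dH: "sign_twist (dH \<omega>) = - dH (sign_twist (\<omega> :: 'd::{finite,linorder} form))"
proof -
  have "(-1 :: real) ^ (CARD('d) - card (S - {i})) = - ((-1) ^ (CARD('d) - card S))" if "i \<in> S" for i and S :: "'d set"
  proof -
    have "card S > 0" using that by (auto simp: card_gt_0_iff)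
    moreover have "card S \<le> CARD('d)" by (simp add: card_mono)
    ultimately have "CARD('d) - card (S - {i}) = Suc (CARD('d) - card S)"
      using that by simp
    then show ?thesis by simp
  qed
  then show ?thesis
    by (simp add: vec_eq_iff sign_twist_nth dH_nth scaleR_sum_right linear_scale[OF linear_total_deriv]
        sum_negf total_deriv_minus mult.commute cong: sum.cong)
qed

lemma dH_axis:
  "dH (axis T h) = (\<Sum>i\<in>-T. wedge_sign i T *\<^sub>R axis (insert i T) (total_deriv i h))"
proof -
  have "dH (axis T h) $ S = (\<Sum>i\<in>-T. wedge_sign i T *\<^sub>R axis (insert i T) (total_deriv i h)) $ S" for S
  proof -
    let ?t = "\<lambda>i. if i \<notin> T \<and> S = insert i T then wedge_sign i T *\<^sub>R total_deriv i h else 0"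
    have eq: "i \<in> S \<and> S - {i} = T \<longleftrightarrow> i \<notin> T \<and> S = insert i T" for i by auto
    have "dH (axis T h) $ S = (\<Sum>i\<in>S. ?t i)"
      unfolding dH_nth
    proof (rule sum.cong)
      fix i assume "i \<in> S"
      then show "wedge_sign i S *\<^sub>R total_deriv i (axis T h $ (S - {i})) = ?t i"
        using eq[of i] by (auto simp: axis_def total_deriv_zero)
    qed simp
    also have "\<dots> = (\<Sum>i\<in>UNIV. ?t i)" by (rule sum.mono_neutral_left) auto
    also have "\<dots> = (\<Sum>i\<in>-T. ?t i)" by (rule sum.mono_neutral_right) auto
    also have "\<dots> = (\<Sum>i\<in>-T. wedge_sign i T *\<^sub>R axis (insert i T) (total_deriv i h)) $ S"
      by (simp add: axis_def if_distrib cong: if_cong)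
    finally show ?thesis .
  qed
  then show ?thesis by (simp add: vec_eq_iff)
qed

lemma sign_twist_axis: "sign_twist (axis T h) = ((-1) ^ (CARD('d) - card T) :: real) *\<^sub>R axis (T :: 'd::finite set) h"
  by (simp add: vec_eq_iff sign_twist_nth axis_def)

section \<open>Multilinear operators on forms\<close>

lemma multilinear_lin: "multilinear F \<Longrightarrow> linear (\<lambda>x. F (g(j := x)))"
  by (simp add: multilinear_def)

lemma multilinear_scale:
  fixes F :: "('n::finite \<Rightarrow> 'v::real_vector) \<Rightarrow> 'w::real_vector"
  assumes "multilinear F"
  shows "F (\<lambda>l. c l *\<^sub>R g l) = (\<Prod>l\<in>UNIV. c l) *\<^sub>R F g"
proof -
  have "F (\<lambda>l. if l \<in> A then c l *\<^sub>R g l else g l) = (\<Prod>l\<in>A. c l) *\<^sub>R F g" for A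
  proof (induction A rule: infinite_finite_induct)
    case (insert a A)
    define g' where "g' = (\<lambda>l. if l \<in> A then c l *\<^sub>R g l else g l)"
    have "(\<lambda>l. if l \<in> insert a A then c l *\<^sub>R g l else g l) = g'(a := c a *\<^sub>R g a)"
      by (auto simp: g'_def)
    moreover have "F (g'(a := c a *\<^sub>R g a)) = c a *\<^sub>R F (g'(a := g a))"
      by (rule linear_scale[OF multilinear_lin[OF assms]])
    moreover have "g'(a := g a) = g'" using insert.hyps by (auto simp: g'_def)
    ultimately show ?case using insert by (simp add: g'_def)
  qed simp_all
  from this[of UNIV] show ?thesis by simp
qed

lemma multilinear_eqI:
  fixes F G :: "('n::finite, 'd::finite) form_op"
  assumes F: "multilinear F" and G: "multilinear G"
    and eq: "\<And>\<epsilon> S. matrix_coeff F \<epsilon> S = matrix_coeff G \<epsilon> S"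
  shows "F = G"
proof
  fix f
  \<comment> \<open>\<open>A\<close> collects the slots whose argument is not yet concentrated on
    one basis form; the induction decomposes them one by one.\<close>
  have "F f = G f" if "\<forall>j. j \<notin> A \<longrightarrow> (\<exists>T h. f j = axis T h)" for A f
    using finite[of A] that
  proof (induction A arbitrary: f rule: finite_induct)
    case empty
    then have "\<forall>j. \<exists>T h. f j = axis T h" by blast
    then obtain T h where "\<And>j. f j = axis (T j) (h j)" by metis
    then have "f = (\<lambda>j. axis (T j) (h j))" by auto
    moreover have "F (\<lambda>j. axis (T j) (h j)) $ S = G (\<lambda>j. axis (T j) (h j)) $ S" for S
      using fun_cong[OF eq[of T S], of h] by (simp add: matrix_coeff_def)
    ultimately show ?case by (simp add: vec_eq_iff)
  next
    case (insert a A)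
    have dec: "f a = (\<Sum>T\<in>UNIV. axis T (f a $ T))"
      by (simp add: vec_eq_iff axis_def)
    have expand: "H f = (\<Sum>T\<in>UNIV. H (f(a := axis T (f a $ T))))"
      if "multilinear H" for H :: "('n, 'd) form_op"
      using linear_sum[OF multilinear_lin[OF that, of f a], of "\<lambda>T. axis T (f a $ T)" UNIV]
      by (simp flip: dec)
    have "F (f(a := axis T (f a $ T))) = G (f(a := axis T (f a $ T)))" for T
      by (rule insert.IH) (use insert.prems in auto)
    then show ?case by (simp only: expand[OF F] expand[OF G])
  qed
  from this[of UNIV f] show "F f = G f" by simp
qed

definition form_of ::
    "(('n \<Rightarrow> 'd set) \<Rightarrow> 'd set \<Rightarrow> ('n, 'd) multi_op) \<Rightarrow> ('n::finite, 'd::finite) form_op" where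
  "form_of A \<omega> = (\<chi> S. \<Sum>\<epsilon>\<in>UNIV. A \<epsilon> S (\<lambda>j. \<omega> j $ \<epsilon> j))"

lemma multilinear_form_of:
  fixes A :: "('n::finite \<Rightarrow> 'd::finite set) \<Rightarrow> 'd set \<Rightarrow> ('n, 'd) multi_op"
  assumes "\<And>\<epsilon> S. multilinear (A \<epsilon> S)"
  shows "multilinear (form_of A)"
  unfolding multilinear_def
proof (intro allI)
  fix j and f :: "'n \<Rightarrow> 'd form"
  have *: "(\<lambda>l. (f(j := x)) l $ \<epsilon> l) = (\<lambda>l. f l $ \<epsilon> l)(j := x $ \<epsilon> j)" for x \<epsilon> by auto
  have lin: "linear (\<lambda>x. A \<epsilon> S (g(j := x)))" for \<epsilon> S g by (rule multilinear_lin[OF assms])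
  show "linear (\<lambda>g. form_of A (f(j := g)))"
    by (rule linearI) (simp_all add: form_of_def vec_eq_iff * linear_add[OF lin] linear_scale[OF lin]
        sum.distrib scaleR_sum_right del: fun_upd_apply)
qed

lemma matrix_coeff_form_of:
  fixes A :: "('n::finite \<Rightarrow> 'd::finite set) \<Rightarrow> 'd set \<Rightarrow> ('n, 'd) multi_op"
  assumes "\<And>\<epsilon> S. multilinear (A \<epsilon> S)"
  shows "matrix_coeff (form_of A) \<epsilon> S = A \<epsilon> S"
proof
  fix h
  have "A \<epsilon>' S (\<lambda>j. axis (\<epsilon> j) (h j) $ \<epsilon>' j) = (if \<epsilon>' = \<epsilon> then A \<epsilon> S h else 0)" for \<epsilon>'
  proof (cases "\<epsilon>' = \<epsilon>")
    case False
    then obtain j where "\<epsilon>' j \<noteq> \<epsilon> j" by (meson ext)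
    with False show ?thesis
      using multilinear_zero[OF assms, of "\<lambda>j. axis (\<epsilon> j) (h j) $ \<epsilon>' j" j] by (simp add: axis_def)
  qed (simp add: axis_def)
  then show "matrix_coeff (form_of A) \<epsilon> S h = A \<epsilon> S h"
    by (simp add: matrix_coeff_def form_of_def)
qed

lemma matrix_coeff_dH:
  "matrix_coeff (\<lambda>\<omega>. dH (F \<omega>)) \<epsilon> S
     = (\<lambda>h. \<Sum>i\<in>S. wedge_sign i S *\<^sub>R total_deriv i (matrix_coeff F \<epsilon> (S - {i}) h))"
  by (simp add: matrix_coeff_def dH_nth)

text \<open>The sign of passing the differential over the earlier arguments, times the sign of the
  wedge product in slot \<open>j\<close>. Squares of the differential are computed with
  \<open>diff_at\<close>; below, this sign is used only through its being nonzero.\<close>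

definition koszul_sign :: "('n::{finite,linorder} \<Rightarrow> 'd::{finite,linorder} set) \<Rightarrow> 'n \<Rightarrow> 'd \<Rightarrow> real" where
  "koszul_sign \<epsilon> j i = (\<Prod>l\<in>UNIV. if l < j then (-1) ^ (CARD('d) - card (\<epsilon> l)) else 1) * wedge_sign i (\<epsilon> j)"

lemma koszul_sign_nonzero: "koszul_sign \<epsilon> j i \<noteq> 0"
  by (simp add: koszul_sign_def wedge_sign_def)

text \<open>The entry at \<open>\<epsilon>\<close> involves \<open>F\<close> only at tuples with one
  more differential, whose argument degree is smaller by one. This triangularity makes the
  filtration by argument degree work.\<close>

lemma matrix_coeff_precomp_dH:
  fixes F :: "('n::{finite,linorder}, 'd::{finite,linorder}) form_op"
  assumes F: "multilinear F"
  shows "matrix_coeff (precomp_dH F) \<epsilon> S = (\<lambda>h. \<Sum>j\<in>UNIV. \<Sum>i\<in>-\<epsilon> j. koszul_sign \<epsilon> j i *\<^sub>R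
    precomp_total j i (matrix_coeff F (\<epsilon>(j := insert i (\<epsilon> j))) S) h)"
proof
  fix h
  have "F (\<lambda>l. if l < j then sign_twist (axis (\<epsilon> l) (h l)) else if l = j then dH (axis (\<epsilon> l) (h l))
        else axis (\<epsilon> l) (h l))
      = (\<Sum>i\<in>-\<epsilon> j. koszul_sign \<epsilon> j i *\<^sub>R
          F (\<lambda>l. axis ((\<epsilon>(j := insert i (\<epsilon> j))) l) ((h(j := total_deriv i (h j))) l)))" for j
  proof -
    define c where "c l = (if l < j then (-1) ^ (CARD('d) - card (\<epsilon> l)) else (1 :: real))" for l
    define g where "g l = axis (\<epsilon> l) (h l)" for l
    have upd: "(\<lambda>l. axis ((\<epsilon>(j := insert i (\<epsilon> j))) l) ((h(j := total_deriv i (h j))) l))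
        = g(j := axis (insert i (\<epsilon> j)) (total_deriv i (h j)))" for i
      by (auto simp: g_def)
    have "(\<lambda>l. if l < j then sign_twist (axis (\<epsilon> l) (h l)) else if l = j then dH (axis (\<epsilon> l) (h l))
        else axis (\<epsilon> l) (h l)) = (\<lambda>l. c l *\<^sub>R (g(j := dH (g j))) l)"
      by (auto simp: fun_eq_iff c_def g_def sign_twist_axis)
    then have "F (\<lambda>l. if l < j then sign_twist (axis (\<epsilon> l) (h l)) else if l = j then dH (axis (\<epsilon> l) (h l))
        else axis (\<epsilon> l) (h l)) = (\<Prod>l\<in>UNIV. c l) *\<^sub>R F (g(j := dH (g j)))"
      by (simp only: multilinear_scale[OF F])
    also have "F (g(j := dH (g j)))
        = (\<Sum>i\<in>-\<epsilon> j. wedge_sign i (\<epsilon> j) *\<^sub>R F (g(j := axis (insert i (\<epsilon> j)) (total_deriv i (h j)))))"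
      unfolding g_def[of j] dH_axis
      by (simp only: linear_sum[OF multilinear_lin[OF F]] linear_scale[OF multilinear_lin[OF F]])
    finally show ?thesis
      by (simp only: upd scaleR_sum_right koszul_sign_def c_def scaleR_scaleR)
  qed
  then show "matrix_coeff (precomp_dH F) \<epsilon> S h = (\<Sum>j\<in>UNIV. \<Sum>i\<in>-\<epsilon> j. koszul_sign \<epsilon> j i *\<^sub>R
    precomp_total j i (matrix_coeff F (\<epsilon>(j := insert i (\<epsilon> j))) S) h)"
    by (simp add: matrix_coeff_def precomp_dH_def precomp_total_def del: fun_upd_apply)
qed

definition diff_at ::
    "'n::linorder \<Rightarrow> ('n \<Rightarrow> 'd::{finite,linorder} form) \<Rightarrow> 'n \<Rightarrow> 'd form" where
  "diff_at j \<omega> = (\<lambda>l. if l < j then sign_twist (\<omega> l) else if l = j then dH (\<omega> l) else \<omega> l)"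

lemma precomp_dH_eq: "precomp_dH F \<omega> = (\<Sum>j\<in>UNIV. F (diff_at j \<omega>))"
  by (simp add: precomp_dH_def diff_at_def)

lemma precomp_dH_precomp_dH:
  assumes F: "multilinear F"
  shows "precomp_dH (precomp_dH F) \<omega> = 0"
proof -
  have lt: "F (diff_at j (diff_at i \<omega>)) = - F (diff_at i (diff_at j \<omega>))" if "i < j" for i j
  proof -
    define g where "g = diff_at j (diff_at i \<omega>)"
    \<comment> \<open>The two orders differ only in slot \<open>i\<close>, where \<open>dH\<close>
      and \<open>sign_twist\<close> are exchanged.\<close>
    have "diff_at i (diff_at j \<omega>) = g(i := - g i)"
      using that by (auto simp: g_def diff_at_def fun_eq_iff sign_twist_dH)
    moreover have "F (g(i := - g i)) = - F (g(i := g i))"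
      by (rule linear_neg[OF multilinear_lin[OF F]])
    ultimately show ?thesis by (simp add: g_def)
  qed
  have same: "F (diff_at i (diff_at i \<omega>)) = 0" for i
    by (rule multilinear_zero[OF F, of _ i]) (simp add: diff_at_def dH_dH)
  have "F (diff_at j (diff_at i \<omega>)) = - F (diff_at i (diff_at j \<omega>))" for i j
    using lt[of i j] lt[of j i] same by (cases i j rule: linorder_cases) auto
  then have "(\<Sum>i\<in>UNIV. \<Sum>j\<in>UNIV. F (diff_at j (diff_at i \<omega>))) = 0"
    by (rule antisym_sum_eq_0)
  then show ?thesis by (simp add: precomp_dH_eq)
qed

lemma multilinear_precomp_dH:
  assumes F: "multilinear F"
  shows "multilinear (precomp_dH F)"
  unfolding multilinear_def
proof (intro allI)
  fix l f
  have "linear (\<lambda>x. F (diff_at j (f(l := x))))" for j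
  proof -
    define \<Phi> where "\<Phi> x = (if l < j then sign_twist x else if l = j then dH x else x)" for x :: "'b form"
    have "linear \<Phi>"
      unfolding \<Phi>_def by (cases "l < j"; cases "l = j") (simp_all add: linear_sign_twist linear_dH linear_ident)
    moreover have "diff_at j (f(l := x)) = (diff_at j f)(l := \<Phi> x)" for x
      by (auto simp: diff_at_def \<Phi>_def)
    ultimately show ?thesis
      using linear_compose[OF \<open>linear \<Phi>\<close> multilinear_lin[OF F, of "diff_at j f" l]] by (simp add: o_def)
  qed
  then have "linear (\<lambda>x. \<Sum>j\<in>UNIV. F (diff_at j (f(l := x))))"
    by (intro linear_compose_sum) auto
  then show "linear (\<lambda>g. precomp_dH F (f(l := g)))"
    by (simp add: precomp_dH_eq)
qed


section \<open>The complex of operators\<close>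

definition indeg :: "('n::finite \<Rightarrow> 'd::finite set) \<Rightarrow> int" where
  "indeg \<epsilon> = (\<Sum>j\<in>UNIV. chain_deg (\<epsilon> j))"

lemma matrix_coeff_lincomb:
  "matrix_coeff (\<lambda>\<omega>. F \<omega> + c *\<^sub>R G \<omega>) \<epsilon> S = (\<lambda>h. matrix_coeff F \<epsilon> S h + c *\<^sub>R matrix_coeff G \<epsilon> S h)"
  by (simp add: matrix_coeff_def)

lemma multilinear_lincomb:
  assumes "multilinear F" "multilinear G"
  shows "multilinear (\<lambda>\<omega>. F \<omega> + c *\<^sub>R G \<omega>)"
  unfolding multilinear_def
  using multilinear_lin[OF assms(1)] multilinear_lin[OF assms(2)]
  by (intro allI linear_compose_add linear_compose_scale_right)

lemma LDO_lincomb: "A \<in> LDO \<Longrightarrow> B \<in> LDO \<Longrightarrow> (\<lambda>f. A f + c *\<^sub>R B f) \<in> LDO"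
  for A :: "('n::{finite,linorder}, 'd::finite) multi_op"
  by (intro LDO_add LDO_scaleR)

lemma DEnd_multilinear: "F \<in> DEnd k \<Longrightarrow> multilinear F"
  and DEnd_LDO: "F \<in> DEnd k \<Longrightarrow> matrix_coeff F \<epsilon> S \<in> LDO"
  and DEnd_degree: "F \<in> DEnd k \<Longrightarrow> chain_deg S \<noteq> indeg \<epsilon> + k \<Longrightarrow> matrix_coeff F \<epsilon> S = (\<lambda>_. 0)"
  by (simp_all add: DEnd_def indeg_def)

lemma DEnd_I:
  assumes "multilinear F" "\<And>\<epsilon> S. matrix_coeff F \<epsilon> S \<in> LDO"
    "\<And>\<epsilon> S. chain_deg S \<noteq> indeg \<epsilon> + k \<Longrightarrow> matrix_coeff F \<epsilon> S = (\<lambda>_. 0)"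
  shows "F \<in> DEnd k"
  using assms by (simp add: DEnd_def indeg_def)

lemma DEnd_lincomb: "F \<in> DEnd k \<Longrightarrow> G \<in> DEnd k \<Longrightarrow> (\<lambda>\<omega>. F \<omega> + c *\<^sub>R G \<omega>) \<in> DEnd k"
  by (rule DEnd_I)
    (auto simp: matrix_coeff_lincomb DEnd_degree intro: multilinear_lincomb LDO_lincomb DEnd_multilinear DEnd_LDO)

lemma multilinear_const_zero: "multilinear (\<lambda>_. 0)"
  by (simp add: multilinear_def linear_iff)

lemma DEnd_zero: "(\<lambda>_. 0) \<in> DEnd k"
  by (rule DEnd_I) (simp_all add: matrix_coeff_def multilinear_const_zero LDO_zero)

lemma delta_lincomb: "delta k (\<lambda>\<omega>. F \<omega> + c *\<^sub>R G \<omega>) = (\<lambda>\<omega>. delta k F \<omega> + c *\<^sub>R delta k G \<omega>)"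
  by (simp add: delta_def precomp_dH_eq linear_add[OF linear_dH] linear_scale[OF linear_dH] sum.distrib
      scaleR_sum_right algebra_simps fun_eq_iff)

lemma matrix_coeff_delta:
  assumes "multilinear F"
  shows "matrix_coeff (delta k F) \<epsilon> S = (\<lambda>h.
    (\<Sum>i\<in>S. wedge_sign i S *\<^sub>R total_deriv i (matrix_coeff F \<epsilon> (S - {i}) h)) +
    (- ((-1) powi k)) *\<^sub>R (\<Sum>j\<in>UNIV. \<Sum>i\<in>-\<epsilon> j. koszul_sign \<epsilon> j i *\<^sub>R
      precomp_total j i (matrix_coeff F (\<epsilon>(j := insert i (\<epsilon> j))) S) h))"
proof -
  have "delta k F = (\<lambda>\<omega>. dH (F \<omega>) + (- ((-1) powi k)) *\<^sub>R precomp_dH F \<omega>)"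
    by (simp add: delta_def)
  then show ?thesis
    by (simp only: matrix_coeff_lincomb matrix_coeff_dH matrix_coeff_precomp_dH[OF assms])
qed

lemma chain_deg_remove:
  fixes S :: "'d::finite set"
  assumes "i \<in> S"
  shows "chain_deg (S - {i}) = chain_deg S + 1"
proof -
  have "card S > 0" using assms by (auto simp: card_gt_0_iff)
  then show ?thesis using assms by (simp add: chain_deg_def of_nat_diff)
qed

lemma indeg_insert:
  fixes \<epsilon> :: "'n::finite \<Rightarrow> 'd::finite set"
  assumes "i \<notin> \<epsilon> j"
  shows "indeg (\<epsilon>(j := insert i (\<epsilon> j))) = indeg \<epsilon> - 1"
proof -
  have "chain_deg (insert i (\<epsilon> j)) = chain_deg (\<epsilon> j) - 1"
    using assms by (simp add: chain_deg_def)
  moreover have "(\<Sum>l\<in>UNIV - {j}. chain_deg ((\<epsilon>(j := insert i (\<epsilon> j))) l)) = (\<Sum>l\<in>UNIV - {j}. chain_deg (\<epsilon> l))"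
    by (rule sum.cong) auto
  ultimately show ?thesis
    by (simp add: indeg_def sum.remove[of UNIV j] del: fun_upd_apply) simp
qed

lemma precomp_total_zero: "precomp_total j i (\<lambda>_. 0) = (\<lambda>_. 0)"
  by (simp add: precomp_total_def)

lemma delta_DEnd:
  fixes F :: "('n::{finite,linorder}, 'd::{finite,linorder}) form_op"
  assumes F: "F \<in> DEnd k"
  shows "delta k F \<in> DEnd (k - 1)"
proof (rule DEnd_I)
  have m: "multilinear F" by (rule DEnd_multilinear[OF F])
  have "multilinear (\<lambda>\<omega>. dH (F \<omega>))"
    unfolding multilinear_def
  proof (intro allI)
    fix j f
    show "linear (\<lambda>g. dH (F (f(j := g))))"
      using linear_compose[OF multilinear_lin[OF m, of f j] linear_dH] by (simp add: o_def)
  qed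
  from multilinear_lincomb[OF this multilinear_precomp_dH[OF m], of "- ((-1) powi k)"]
  show "multilinear (delta k F)" by (simp add: delta_def)
  fix \<epsilon> :: "'n \<Rightarrow> 'd set" and S
  show "matrix_coeff (delta k F) \<epsilon> S \<in> LDO"
    unfolding matrix_coeff_delta[OF m]
    by (intro LDO_lincomb LDO_sum LDO_scaleR LDO_total_deriv LDO_precomp_total DEnd_LDO[OF F])
  assume deg: "chain_deg S \<noteq> indeg \<epsilon> + (k - 1)"
  have "matrix_coeff F \<epsilon> (S - {i}) = (\<lambda>_. 0)" if "i \<in> S" for i
    by (rule DEnd_degree[OF F]) (use deg chain_deg_remove[OF that] in simp)
  moreover have "matrix_coeff F (\<epsilon>(j := insert i (\<epsilon> j))) S = (\<lambda>_. 0)" if "i \<in> -\<epsilon> j" for i j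
    by (rule DEnd_degree[OF F]) (use deg indeg_insert[of i \<epsilon> j] that in simp)
  ultimately show "matrix_coeff (delta k F) \<epsilon> S = (\<lambda>_. 0)"
    unfolding matrix_coeff_delta[OF m] by (simp add: total_deriv_zero precomp_total_zero)
qed

text \<open>Both squares vanish, and the two mixed terms cancel because the sign in
  \<open>delta\<close> changes between \<open>k\<close> and \<open>k - 1\<close>.\<close>

lemma delta_delta:
  fixes F :: "('n::{finite,linorder}, 'd::{finite,linorder}) form_op"
  assumes F: "F \<in> DEnd k"
  shows "delta (k - 1) (delta k F) = (\<lambda>_. 0)"
proof
  fix \<omega>
  define c :: real where "c = (-1) powi k"
  have c: "(-1 :: real) powi (k - 1) = - c"
    by (simp add: c_def power_int_diff)
  have "precomp_dH (delta k F) \<omega> = dH (precomp_dH F \<omega>) - c *\<^sub>R precomp_dH (precomp_dH F) \<omega>"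
    by (simp add: precomp_dH_eq delta_def c_def sum_subtractf linear_sum[OF linear_dH] scaleR_sum_right)
  then have "precomp_dH (delta k F) \<omega> = dH (precomp_dH F \<omega>)"
    by (simp add: precomp_dH_precomp_dH[OF DEnd_multilinear[OF F]])
  moreover have "dH (delta k F \<omega>) = - (c *\<^sub>R dH (precomp_dH F \<omega>))"
    by (simp add: delta_def c_def linear_diff[OF linear_dH] linear_scale[OF linear_dH] dH_dH)
  ultimately show "delta (k - 1) (delta k F) \<omega> = 0"
    by (simp add: delta_def[of "k - 1"] c)
qed

lemma delta_cycle: "F \<in> DEnd (k + 1) \<Longrightarrow> delta (k + 1) F \<in> cycles k"
  for F :: "('n::{finite,linorder}, 'd::{finite,linorder}) form_op"
  using delta_DEnd[of F "k + 1"] delta_delta[of F "k + 1"] by (simp add: cycles_def)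

lemma cycles_lincomb: "F \<in> cycles k \<Longrightarrow> G \<in> cycles k \<Longrightarrow> (\<lambda>\<omega>. F \<omega> + c *\<^sub>R G \<omega>) \<in> cycles k"
  by (simp add: cycles_def DEnd_lincomb delta_lincomb)

lemma char_kernel_LDO: "A \<in> char_kernel \<Longrightarrow> A \<in> LDO"
  by (simp add: char_kernel_def)

lemma char_kernel_add: "A \<in> char_kernel \<Longrightarrow> B \<in> char_kernel \<Longrightarrow> (\<lambda>f. A f + B f) \<in> char_kernel"
  using char_kernel_sum[of UNIV "\<lambda>b. if b then A else B"] by (simp add: UNIV_bool add.commute)

lemma char_kernel_lincomb:
  "A \<in> char_kernel \<Longrightarrow> B \<in> char_kernel \<Longrightarrow> (\<lambda>f. A f + c *\<^sub>R B f) \<in> char_kernel"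
  by (intro char_kernel_add char_kernel_scaleR)

lemma char_kernel_zero: "(\<lambda>_. 0) \<in> char_kernel"
  using char_kernel_sum[of "{}"] by simp

lemma char_kernel_boundary:
  assumes "\<And>T. A T \<in> LDO"
  shows "(\<lambda>h. \<Sum>i\<in>S. wedge_sign i S *\<^sub>R total_deriv i (A (S - {i}) h)) \<in> char_kernel"
  by (intro char_kernel_sum char_kernel_scaleR char_kernel_total_deriv assms)

text \<open>
  Filtering by the degree of the arguments, the associated graded complex is a product of Koszul
  complexes; the next two lemmas solve \<open>\<delta> G = E\<close> one degree at a time.
\<close>

lemma lift_one_degree:
  fixes E :: "('n::{finite,linorder}, 'd::{finite,linorder}) form_op"
  assumes E: "E \<in> cycles k"
    and vanish: "\<And>\<epsilon> S. indeg \<epsilon> \<le> s \<Longrightarrow> matrix_coeff E \<epsilon> S = (\<lambda>_. 0)"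
    and top: "\<And>\<epsilon>. indeg \<epsilon> = s + 1 \<Longrightarrow> s + 1 + k > 0 \<or> matrix_coeff E \<epsilon> UNIV \<in> char_kernel"
  shows "\<exists>G\<in>DEnd (k + 1). (\<forall>\<epsilon> S. indeg \<epsilon> \<noteq> s + 1 \<longrightarrow> matrix_coeff G \<epsilon> S = (\<lambda>_. 0)) \<and>
    (\<forall>\<epsilon> S. indeg \<epsilon> \<le> s + 1 \<longrightarrow> matrix_coeff (delta (k + 1) G) \<epsilon> S = matrix_coeff E \<epsilon> S)"
proof -
  have ED: "E \<in> DEnd k" and dE: "delta k E = (\<lambda>_. 0)" using E by (simp_all add: cycles_def)
  \<comment> \<open>The precomposition part of \<open>delta k E\<close> sees \<open>E\<close> only
    at argument degree at most \<open>s\<close>, where it vanishes; hence \<open>E\<close> is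
    d_H-closed at argument degree \<open>s + 1\<close>.\<close>
  have E0: "matrix_coeff E (\<epsilon>(j := insert i (\<epsilon> j))) S = (\<lambda>_. 0)"
    if "i \<in> -\<epsilon> j" "indeg \<epsilon> \<le> s + 1" for i j \<epsilon> S
    by (rule vanish) (use indeg_insert[of i \<epsilon> j] that in simp)
  \<comment> \<open>The form degree of outputs of degree \<open>s + 1 + k\<close>. If that degree
    exceeds N, \<open>nat\<close> gives 0 and the condition \<open>card S + 1 = p\<close> leaves no
    nonzero preimage.\<close>
  define p where "p = nat (int CARD('d) - (s + 1 + k))"
  define P where "P \<epsilon> B \<longleftrightarrow> (\<forall>S. B S \<in> LDO \<and> (B S \<noteq> (\<lambda>_. 0) \<longrightarrow> card S + 1 = p)) \<and>
    (\<forall>S f. matrix_coeff E \<epsilon> S f = (\<Sum>i\<in>S. wedge_sign i S *\<^sub>R total_deriv i (B (S - {i}) f)))"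
    for \<epsilon> and B :: "'d set \<Rightarrow> ('n, 'd) multi_op"
  have "\<exists>B. P \<epsilon> B" if \<epsilon>: "indeg \<epsilon> = s + 1" for \<epsilon>
    unfolding P_def
  proof (rule koszul_LDO)
    show "matrix_coeff E \<epsilon> S \<in> LDO" for S by (rule DEnd_LDO[OF ED])
    show "card S = p" if "matrix_coeff E \<epsilon> S \<noteq> (\<lambda>_. 0)" for S
    proof -
      have "chain_deg S = indeg \<epsilon> + k" using DEnd_degree[OF ED] that by blast
      then show ?thesis by (simp add: p_def \<epsilon> chain_deg_def)
    qed
    show "(\<Sum>i\<in>S. wedge_sign i S *\<^sub>R total_deriv i (matrix_coeff E \<epsilon> (S - {i}) f)) = 0" for S f
    proof -
      have "matrix_coeff (delta k E) \<epsilon> S f = 0" by (simp add: dE matrix_coeff_def)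
      then show ?thesis
        unfolding matrix_coeff_delta[OF DEnd_multilinear[OF ED]]
        using E0[of _ \<epsilon>] \<epsilon> by (simp add: precomp_total_zero)
    qed
    assume "p = CARD('d)"
    \<comment> \<open>As N is positive, \<open>p = N\<close> is not a truncated value, so
      \<open>s + 1 + k = 0\<close> and the second alternative of \<open>top\<close> applies.\<close>
    then have "int CARD('d) - (s + 1 + k) = int CARD('d)"
      using zero_less_card_finite[where 'a = 'd] unfolding p_def by linarith
    then show "matrix_coeff E \<epsilon> UNIV \<in> char_kernel" using top[OF \<epsilon>] by auto
  qed
  then have "\<forall>\<epsilon>. \<exists>B. indeg \<epsilon> = s + 1 \<longrightarrow> P \<epsilon> B" by blast
  then obtain B where "\<forall>\<epsilon>. indeg \<epsilon> = s + 1 \<longrightarrow> P \<epsilon> (B \<epsilon>)" by (rule choice[THEN exE])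
  then have B: "\<And>\<epsilon> S. indeg \<epsilon> = s + 1 \<Longrightarrow> B \<epsilon> S \<in> LDO"
    "\<And>\<epsilon> S. indeg \<epsilon> = s + 1 \<Longrightarrow> B \<epsilon> S \<noteq> (\<lambda>_. 0) \<Longrightarrow> card S + 1 = p"
    "\<And>\<epsilon> S f. indeg \<epsilon> = s + 1 \<Longrightarrow> matrix_coeff E \<epsilon> S f
       = (\<Sum>i\<in>S. wedge_sign i S *\<^sub>R total_deriv i (B \<epsilon> (S - {i}) f))"
    unfolding P_def by blast+
  define B' where "B' \<epsilon> S = (if indeg \<epsilon> = s + 1 then B \<epsilon> S else (\<lambda>_. 0))" for \<epsilon> S
  have B': "B' \<epsilon> S \<in> LDO" for \<epsilon> S using B(1) by (auto simp: B'_def LDO_zero)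
  define G where "G = form_of B'"
  have mG: "multilinear G"
    unfolding G_def by (intro multilinear_form_of LDO_multilinear B')
  have cG: "matrix_coeff G \<epsilon> S = B' \<epsilon> S" for \<epsilon> S
    unfolding G_def by (intro matrix_coeff_form_of LDO_multilinear B')
  show ?thesis
  proof (intro bexI[of _ G] conjI allI impI)
    show "G \<in> DEnd (k + 1)"
    proof (rule DEnd_I[OF mG])
      show "matrix_coeff G \<epsilon> S \<in> LDO" for \<epsilon> S by (simp only: cG B')
      show "matrix_coeff G \<epsilon> S = (\<lambda>_. 0)" if "chain_deg S \<noteq> indeg \<epsilon> + (k + 1)" for \<epsilon> S
      proof (rule ccontr)
        assume nz: "matrix_coeff G \<epsilon> S \<noteq> (\<lambda>_. 0)"
        then have \<epsilon>: "indeg \<epsilon> = s + 1" by (auto simp: cG B'_def split: if_splits)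
        with nz have "card S + 1 = p" using B(2) by (simp add: cG B'_def)
        then have "int (card S) + 1 = int CARD('d) - (s + 1 + k)" unfolding p_def by linarith
        with that \<epsilon> show False by (simp add: chain_deg_def)
      qed
    qed
    show "matrix_coeff G \<epsilon> S = (\<lambda>_. 0)" if "indeg \<epsilon> \<noteq> s + 1" for \<epsilon> S
      using that by (simp add: cG B'_def)
    show "matrix_coeff (delta (k + 1) G) \<epsilon> S = matrix_coeff E \<epsilon> S" if \<epsilon>: "indeg \<epsilon> \<le> s + 1" for \<epsilon> S
    proof -
      \<comment> \<open>Up to argument degree \<open>s + 1\<close> the precomposition part of
        \<open>delta\<close> evaluates \<open>G\<close> at degrees where it is zero, so only d_H
        remains.\<close>
      have "B' (\<epsilon>(j := insert i (\<epsilon> j))) S = (\<lambda>_. 0)" if "i \<in> - \<epsilon> j" for i j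
        using indeg_insert[of i \<epsilon> j] that \<epsilon> by (simp add: B'_def)
      then have "matrix_coeff (delta (k + 1) G) \<epsilon> S
          = (\<lambda>h. \<Sum>i\<in>S. wedge_sign i S *\<^sub>R total_deriv i (B' \<epsilon> (S - {i}) h))"
        unfolding matrix_coeff_delta[OF mG] cG by (simp add: precomp_total_zero)
      also have "\<dots> = matrix_coeff E \<epsilon> S"
      proof (cases "indeg \<epsilon> = s + 1")
        case True
        then show ?thesis by (simp add: B'_def fun_eq_iff B(3))
      next
        case False
        then show ?thesis using vanish[of \<epsilon> S] \<epsilon> by (simp add: B'_def total_deriv_zero)
      qed
      finally show ?thesis .
    qed
  qed
qed

lemma indeg_nonneg: "indeg \<epsilon> \<ge> 0"
  unfolding indeg_def chain_deg_def by (intro sum_nonneg) (simp add: card_mono)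

lemma indeg_le: "indeg (\<epsilon> :: 'n::finite \<Rightarrow> 'd::finite set) \<le> int (CARD('n) * CARD('d))"
proof -
  have "indeg \<epsilon> \<le> (\<Sum>j\<in>(UNIV :: 'n set). int CARD('d))"
    unfolding indeg_def by (intro sum_mono) (simp add: chain_deg_def)
  then show ?thesis by simp
qed

lemma lift_all_degrees:
  fixes E :: "('n::{finite,linorder}, 'd::{finite,linorder}) form_op"
  assumes "E \<in> cycles k" "\<And>\<epsilon> S. indeg \<epsilon> \<le> s \<Longrightarrow> matrix_coeff E \<epsilon> S = (\<lambda>_. 0)" "s + 1 + k > 0"
  shows "\<exists>G\<in>DEnd (k + 1). (\<forall>\<epsilon> S. indeg \<epsilon> \<le> s \<longrightarrow> matrix_coeff G \<epsilon> S = (\<lambda>_. 0)) \<and> delta (k + 1) G = E"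
  using assms
proof (induction "nat (int (CARD('n) * CARD('d)) - s)" arbitrary: s E)
  case 0
  \<comment> \<open>Argument degrees are bounded by n N, so a cycle vanishing up to that degree is
    zero; this ends the recursion.\<close>
  then have "indeg \<epsilon> \<le> s" for \<epsilon> :: "'n \<Rightarrow> 'd set" using indeg_le[of \<epsilon>] by linarith
  then have "matrix_coeff E \<epsilon> S = matrix_coeff (\<lambda>_. 0) \<epsilon> S" for \<epsilon> S
    using 0(3) by (simp add: matrix_coeff_def[of "\<lambda>_. 0"])
  then have "E = (\<lambda>_. 0)"
    using 0(2) by (intro multilinear_eqI) (auto simp: cycles_def intro: DEnd_multilinear multilinear_const_zero)
  moreover have "delta (k + 1) (\<lambda>_. 0) = (\<lambda>_. 0)"
    by (simp add: delta_def precomp_dH_eq linear_0[OF linear_dH])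
  ultimately show ?case
    by (intro bexI[of _ "\<lambda>_. 0"]) (simp_all add: DEnd_zero matrix_coeff_def)
next
  case (Suc n)
  have "\<exists>G\<in>DEnd (k + 1). (\<forall>\<epsilon> S. indeg \<epsilon> \<noteq> s + 1 \<longrightarrow> matrix_coeff G \<epsilon> S = (\<lambda>_. 0)) \<and>
    (\<forall>\<epsilon> S. indeg \<epsilon> \<le> s + 1 \<longrightarrow> matrix_coeff (delta (k + 1) G) \<epsilon> S = matrix_coeff E \<epsilon> S)"
    by (rule lift_one_degree[OF Suc.prems(1,2)]) (use Suc.prems(3) in auto)
  then obtain G where G: "G \<in> DEnd (k + 1)" "\<And>\<epsilon> S. indeg \<epsilon> \<noteq> s + 1 \<Longrightarrow> matrix_coeff G \<epsilon> S = (\<lambda>_. 0)"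
    "\<And>\<epsilon> S. indeg \<epsilon> \<le> s + 1 \<Longrightarrow> matrix_coeff (delta (k + 1) G) \<epsilon> S = matrix_coeff E \<epsilon> S"
    by blast
  \<comment> \<open>The error is again a cycle and starts one degree higher. The condition
    \<open>s + 1 + k > 0\<close> persists as \<open>s\<close> grows, so no obstruction arises
    later.\<close>
  define E' where "E' = (\<lambda>\<omega>. E \<omega> + (-1) *\<^sub>R delta (k + 1) G \<omega>)"
  have "\<exists>H\<in>DEnd (k + 1). (\<forall>\<epsilon> S. indeg \<epsilon> \<le> s + 1 \<longrightarrow> matrix_coeff H \<epsilon> S = (\<lambda>_. 0)) \<and> delta (k + 1) H = E'"
  proof (rule Suc.hyps(1))
    show "n = nat (int (CARD('n) * CARD('d)) - (s + 1))" using Suc.hyps(2) by linarith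
    show "E' \<in> cycles k" unfolding E'_def by (intro cycles_lincomb Suc.prems(1) delta_cycle G(1))
    show "matrix_coeff E' \<epsilon> S = (\<lambda>_. 0)" if "indeg \<epsilon> \<le> s + 1" for \<epsilon> S
      unfolding E'_def matrix_coeff_lincomb G(3)[OF that] by simp
    show "s + 1 + 1 + k > 0" using Suc.prems(3) by simp
  qed
  then obtain H where H: "H \<in> DEnd (k + 1)" "\<And>\<epsilon> S. indeg \<epsilon> \<le> s + 1 \<Longrightarrow> matrix_coeff H \<epsilon> S = (\<lambda>_. 0)"
    "delta (k + 1) H = E'" by blast
  show ?case
  proof (intro bexI[of _ "\<lambda>\<omega>. G \<omega> + 1 *\<^sub>R H \<omega>"] conjI allI impI)
    show "delta (k + 1) (\<lambda>\<omega>. G \<omega> + 1 *\<^sub>R H \<omega>) = E"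
      unfolding delta_lincomb H(3) E'_def by simp
    show "(\<lambda>\<omega>. G \<omega> + 1 *\<^sub>R H \<omega>) \<in> DEnd (k + 1)" by (rule DEnd_lincomb[OF G(1) H(1)])
    show "matrix_coeff (\<lambda>\<omega>. G \<omega> + 1 *\<^sub>R H \<omega>) \<epsilon> S = (\<lambda>_. 0)" if "indeg \<epsilon> \<le> s" for \<epsilon> S
      unfolding matrix_coeff_lincomb using that G(2)[of \<epsilon> S] H(2)[of \<epsilon> S] by simp
  qed
qed

lemma boundaries_subset_cycles:
  "(boundaries k :: ('n::{finite,linorder}, 'd::{finite,linorder}) form_op set) \<subseteq> cycles k"
  by (auto simp: boundaries_def delta_cycle)

lemma cycles_pos_boundaries:
  assumes "k > 0"
  shows "(cycles k :: ('n::{finite,linorder}, 'd::{finite,linorder}) form_op set) \<subseteq> boundaries k"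
proof
  fix E :: "('n, 'd) form_op" assume E: "E \<in> cycles k"
  \<comment> \<open>Starting below all argument degrees, at \<open>s = -1\<close>, the condition
    \<open>s + 1 + k > 0\<close> is exactly \<open>k > 0\<close>.\<close>
  have "\<exists>G\<in>DEnd (k + 1). (\<forall>\<epsilon> S. indeg \<epsilon> \<le> -1 \<longrightarrow> matrix_coeff G \<epsilon> S = (\<lambda>_. 0)) \<and> delta (k + 1) G = E"
  proof (rule lift_all_degrees[OF E])
    show "matrix_coeff E \<epsilon> S = (\<lambda>_. 0)" if "indeg \<epsilon> \<le> -1" for \<epsilon> S
      using that indeg_nonneg[of \<epsilon>] by simp
  qed (use assms in simp)
  then show "E \<in> boundaries k" by (auto simp: boundaries_def)
qed

section \<open>Degree zero\<close>

lemma indeg_UNIV: "indeg (\<lambda>_. UNIV) = 0"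
  by (simp add: indeg_def chain_deg_def)

lemma chain_deg_nonneg: "chain_deg S \<ge> 0"
  by (simp add: chain_deg_def card_mono)

lemma chain_deg_eq_0: "chain_deg S = 0 \<longleftrightarrow> S = UNIV"
  using card_subset_eq[of UNIV S] by (auto simp: chain_deg_def)

lemma indeg_eq_0:
  assumes "indeg \<epsilon> = 0"
  shows "\<epsilon> = (\<lambda>_. UNIV)"
proof
  fix j
  have "chain_deg (\<epsilon> j) = 0"
    using assms sum_nonneg_eq_0_iff[of UNIV "\<lambda>j. chain_deg (\<epsilon> j)"]
    by (simp add: indeg_def chain_deg_nonneg)
  then show "\<epsilon> j = UNIV" by (simp add: chain_deg_eq_0)
qed

lemma indeg_eq_1:
  fixes \<epsilon> :: "'n::finite \<Rightarrow> 'd::finite set"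
  assumes "indeg \<epsilon> = 1"
  shows "\<exists>j i. \<epsilon> = (\<lambda>_. UNIV)(j := - {i})"
proof -
  obtain j where j: "chain_deg (\<epsilon> j) \<noteq> 0"
    using assms by (force simp: indeg_def)
  have "indeg \<epsilon> = chain_deg (\<epsilon> j) + (\<Sum>l\<in>UNIV - {j}. chain_deg (\<epsilon> l))"
    by (simp add: indeg_def sum.remove[of UNIV j])
  moreover have "(\<Sum>l\<in>UNIV - {j}. chain_deg (\<epsilon> l)) \<ge> 0" by (intro sum_nonneg chain_deg_nonneg)
  ultimately have c: "chain_deg (\<epsilon> j) = 1" "(\<Sum>l\<in>UNIV - {j}. chain_deg (\<epsilon> l)) = 0"
    using j assms chain_deg_nonneg[of "\<epsilon> j"] by linarith+
  have "\<epsilon> l = UNIV" if "l \<noteq> j" for l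
  proof -
    have "chain_deg (\<epsilon> l) = 0"
      using c(2) sum_nonneg_eq_0_iff[of "UNIV - {j}" "\<lambda>j. chain_deg (\<epsilon> j)"] that
      by (simp add: chain_deg_nonneg)
    then show ?thesis by (simp add: chain_deg_eq_0)
  qed
  moreover have "card (- \<epsilon> j) = 1"
  proof -
    have "card (\<epsilon> j) \<le> CARD('d)" by (simp add: card_mono)
    with c(1) show ?thesis
      by (simp add: Compl_eq_Diff_UNIV card_Diff_subset chain_deg_def)
  qed
  then obtain i where "- \<epsilon> j = {i}" by (auto simp: card_1_singleton_iff)
  then have "\<epsilon> j = - {i}" by auto
  ultimately have "\<epsilon> = (\<lambda>_. UNIV)(j := - {i})" by (auto simp: fun_eq_iff)
  then show ?thesis by blast
qed

text \<open>The first place where \<open>delta\<close> meets \<open>B0 F\<close>: with a single dx^i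
  missing, in slot \<open>j\<close>, it is the only differential that can be inserted, so
  precomposition has one term.\<close>

lemma matrix_coeff_delta_degree_1:
  fixes F :: "('n::{finite,linorder}, 'd::{finite,linorder}) form_op"
  assumes "multilinear F" and \<epsilon>: "\<epsilon> = (\<lambda>_. UNIV)(j := - {i})"
  shows "matrix_coeff (delta k F) \<epsilon> UNIV = (\<lambda>h.
    (\<Sum>i\<in>UNIV. wedge_sign i UNIV *\<^sub>R total_deriv i (matrix_coeff F \<epsilon> (UNIV - {i}) h)) +
    (- ((-1) powi k) * koszul_sign \<epsilon> j i) *\<^sub>R precomp_total j i (B0 F) h)"
proof -
  have upd: "\<epsilon>(j := insert i (\<epsilon> j)) = (\<lambda>_. UNIV)" by (auto simp: \<epsilon>)
  have "(\<Sum>l\<in>UNIV. \<Sum>m\<in>-\<epsilon> l. koszul_sign \<epsilon> l m *\<^sub>R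
      precomp_total l m (matrix_coeff F (\<epsilon>(l := insert m (\<epsilon> l))) UNIV) h)
    = (\<Sum>l\<in>{j}. \<Sum>m\<in>-\<epsilon> l. koszul_sign \<epsilon> l m *\<^sub>R
      precomp_total l m (matrix_coeff F (\<epsilon>(l := insert m (\<epsilon> l))) UNIV) h)" for h
    by (rule sum.mono_neutral_right) (auto simp: \<epsilon>)
  moreover have "- \<epsilon> j = {i}" by (simp add: \<epsilon>)
  ultimately show ?thesis
    unfolding matrix_coeff_delta[OF assms(1)] by (simp add: upd B0_def del: fun_upd_apply)
qed

lemma matrix_coeff_delta_degree_0:
  fixes F :: "('n::{finite,linorder}, 'd::{finite,linorder}) form_op"
  assumes "multilinear F"
  shows "matrix_coeff (delta k F) (\<lambda>_. UNIV) S
    = (\<lambda>h. \<Sum>i\<in>S. wedge_sign i S *\<^sub>R total_deriv i (matrix_coeff F (\<lambda>_. UNIV) (S - {i}) h))"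
  unfolding matrix_coeff_delta[OF assms(1)] by simp

lemma char_cycles_iff: "A \<in> char_cycles \<longleftrightarrow> A \<in> LDO \<and> (\<forall>j i. precomp_total j i A \<in> char_kernel)"
  by (auto simp: char_cycles_def char_kernel_def LDO_precomp_total)

lemma char_cycles_lincomb:
  "A \<in> char_cycles \<Longrightarrow> B \<in> char_cycles \<Longrightarrow> (\<lambda>f. A f + c *\<^sub>R B f) \<in> char_cycles"
proof -
  assume "A \<in> char_cycles" "B \<in> char_cycles"
  moreover have "precomp_total j i (\<lambda>f. A f + c *\<^sub>R B f)
      = (\<lambda>f. precomp_total j i A f + c *\<^sub>R precomp_total j i B f)" for j i
    by (simp add: precomp_total_def)
  ultimately show ?thesis by (simp add: char_cycles_iff LDO_lincomb char_kernel_lincomb)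
qed

lemma char_kernel_subset: "char_kernel \<subseteq> char_cycles"
  by (auto simp: char_cycles_iff char_kernel_LDO char_kernel_precomp)

text \<open>At argument degree 1, in top form degree, the cycle condition equates a nonzero multiple
  of \<open>precomp_total j i (B0 F)\<close> with a sum of total derivatives of operators, whose
  characteristic is zero.\<close>

lemma B0_cycles:
  fixes F :: "('n::{finite,linorder}, 'd::{finite,linorder}) form_op"
  assumes F: "F \<in> cycles 0"
  shows "B0 F \<in> char_cycles"
proof -
  have FD: "F \<in> DEnd 0" and dF: "delta 0 F = (\<lambda>_. 0)" using F by (simp_all add: cycles_def)
  have "precomp_total j i (B0 F) \<in> char_kernel" for j i
  proof -
    define \<epsilon> where "\<epsilon> = (\<lambda>_ :: 'n. UNIV :: 'd set)(j := - {i})"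
    define K where "K h = (\<Sum>i\<in>UNIV. wedge_sign i UNIV *\<^sub>R total_deriv i (matrix_coeff F \<epsilon> (UNIV - {i}) h))" for h
    define c where "c = - ((-1) powi 0) * koszul_sign \<epsilon> j i"
    have "K \<in> char_kernel"
      unfolding K_def by (rule char_kernel_boundary) (rule DEnd_LDO[OF FD])
    then have "(\<lambda>h. (- 1 / c) *\<^sub>R K h) \<in> char_kernel" by (rule char_kernel_scaleR)
    moreover have "(- 1 / c) *\<^sub>R K h = precomp_total j i (B0 F) h" for h
    proof -
      have "matrix_coeff (delta 0 F) \<epsilon> UNIV h = 0" by (simp add: dF matrix_coeff_def)
      then have "K h + c *\<^sub>R precomp_total j i (B0 F) h = 0"
        unfolding matrix_coeff_delta_degree_1[OF DEnd_multilinear[OF FD] \<epsilon>_def] K_def c_def .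
      then have "K h = (- c) *\<^sub>R precomp_total j i (B0 F) h"
        by (simp add: eq_neg_iff_add_eq_0)
      moreover have "c \<noteq> 0" by (simp add: c_def koszul_sign_nonzero)
      ultimately show ?thesis by simp
    qed
    ultimately show ?thesis by simp
  qed
  then show ?thesis unfolding char_cycles_iff B0_def using DEnd_LDO[OF FD] by blast
qed

text \<open>Extension of \<open>A\<close> by zero gives \<open>G\<close>, whose differential is a
  cycle of degree -1. The only obstruction to correcting \<open>G\<close> sits at argument degree 1
  and is a multiple of \<open>A\<close> precomposed with a total derivative, which has
  characteristic zero by assumption. Corrections vanish at argument degree 0, so they leave
  \<open>B0\<close> unchanged.\<close>

lemma B0_surj:
  fixes A :: "('n::{finite,linorder}, 'd::{finite,linorder}) multi_op"
  assumes A: "A \<in> char_cycles"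
  shows "\<exists>F\<in>cycles 0. B0 F = A"
proof -
  define C where "C \<epsilon> S = (if \<epsilon> = (\<lambda>_. UNIV) \<and> S = UNIV then A else (\<lambda>_. 0))"
    for \<epsilon> :: "'n \<Rightarrow> 'd set" and S :: "'d set"
  have C: "C \<epsilon> S \<in> LDO" for \<epsilon> S using A by (auto simp: C_def char_cycles_iff LDO_zero)
  define G where "G = form_of C"
  have mG: "multilinear G" unfolding G_def by (intro multilinear_form_of LDO_multilinear C)
  have cG: "matrix_coeff G \<epsilon> S = C \<epsilon> S" for \<epsilon> S
    unfolding G_def by (intro matrix_coeff_form_of LDO_multilinear C)
  have G: "G \<in> DEnd 0"
    by (rule DEnd_I[OF mG]) (auto simp: cG C, auto simp: C_def indeg_UNIV chain_deg_def)
  define E where "E = delta 0 G"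
  have E: "E \<in> cycles (-1)" using delta_cycle[of G "-1"] G by (simp add: E_def)
  have CU: "C \<epsilon> (UNIV - {i}) = (\<lambda>_. 0)" for \<epsilon> i by (auto simp: C_def)
  have CS: "C \<epsilon> (S - {i}) = (\<lambda>_. 0)" for \<epsilon> i S by (auto simp: C_def)
  \<comment> \<open>At argument degree 0 the only entry of \<open>G\<close> is a top form, which d_H
    kills.\<close>
  have E0: "matrix_coeff E \<epsilon> S = (\<lambda>_. 0)" if "indeg \<epsilon> \<le> 0" for \<epsilon> S
  proof -
    have "\<epsilon> = (\<lambda>_. UNIV)" using that indeg_nonneg[of \<epsilon>] by (intro indeg_eq_0) simp
    then show ?thesis by (simp add: E_def matrix_coeff_delta_degree_0[OF mG] cG CS total_deriv_zero)
  qed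
  have B0G: "B0 G = A" by (simp add: B0_def cG C_def)
  have E1: "matrix_coeff E \<epsilon> UNIV \<in> char_kernel" if deg: "indeg \<epsilon> = 1" for \<epsilon>
  proof -
    obtain j i where \<epsilon>: "\<epsilon> = (\<lambda>_. UNIV)(j := - {i})" using indeg_eq_1[OF deg] by blast
    have "matrix_coeff E \<epsilon> UNIV
        = (\<lambda>h. (- ((-1) powi 0) * koszul_sign \<epsilon> j i) *\<^sub>R precomp_total j i A h)"
      unfolding E_def matrix_coeff_delta_degree_1[OF mG \<epsilon>] by (simp add: cG CU total_deriv_zero B0G)
    then show ?thesis using A by (simp only: char_kernel_scaleR char_cycles_iff)
  qed
  \<comment> \<open>With \<open>s = 0\<close> and \<open>k = -1\<close> the sum
    \<open>s + 1 + k\<close> is zero, the one obstructed degree; \<open>E1\<close> supplies the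
    alternative in \<open>top\<close>.\<close>
  obtain G1 where G1: "G1 \<in> DEnd 0" "\<And>\<epsilon> S. indeg \<epsilon> \<noteq> 1 \<Longrightarrow> matrix_coeff G1 \<epsilon> S = (\<lambda>_. 0)"
    "\<And>\<epsilon> S. indeg \<epsilon> \<le> 1 \<Longrightarrow> matrix_coeff (delta 0 G1) \<epsilon> S = matrix_coeff E \<epsilon> S"
    using lift_one_degree[OF E, of 0] E0 E1 by auto
  define E' where "E' = (\<lambda>\<omega>. E \<omega> + (-1) *\<^sub>R delta 0 G1 \<omega>)"
  have E': "E' \<in> cycles (-1)"
    unfolding E'_def using delta_cycle[of G1 "-1"] G1(1) by (intro cycles_lincomb E) simp
  have "matrix_coeff E' \<epsilon> S = (\<lambda>_. 0)" if "indeg \<epsilon> \<le> 1" for \<epsilon> S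
    unfolding E'_def matrix_coeff_lincomb G1(3)[OF that] by simp
  \<comment> \<open>From \<open>s = 1\<close> on, \<open>s + 1 + k\<close> is positive and the
    remaining degrees are unobstructed.\<close>
  then obtain G2 where G2: "G2 \<in> DEnd 0" "\<And>\<epsilon> S. indeg \<epsilon> \<le> 1 \<Longrightarrow> matrix_coeff G2 \<epsilon> S = (\<lambda>_. 0)"
    "delta 0 G2 = E'"
    using lift_all_degrees[OF E', of 1] by auto
  define F where "F = (\<lambda>\<omega>. (\<lambda>\<omega>. G \<omega> + (-1) *\<^sub>R G1 \<omega>) \<omega> + (-1) *\<^sub>R G2 \<omega>)"
  have "F \<in> DEnd 0" unfolding F_def by (intro DEnd_lincomb G G1 G2)
  moreover have "delta 0 F = (\<lambda>_. 0)"
    unfolding F_def delta_lincomb G2(3) E'_def E_def[symmetric] by simp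
  moreover have "B0 F = A"
    unfolding B0_def F_def matrix_coeff_lincomb
    using G1(2)[of "\<lambda>_. UNIV" UNIV] G2(2)[of "\<lambda>_. UNIV" UNIV] B0G[unfolded B0_def]
    by (simp add: indeg_UNIV)
  ultimately show ?thesis by (auto simp: cycles_def)
qed

text \<open>For a cycle of degree 0 only argument degree 0 is obstructed, and the obstruction is the
  characteristic of \<open>B0 F\<close>. Conversely, all arguments of \<open>B0\<close> are top
  forms, so for a boundary the precomposition part has no terms and \<open>B0\<close> yields a sum
  of total derivatives.\<close>

lemma B0_kernel:
  fixes F :: "('n::{finite,linorder}, 'd::{finite,linorder}) form_op"
  assumes F: "F \<in> cycles 0"
  shows "B0 F \<in> char_kernel \<longleftrightarrow> F \<in> boundaries 0"
proof
  assume B0: "B0 F \<in> char_kernel"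
  have "matrix_coeff F \<epsilon> S = (\<lambda>_. 0)" if "indeg \<epsilon> \<le> -1" for \<epsilon> S
    using that indeg_nonneg[of \<epsilon>] by simp
  moreover have "matrix_coeff F \<epsilon> UNIV \<in> char_kernel" if "indeg \<epsilon> = 0" for \<epsilon>
    using B0 indeg_eq_0[OF that] by (simp add: B0_def)
  ultimately obtain G where G: "G \<in> DEnd 1"
    "\<And>\<epsilon> S. indeg \<epsilon> \<le> 0 \<Longrightarrow> matrix_coeff (delta 1 G) \<epsilon> S = matrix_coeff F \<epsilon> S"
    using lift_one_degree[OF F, of "-1"] by auto
  define E where "E = (\<lambda>\<omega>. F \<omega> + (-1) *\<^sub>R delta 1 G \<omega>)"
  have E: "E \<in> cycles 0"
    unfolding E_def using delta_cycle[of G 0] G(1) by (intro cycles_lincomb F) simp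
  have "matrix_coeff E \<epsilon> S = (\<lambda>_. 0)" if "indeg \<epsilon> \<le> 0" for \<epsilon> S
    unfolding E_def matrix_coeff_lincomb G(2)[OF that] by simp
  \<comment> \<open>After the single obstructed step, \<open>s = 0\<close> gives
    \<open>s + 1 + k = 1\<close>.\<close>
  then obtain H where H: "H \<in> DEnd 1" "delta 1 H = E"
    using lift_all_degrees[OF E, of 0] by auto
  have "F = delta 1 (\<lambda>\<omega>. G \<omega> + 1 *\<^sub>R H \<omega>)"
    unfolding delta_lincomb H(2) E_def by simp
  then show "F \<in> boundaries 0"
    using DEnd_lincomb[OF G(1) H(1), of 1] by (auto simp: boundaries_def)
next
  assume "F \<in> boundaries 0"
  then obtain G where G: "G \<in> DEnd 1" "F = delta 1 G" by (auto simp: boundaries_def)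
  show "B0 F \<in> char_kernel"
    unfolding B0_def G(2) matrix_coeff_delta_degree_0[OF DEnd_multilinear[OF G(1)]]
    by (rule char_kernel_boundary) (rule DEnd_LDO[OF G(1)])
qed

section \<open>The homology groups\<close>

lemma pointwise_comm_group:
  fixes V :: "('a \<Rightarrow> 'b::real_vector) set"
  assumes "(\<lambda>_. 0) \<in> V" "\<And>f g c. f \<in> V \<Longrightarrow> g \<in> V \<Longrightarrow> (\<lambda>x. f x + c *\<^sub>R g x) \<in> V"
  shows "comm_group (pointwise_group V)"
proof (rule comm_groupI)
  fix f g assume "f \<in> carrier (pointwise_group V)" "g \<in> carrier (pointwise_group V)"
  then show "f \<otimes>\<^bsub>pointwise_group V\<^esub> g \<in> carrier (pointwise_group V)"
    using assms(2)[of f g 1] by (simp add: pointwise_group_def)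
next
  fix f assume "f \<in> carrier (pointwise_group V)"
  then have "(\<lambda>x. - f x) \<in> V"
    using assms(2)[OF assms(1), of f "-1"] by (simp add: pointwise_group_def)
  then show "\<exists>g\<in>carrier (pointwise_group V). g \<otimes>\<^bsub>pointwise_group V\<^esub> f = \<one>\<^bsub>pointwise_group V\<^esub>"
    by (intro bexI[of _ "\<lambda>x. - f x"]) (simp_all add: pointwise_group_def)
qed (simp_all add: pointwise_group_def assms(1) add_ac)

lemma pointwise_subgroup:
  fixes V W :: "('a \<Rightarrow> 'b::real_vector) set"
  assumes "comm_group (pointwise_group V)" "W \<subseteq> V"
    and "(\<lambda>_. 0) \<in> W" "\<And>f g c. f \<in> W \<Longrightarrow> g \<in> W \<Longrightarrow> (\<lambda>x. f x + c *\<^sub>R g x) \<in> W"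
  shows "subgroup W (pointwise_group V)"
proof -
  interpret G: comm_group "pointwise_group V" by (rule assms(1))
  show ?thesis
  proof (rule G.subgroupI)
    fix f assume f: "f \<in> W"
    have m: "(\<lambda>x. - f x) \<in> W" using assms(4)[OF assms(3) f, of "-1"] by simp
    have "inv\<^bsub>pointwise_group V\<^esub> f = (\<lambda>x. - f x)"
      by (rule G.inv_equality) (use f m assms(2) in \<open>auto simp: pointwise_group_def\<close>)
    with m show "inv\<^bsub>pointwise_group V\<^esub> f \<in> W" by simp
  next
    fix f g assume "f \<in> W" "g \<in> W"
    then show "f \<otimes>\<^bsub>pointwise_group V\<^esub> g \<in> W"
      using assms(4)[of f g 1] by (simp add: pointwise_group_def)
  qed (use assms(2,3) in \<open>auto simp: pointwise_group_def\<close>)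
qed

lemma trivial_factor_group:
  assumes "comm_group G"
  shows "trivial_group (G Mod carrier G)"
proof -
  interpret comm_group G by (rule assms)
  have s: "subgroup (carrier G) G" by (rule subgroup_self)
  have "carrier G #>\<^bsub>G\<^esub> x = carrier G" if "x \<in> carrier G" for x
    by (rule coset_join2[OF that s that])
  then have "carrier (G Mod carrier G) = {carrier G}"
    by (auto simp: carrier_FactGroup intro: one_closed)
  moreover have "group (G Mod carrier G)"
    by (rule normal.factorgroup_is_group[OF subgroup_imp_normal[OF s]])
  ultimately show ?thesis by (simp add: trivial_group_def)
qed

lemma delta_zero: "delta k (\<lambda>_. 0) = (\<lambda>_. 0)"
  by (simp add: delta_def precomp_dH_eq linear_0[OF linear_dH])

lemma cycles_zero: "(\<lambda>_. 0) \<in> cycles k"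
  by (simp add: cycles_def DEnd_zero delta_zero)

lemma boundaries_zero: "(\<lambda>_. 0) \<in> boundaries k"
  unfolding boundaries_def by (rule image_eqI[where x = "\<lambda>_. 0"]) (simp_all add: delta_zero DEnd_zero)

theorem theorem4p8:
  shows "(\<forall>k>0. trivial_group (homology k ::
            ('n::{finite,linorder}, 'd::{finite,linorder}) form_op set monoid)) \<and>
         (\<exists>\<phi> \<in> iso (homology 0 :: ('n, 'd) form_op set monoid)
                    (pointwise_group char_cycles Mod (char_kernel :: ('n, 'd) multi_op set)).
            \<forall>F \<in> cycles 0.
              \<phi> (boundaries 0 #>\<^bsub>pointwise_group (cycles 0)\<^esub> F)
                = char_kernel #>\<^bsub>pointwise_group char_cycles\<^esub> B0 F) \<and>
         B0 ` (cycles 0 :: ('n, 'd) form_op set) = char_cycles"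
proof (intro conjI allI impI)
  fix k :: int assume k: "0 < k"
  have "boundaries k = carrier (pointwise_group (cycles k :: ('n, 'd) form_op set))"
    using boundaries_subset_cycles cycles_pos_boundaries[OF k] by (auto simp: pointwise_group_def)
  then show "trivial_group (homology k :: ('n, 'd) form_op set monoid)"
    unfolding homology_def
    by (simp only:) (intro trivial_factor_group pointwise_comm_group cycles_zero cycles_lincomb)
next
  show surj: "B0 ` (cycles 0 :: ('n, 'd) form_op set) = char_cycles"
    using B0_cycles B0_surj by (force simp: image_iff)
  define Z where "Z = pointwise_group (cycles 0 :: ('n, 'd) form_op set)"
  define C where "C = pointwise_group (char_cycles :: ('n, 'd) multi_op set)"
  \<comment> \<open>\<open>B0\<close> followed by the projection to the quotient; its kernel is
    found from \<open>B0_kernel\<close>, and the first isomorphism theorem applies.\<close>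
  define h where "h F = char_kernel #>\<^bsub>C\<^esub> B0 F" for F :: "('n, 'd) form_op"
  have cz: "carrier Z = cycles 0" "carrier C = char_cycles" by (simp_all add: Z_def C_def pointwise_group_def)
  interpret Z: comm_group Z
    unfolding Z_def by (intro pointwise_comm_group cycles_zero cycles_lincomb)
  interpret C: comm_group C
    unfolding C_def
    by (intro pointwise_comm_group char_cycles_lincomb subsetD[OF char_kernel_subset char_kernel_zero])
  have sub: "subgroup char_kernel C"
    unfolding C_def using C.comm_group_axioms[unfolded C_def]
    by (intro pointwise_subgroup char_kernel_subset char_kernel_zero char_kernel_lincomb)
  interpret N: normal char_kernel C by (rule C.subgroup_imp_normal[OF sub])
  have "h \<in> hom Z (C Mod char_kernel)"
  proof (rule homI)
    fix F assume "F \<in> carrier Z"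
    then show "h F \<in> carrier (C Mod char_kernel)"
      using B0_cycles by (auto simp: h_def carrier_FactGroup cz)
  next
    fix F G assume FG: "F \<in> carrier Z" "G \<in> carrier Z"
    have "B0 (F \<otimes>\<^bsub>Z\<^esub> G) = B0 F \<otimes>\<^bsub>C\<^esub> B0 G"
      by (simp add: Z_def C_def pointwise_group_def B0_def matrix_coeff_def)
    then show "h (F \<otimes>\<^bsub>Z\<^esub> G) = h F \<otimes>\<^bsub>C Mod char_kernel\<^esub> h G"
      using FG by (simp add: h_def cz B0_cycles N.rcos_sum)
  qed
  then interpret h: group_hom Z "C Mod char_kernel" h
    by (simp add: group_hom_def group_hom_axioms_def Z.group_axioms N.factorgroup_is_group)
  have ker: "kernel Z (C Mod char_kernel) h = boundaries 0"
  proof -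
    have "h F = char_kernel \<longleftrightarrow> F \<in> boundaries 0" if "F \<in> cycles 0" for F
      using C.coset_join1[OF _ _ sub, of "B0 F"] C.coset_join2[OF _ sub, of "B0 F"]
        B0_cycles[OF that] B0_kernel[OF that] by (auto simp: h_def cz)
    then show ?thesis
      using boundaries_subset_cycles[of 0] by (auto simp: kernel_def cz)
  qed
  have "h ` carrier Z = carrier (C Mod char_kernel)"
    unfolding carrier_FactGroup cz surj[symmetric] by (auto simp: h_def image_image)
  from h.FactGroup_iso_set[OF this] have iso:
    "(\<lambda>X. the_elem (h ` X)) \<in> iso (Z Mod boundaries 0) (C Mod char_kernel)"
    by (simp only: ker)
  \<comment> \<open>The isomorphism takes the single element of the image of a coset. On the coset
    of \<open>F\<close> this is \<open>h F\<close>, since \<open>boundaries 0\<close> is the kernel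
    of \<open>h\<close>; hence the map is the one induced by \<open>B0\<close>.\<close>
  have "the_elem (h ` (boundaries 0 #>\<^bsub>Z\<^esub> F)) = h F" if F: "F \<in> cycles 0" for F
  proof -
    have "h (b \<otimes>\<^bsub>Z\<^esub> F) = h F" if "b \<in> boundaries 0" for b
      using that F h.H.l_one[OF h.hom_closed[of F]] unfolding ker[symmetric] by (simp add: kernel_def cz)
    moreover have "boundaries 0 #>\<^bsub>Z\<^esub> F = (\<lambda>b. b \<otimes>\<^bsub>Z\<^esub> F) ` boundaries 0"
      by (auto simp: r_coset_def)
    ultimately have "h ` (boundaries 0 #>\<^bsub>Z\<^esub> F) = {h F}"
      using boundaries_zero[of 0] by (auto simp: image_iff)
    then show ?thesis by simp
  qed
  then show "\<exists>\<phi> \<in> iso (homology 0 :: ('n, 'd) form_op set monoid)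
                    (pointwise_group char_cycles Mod (char_kernel :: ('n, 'd) multi_op set)).
            \<forall>F \<in> cycles 0.
              \<phi> (boundaries 0 #>\<^bsub>pointwise_group (cycles 0)\<^esub> F)
                = char_kernel #>\<^bsub>pointwise_group char_cycles\<^esub> B0 F"
    unfolding homology_def Z_def[symmetric] C_def[symmetric] h_def[symmetric]
    by (intro bexI[OF _ iso] ballI)
qed

end
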